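(* Let $0<q<1$ and let $$s(q)=\frac{\pi q^2+2(1-q^2)\sin^{-1}\!\big(\frac{q}{1+q}\big)}{2q\sqrt{1+2q}}.$$ If $\delta$ is the density of a doubly periodic triangulated packing of disks in the plane with all radii between $q$ and $1$ (that is, in $[q,1]$), then $\delta<s(q)$.
   Context: A disk packing in the plane is a collection of closed circular disks with pairwise disjoint interiors. It is doubly periodic if it is invariant under a lattice of translations with two linearly independent generators, with finitely many disks per fundamental region of the lattice. Its density is the area of the part of a fundamental region covered by the disks divided by the area of the fundamental region. The contact graph of a packing is obtained by joining, by straight segments, the centers of every two tangent disks. The packing is triangulated (or compact) if its contact graph is a triangulation of the plane, i.e. all faces of the contact graph are triangles. *)

theory Defs
  imports "HOL-Analysis.Analysis"
begin

text \<open>A closed disk is encoded by its center and radius; packings consist of pairs with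
  positive radius, for which this encoding is injective.\<close>

type_synonym plane = "real ^ 2"
type_synonym disk = "plane \<times> real"

definition disk_set :: "disk \<Rightarrow> plane set" where
  "disk_set d = cball (fst d) (snd d)"

definition disk_packing :: "disk set \<Rightarrow> bool" where
  "disk_packing P \<longleftrightarrow>
     (\<forall>d\<in>P. 0 < snd d) \<and>
     pairwise (\<lambda>d e. disjnt (interior (disk_set d)) (interior (disk_set e))) P"

definition lattice_of :: "plane \<Rightarrow> plane \<Rightarrow> plane set" where
  "lattice_of u v = {of_int m *\<^sub>R u + of_int n *\<^sub>R v | m n :: int. True}"

definition fundamental_region :: "plane \<Rightarrow> plane \<Rightarrow> plane set" where
  "fundamental_region u v = {s *\<^sub>R u + t *\<^sub>R v | s t :: real. 0 \<le> s \<and> s < 1 \<and> 0 \<le> t \<and> t < 1}"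

text \<open>The condition \<open>u \<noteq> v\<close> is needed since \<open>{u, u}\<close> collapses to a singleton. A disk is counted
  in the fundamental region containing its center, so each orbit of disks under the lattice is
  counted once.\<close>

definition doubly_periodic :: "plane \<Rightarrow> plane \<Rightarrow> disk set \<Rightarrow> bool" where
  "doubly_periodic u v P \<longleftrightarrow>
     u \<noteq> v \<and> independent {u, v} \<and>
     (\<forall>l\<in>lattice_of u v. (\<lambda>(c, r). (c + l, r)) ` P = P) \<and>
     finite {d \<in> P. fst d \<in> fundamental_region u v}"

definition packing_density :: "plane \<Rightarrow> plane \<Rightarrow> disk set \<Rightarrow> real" where
  "packing_density u v P =
     measure lebesgue (fundamental_region u v \<inter> (\<Union>d\<in>P. disk_set d)) /
     measure lebesgue (fundamental_region u v)"

text \<open>This is external tangency, the only kind possible between disks of a packing.\<close>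

definition tangent :: "disk \<Rightarrow> disk \<Rightarrow> bool" where
  "tangent d e \<longleftrightarrow> dist (fst d) (fst e) = snd d + snd e"

text \<open>The vertices are included explicitly so that a center without any contacts (which lies on
  no edge) still belongs to the drawn graph and prevents the face around it from being a
  triangle.\<close>

definition contact_graph_drawing :: "disk set \<Rightarrow> plane set" where
  "contact_graph_drawing P =
     fst ` P \<union> \<Union>{closed_segment (fst d) (fst e) | d e. d \<in> P \<and> e \<in> P \<and> tangent d e}"

definition contact_graph_faces :: "disk set \<Rightarrow> plane set set" where
  "contact_graph_faces P = components (- contact_graph_drawing P)"

text \<open>A triangular face is the open region enclosed by three edges of the contact graph. The
  triangle is automatically nondegenerate, since radii are positive.\<close>

definition triangulated :: "disk set \<Rightarrow> bool" where
  "triangulated P \<longleftrightarrow>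
     (\<forall>F\<in>contact_graph_faces P. \<exists>d1\<in>P. \<exists>d2\<in>P. \<exists>d3\<in>P.
        tangent d1 d2 \<and> tangent d2 d3 \<and> tangent d3 d1 \<and>
        F = interior (convex hull {fst d1, fst d2, fst d3}))"

definition s :: "real \<Rightarrow> real" where
  "s q = (pi * q\<^sup>2 + 2 * (1 - q\<^sup>2) * arcsin (q / (1 + q))) / (2 * q * sqrt (1 + 2 * q))"

end

theory Submission imports Defs begin

text \<open>
  Since every disk that meets a face of the contact graph is one of the three disks centred at its
  vertices, the covered part of a face consists of three sectors whose angles are determined by the
  radii, and it suffices to prove that a triangle with radii in \<open>[q, 1]\<close> has density at most
  \<open>s q\<close>, with equality only for the radii \<open>q, q, 1\<close>.  By scaling and because \<open>s\<close> decreases, the radii may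
  be taken to be \<open>q, y, 1\<close>.  Along this family the density first falls and then rises, so only the
  end \<open>y = 1\<close> has to be compared with \<open>y = q\<close>.

  A packing all of whose faces have radii \<open>q, q, 1\<close> does not exist: the angle \<open>\<beta>\<close> at a disk of radius \<open>q\<close>
  lies strictly between \<open>\<pi>/3\<close> and \<open>\<pi>/2\<close>, and walking around such a disk the neighbours at the angles \<open>0\<close>,
  \<open>\<beta>\<close>, \<open>2\<beta>\<close>, ... have radii \<open>q, 1, q, 1, q, 1\<close> alternately.  The neighbour at \<open>5\<beta>\<close> is then closer than
  \<open>\<beta>\<close> to the first one, which is impossible.  Hence some face has density less than \<open>s q\<close>.

  Finally, the union of the faces whose lower left corner lies in the fundamental region is itself
  a fundamental region up to a null set, and the density can be computed there face by face.
\<close>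

section \<open>The density function and its monotonicity\<close>


text \<open>\<open>s q\<close> is the density of the triangle with radii \<open>q, q, 1\<close>, so
  the bound for a single triangle is attained. Moreover, as \<open>q\<close> tends to 0 or 1 the
  triangles with radii \<open>q, 1, 1\<close> and \<open>q, q, 1\<close> reach the same density. The
  comparisons therefore degenerate at both ends of the parameter range and crude estimates fail
  there. They are settled by sign patterns instead: a function that is nonnegative at both ends and
  whose derivative changes sign at most once, from positive to negative, is positive in between.
  Derivatives are taken until only algebraic functions and the constant \<open>pi\<close> are left.

  Attainment also shapes the summation over faces: non-strict bounds alone would give only a
  non-strict result, so one strict face has to be found, moved into the chosen period and split off
  from the sum; the finite area of the period lets the strictness survive.

  Only an upper bound for the area of a sector enters. It follows from rotation invariance, by
  cutting a disk into congruent sectors, and avoids integration in polar coordinates.\<close>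

lemma mvt_obtain:
  fixes f f' :: "real \<Rightarrow> real"
  assumes "a < b" and "continuous_on {a..b} f"
    and "\<And>x. a < x \<Longrightarrow> x < b \<Longrightarrow> (f has_real_derivative f' x) (at x)"
  obtains z where "a < z" "z < b" "f b - f a = (b - a) * f' z"
proof -
  have "\<exists>l z. a < z \<and> z < b \<and> DERIV f z :> l \<and> f b - f a = (b - a) * l"
    using assms by (intro MVT) (auto simp: real_differentiable_def)
  then obtain l z where z: "a < z" "z < b" "DERIV f z :> l" "f b - f a = (b - a) * l" by blast
  then have "l = f' z" using assms(3) DERIV_unique by blast
  with z that show ?thesis by blast
qed

text \<open>The sign condition makes \<open>f\<close> rise first and fall afterwards. If
  \<open>f x\<close> were nonpositive, the mean value theorem on either side of \<open>x\<close>
  would give a point with \<open>f' \<le> 0\<close> followed by one with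
  \<open>f' \<ge> 0\<close>.\<close>

lemma positive_between:
  fixes f f' :: "real \<Rightarrow> real"
  assumes "continuous_on {a..b} f"
    and der: "\<And>x. a < x \<Longrightarrow> x < b \<Longrightarrow> (f has_real_derivative f' x) (at x)"
    and "0 \<le> f a" "0 \<le> f b"
    and sgn: "\<And>x y. a < x \<Longrightarrow> x < y \<Longrightarrow> y < b \<Longrightarrow> f' x \<le> 0 \<Longrightarrow> f' y < 0"
    and x: "a < x" "x < b"
  shows "0 < f x"
proof (rule ccontr)
  assume neg: "\<not> 0 < f x"
  obtain y where y: "a < y" "y < x" "f x - f a = (x - a) * f' y"
    using x by (rule_tac mvt_obtain[of a x f f'])
      (auto intro: continuous_on_subset[OF assms(1)] der)
  obtain z where z: "x < z" "z < b" "f b - f x = (b - x) * f' z"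
    using x by (rule_tac mvt_obtain[of x b f f'])
      (auto intro: continuous_on_subset[OF assms(1)] der)
  have "(x - a) * f' y \<le> 0" using y(3) neg assms(3) by linarith
  then have "f' y \<le> 0" using x by (simp add: mult_le_0_iff)
  then have "f' z < 0" using sgn[of y z] y z by auto
  then have "(b - x) * f' z < 0" using x by (simp add: mult_pos_neg)
  then show False using z(3) neg assms(4) by linarith
qed

lemma sin_cos_bounds_below_sixth:
  fixes t :: real
  assumes "0 < t" "t < pi/6"
  shows "0 < sin t" "sin t < 1/2" "0 < cos t" 
proof -
  show "0 < sin t" using assms pi_gt_zero by (intro sin_gt_zero) linarith+
  have "sin t < sin (pi/6)" using assms pi_gt_zero by (subst sin_mono_less_eq) linarith+
  then show "sin t < 1/2" by (simp add: sin_30)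
  show "0 < cos t" using assms pi_gt_zero by (intro cos_gt_zero) linarith+
qed

text \<open>This is \<open>t \<le> tan t\<close> without the division; the difference has derivative
  \<open>t * sin t\<close>.\<close>

lemma mult_cos_le_sin: 
  fixes t :: real
  assumes "0 < t" "t < pi/2"
  shows "t * cos t \<le> sin t"
proof -
  obtain z where z: "0 < z" "z < t" "(sin t - t * cos t) - (sin 0 - 0 * cos 0) = (t - 0) * (z * sin z)"
    using assms(1)
    by (rule_tac mvt_obtain[of 0 t "\<lambda>t. sin t - t * cos t" "\<lambda>t. t * sin t"])
       (auto intro!: derivative_eq_intros continuous_intros)
  have "0 < sin z" using z assms by (intro sin_gt_zero) auto
  then have "0 \<le> (t - 0) * (z * sin z)" using z assms by simp
  with z(3) show ?thesis by simp
qed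

text \<open>The expression is minus the numerator of the derivative of
  \<open>sector_quotient\<close>. It vanishes at both 0 and \<open>pi/6\<close>, so there is no
  slack at either end. Its derivative has the sign of the factor \<open>?J\<close>, which is
  strictly decreasing.\<close>

lemma sector_quotient_slope_pos:
  fixes t :: real
  assumes "0 < t" "t < pi/6"
  shows "0 < t * (1 - 2*(sin t)^2 + 2*(sin t)^3) - pi/2 * (sin t)^2 - (1 - 2 * sin t) * sin t * cos t"
proof (rule positive_between[where a=0 and b="pi/6" and x=t
    and f="\<lambda>t. t * (1 - 2*(sin t)^2 + 2*(sin t)^3) - pi/2 * (sin t)^2 - (1 - 2 * sin t) * sin t * cos t"
    and f'="\<lambda>t. sin t * cos t * (4 * cos t - t * (4 - 6 * sin t) - pi)"])
  let ?J = "\<lambda>t. 4 * cos t - t * (4 - 6 * sin t) - pi :: real"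
  show "continuous_on {0..pi/6} (\<lambda>t. t * (1 - 2*(sin t)^2 + 2*(sin t)^3) - pi/2 * (sin t)^2 - (1 - 2 * sin t) * sin t * cos t)"
    by (intro continuous_intros)
  show "((\<lambda>t. t * (1 - 2*(sin t)^2 + 2*(sin t)^3) - pi/2 * (sin t)^2 - (1 - 2 * sin t) * sin t * cos t)
     has_real_derivative sin x * cos x * ?J x) (at x)" for x :: real
  proof (rule derivative_eq_intros refl)+
    have c2: "cos x * cos x = 1 - sin x * sin x" using sin_cos_squared_add[of x] by (simp add: power2_eq_square)
    then have c3: "cos x * (cos x * y) = (1 - sin x * sin x) * y" for y by (metis mult.assoc)
    show "1 * (1 - 2*(sin x)^2 + 2*(sin x)^3) + (0 - (0 * (sin x)\<^sup>2 + of_nat 2 * (cos x * 1 * sin x ^ (2 - Suc 0)) * 2) + (0 * (sin x)^3 + of_nat 3 * (cos x * 1 * sin x ^ (3 - Suc 0)) * 2)) * x - (0 * (sin x)\<^sup>2 + of_nat 2 * (cos x * 1 * sin x ^ (2 - Suc 0)) * (pi / 2)) - (((0 - (0 * sin x + cos x * 1 * 2)) * sin x + cos x * 1 * (1 - 2 * sin x)) * cos x + - sin x * 1 * ((1 - 2 * sin x) * sin x)) = sin x * cos x * ?J x" 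
      apply (simp add: power2_eq_square power3_eq_cube algebra_simps c2 c3)
      done
  qed
  show "sin y * cos y * ?J y < 0" if xy: "0 < x" "x < y" "y < pi/6" "sin x * cos x * ?J x \<le> 0" for x y
  proof -
    have "?J x \<le> 0" using sin_cos_bounds_below_sixth[of x] xy by (simp add: mult_le_0_iff)
    obtain z where z: "x < z" "z < y" "?J y - ?J x = (y - x) * (6 * z * cos z + 2 * sin z - 4 )"
      using xy(2) by (rule_tac mvt_obtain[of x y ?J "\<lambda>z. 6 * z * cos z + 2 * sin z - 4"])
       (auto intro!: derivative_eq_intros continuous_intros)
    have "6 * (z * cos z) \<le> 6 * sin z" using mult_cos_le_sin[of z] z xy by simp
    moreover have "sin z < 1/2" using sin_cos_bounds_below_sixth[of z] z xy by simp
    ultimately have "6 * z * cos z + 2 * sin z - 4 < 0" by (simp add: mult.assoc)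
    then have "?J y - ?J x < 0" unfolding z(3) using xy by (simp add: mult_pos_neg)
    with \<open>?J x \<le> 0\<close> have "?J y < 0" by simp
    then show ?thesis using sin_cos_bounds_below_sixth[of y] xy by (simp add: mult_pos_neg)
  qed
qed (use assms in \<open>simp_all add: sin_30 cos_30 power2_eq_square power3_eq_cube\<close>)

text \<open>The density of the isosceles triangle with legs of length 1 and half apex angle
  \<open>t\<close>, which belongs to one disk of radius \<open>1 - sin t\<close> and two of radius
  \<open>sin t\<close>. For radii \<open>q, q, 1\<close> this means
  \<open>sin t = q/(1+q)\<close>.\<close>

definition sector_quotient :: "real \<Rightarrow> real" where
  "sector_quotient t = (pi/2 * (sin t)^2 + (1 - 2 * sin t) * t) / (sin t * cos t)"

lemma sector_quotient_antimono:
  assumes "0 < a" "a < b" "b \<le> pi/6"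
  shows "sector_quotient b < sector_quotient a"
proof -
  let ?K = "\<lambda>t. t * (1 - 2*(sin t)^2 + 2*(sin t)^3) - pi/2 * (sin t)^2 - (1 - 2 * sin t) * sin t * cos t"
  have nz: "sin t \<noteq> 0" "cos t \<noteq> 0" if "0 < t" "t \<le> pi/6" for t :: real
    using sin_gt_zero[of t] cos_gt_zero[of t] that pi_gt_zero by auto
  obtain z where z: "a < z" "z < b" "sector_quotient b - sector_quotient a = (b - a) * (- ?K z / (sin z * cos z)^2)"
  proof (rule mvt_obtain[of a b sector_quotient "\<lambda>t. - ?K t / (sin t * cos t)^2"])
    show "continuous_on {a..b} sector_quotient" unfolding sector_quotient_def
      using assms nz by (intro continuous_intros) auto
    fix x assume x: "a < x" "x < b"
    then have nzx: "sin x \<noteq> 0" "cos x \<noteq> 0" using nz[of x] assms by auto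
    have c2: "cos x * cos x = 1 - sin x * sin x" using sin_cos_squared_add[of x] by (simp add: power2_eq_square)
    then have c3: "cos x * (cos x * y) = (1 - sin x * sin x) * y" for y by (metis mult.assoc)
    have "((\<lambda>t. (pi/2 * (sin t)^2 + (1 - 2 * sin t) * t) / (sin t * cos t)) has_real_derivative
       ((pi * sin x * cos x + (1 - 2 * sin x) - 2 * cos x * x) * (sin x * cos x)
         - (pi/2 * (sin x)^2 + (1 - 2 * sin x) * x) * (cos x * cos x - sin x * sin x)) / ((sin x * cos x)*(sin x * cos x))) (at x)"
      using nzx by (auto intro!: derivative_eq_intros simp: algebra_simps)
    moreover have "(pi * sin x * cos x + (1 - 2 * sin x) - 2 * cos x * x) * (sin x * cos x)
         - (pi/2 * (sin x)^2 + (1 - 2 * sin x) * x) * (cos x * cos x - sin x * sin x) = - ?K x"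
      by (simp add: power2_eq_square power3_eq_cube field_simps c2 c3)
    ultimately show "(sector_quotient has_real_derivative - ?K x / (sin x * cos x)^2) (at x)"
      unfolding sector_quotient_def by (simp add: power2_eq_square)
  qed (use assms in auto)
  have "0 < ?K z" using sector_quotient_slope_pos[of z] z assms by auto
  moreover have "0 < (sin z * cos z)^2" using nz[of z] z assms by auto
  ultimately have "- ?K z / (sin z * cos z)^2 < 0" by (metis divide_neg_pos neg_less_0_iff_less)
  then have "(b - a) * (- ?K z / (sin z * cos z)^2) < 0" using assms by (simp only: mult_pos_neg diff_gt_0_iff_gt)
  then show ?thesis using z(3) by linarith
qed

section \<open>Triangles with two large disks\<close>


text \<open>The polynomial is the numerator of the derivative of \<open>endpoint_log_ratio\<close> below.\<close>

lemma single_sign_change: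
  fixes x y :: real
  assumes xy: "0 < x" "x < y"
    and le: "10 + 18*x \<le> 3*x^2 + 35*x^3 + 45*x^4 + 24*x^5 + 2*x^6"
  shows "10 + 18*y < 3*y^2 + 35*y^3 + 45*y^4 + 24*y^5 + 2*y^6"
proof -
  have pow: "x^Suc k * y \<le> y^Suc k * x" for k
  proof -
    have "x^k * (x*y) \<le> y^k * (x*y)" using xy by (intro mult_right_mono power_mono) auto
    then show ?thesis by (simp add: mult_ac)
  qed
  \<comment> \<open>After division by the variable the left polynomial decreases and the right one
    increases; this and the last step are the cross-multiplied forms.\<close>
  have "(10 + 18*y) * x < (10 + 18*x) * y" using xy by (simp add: algebra_simps)
  also have "\<dots> \<le> (3*x^2 + 35*x^3 + 45*x^4 + 24*x^5 + 2*x^6) * y"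
    using le xy by (intro mult_right_mono) auto
  also have "\<dots> \<le> (3*y^2 + 35*y^3 + 45*y^4 + 24*y^5 + 2*y^6) * x"
  proof -
    have "x^2*y \<le> y^2*x" "x^3*y \<le> y^3*x" "x^4*y \<le> y^4*x" "x^5*y \<le> y^5*x" "x^6*y \<le> y^6*x"
      using pow[of 1] pow[of 2] pow[of 3] pow[of 4] pow[of 5] by (simp_all add: eval_nat_numeral)
    then show ?thesis by (simp add: distrib_right mult.assoc)
  qed
  finally show ?thesis using xy by simp
qed

text \<open>The logarithm of the quantity that \<open>endpoint_slope_deriv_sign\<close> compares
  with \<open>pi/2\<close>. The logarithm turns the products and the half-integral power into a sum
  with rational derivative.\<close>

definition endpoint_log_ratio :: "real \<Rightarrow> real" where
  "endpoint_log_ratio k = 3 * ln (2+k) + 3/2 * ln (1+2*k) - ln (1+k) - ln (6 + 16*k + 15*k^2 + 6*k^3 + 2*k^4)"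

lemma endpoint_log_ratio_deriv:
  assumes "0 < k"
  shows "(endpoint_log_ratio has_real_derivative
    (10 + 18*k - (3*k^2 + 35*k^3 + 45*k^4 + 24*k^5 + 2*k^6)) /
      ((2+k)*(1+2*k)*(1+k)*(6 + 16*k + 15*k^2 + 6*k^3 + 2*k^4))) (at k)"
proof -
  let ?a = "6 + 16*k + 15*k^2 + 6*k^3 + 2*k^4"
  have pos: "0 < ?a" using assms by (intro add_pos_pos) auto
  have da: "((\<lambda>k. 6 + 16*k + 15*k^2 + 6*k^3 + 2*k^4) has_real_derivative 16 + 30*k + 18*k^2 + 8*k^3) (at k)"
    by (auto intro!: derivative_eq_intros)
  have l1: "((\<lambda>k. ln (2+k)) has_real_derivative 1/(2+k)) (at k)"
    and l2: "((\<lambda>k. ln (1+2*k)) has_real_derivative 2/(1+2*k)) (at k)"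
    and l3: "((\<lambda>k. ln (1+k)) has_real_derivative 1/(1+k)) (at k)"
    using assms by (auto intro!: derivative_eq_intros)
  have l4: "((\<lambda>k. ln (6 + 16*k + 15*k^2 + 6*k^3 + 2*k^4)) has_real_derivative (16 + 30*k + 18*k^2 + 8*k^3)/?a) (at k)"
    using DERIV_chain2[OF DERIV_ln_divide[OF pos] da] by simp
  have "(endpoint_log_ratio has_real_derivative
    3*(1/(2+k)) + 3/2*(2/(1+2*k)) - 1/(1+k) - (16 + 30*k + 18*k^2 + 8*k^3)/?a) (at k)"
    unfolding endpoint_log_ratio_def by (intro DERIV_diff DERIV_add DERIV_cmult l1 l2 l3 l4)
  \<comment> \<open>The denominators are replaced by variables, here and in later calculations, so
    that clearing fractions does not multiply the polynomials out.\<close>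
  moreover have "3*(1/A) + 3/2*(2/B) - 1/C - d/F = ((3*B*C + 3*A*C - A*B)*F - d*(A*B*C))/(A*B*C*F)"
    if "A \<noteq> 0" "B \<noteq> 0" "C \<noteq> 0" "F \<noteq> 0" for A B C F d :: real
    using that by (simp add: field_simps)
  moreover have "(3*(1+2*k)*(1+k) + 3*(2+k)*(1+k) - (2+k)*(1+2*k))*?a - (16 + 30*k + 18*k^2 + 8*k^3)*((2+k)*(1+2*k)*(1+k))
     = 10 + 18*k - (3*k^2 + 35*k^3 + 45*k^4 + 24*k^5 + 2*k^6)" by algebra
  ultimately show ?thesis using pos assms by simp
qed

text \<open>The derivative of \<open>endpoint_gap\<close>, divided by a negative algebraic factor
  chosen so that \<open>arccos\<close> stands alone; the next derivative is then free of inverse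
  trigonometric functions.\<close>

definition endpoint_slope :: "real \<Rightarrow> real" where
  "endpoint_slope k = (pi/2 * ((1+2*k+2*k^2) / (sqrt (1+2*k) * (1+k+k^2))) - k*(1+2*k)/((1+k)*(1+k+k^2))) * sqrt (1-k^2) - arccos k"

lemma endpoint_slope_deriv:
  assumes k: "0 < k" "k < 1"
  shows "(endpoint_slope has_real_derivative
    k^2 / ((1+k+k^2)^2 * sqrt (1-k^2)) * ((2+k)^3/(1+k) - pi/2 * (6 + 16*k + 15*k^2 + 6*k^3 + 2*k^4) / sqrt (1+2*k)^3)) (at k)"
proof -
  define Y where "Y = sqrt (1+2*k)"
  define D where "D = sqrt (1-k^2)"
  define P where "P = 1+k+k^2"
  have Y: "0 < Y" "Y^2 = 1+2*k" using k by (auto simp: Y_def)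
  have "k^2 < 1" using k by (simp add: power_less_one_iff abs_square_less_1)
  then have D: "0 < D" "D^2 = 1-k^2" using k by (auto simp: D_def)
  have P: "0 < P" using k by (auto simp: P_def intro!: add_pos_pos)
  have dY: "((\<lambda>k. sqrt (1+2*k)) has_real_derivative 1/Y) (at k)"
    using k unfolding Y_def by (auto intro!: derivative_eq_intros simp: field_simps)
  have dP: "((\<lambda>k. 1+k+k^2) has_real_derivative 1+2*k) (at k)"
    by (auto intro!: derivative_eq_intros)
  have d1: "((\<lambda>k. (1+2*k+2*k^2) / (sqrt (1+2*k) * (1+k+k^2))) has_real_derivative
      k*(1-k-4*k^2-2*k^3)/(Y^3*P^2)) (at k)"
  proof -
    have "((\<lambda>k. 1+2*k+2*k^2) has_real_derivative 2+4*k) (at k)"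
      by (auto intro!: derivative_eq_intros)
    from DERIV_divide[OF this DERIV_mult[OF dY dP]]
    have "((\<lambda>k. (1+2*k+2*k^2) / (sqrt (1+2*k) * (1+k+k^2))) has_real_derivative
      ((2+4*k)*(Y*P) - (1+2*k+2*k^2)*(1/Y*P + (1+2*k)*Y))/((Y*P)*(Y*P))) (at k)"
      using Y(1) P unfolding Y_def P_def by simp
    moreover have "((2+4*k)*(Y*P) - (1+2*k+2*k^2)*(1/Y*P + (1+2*k)*Y))/((Y*P)*(Y*P))
       = ((2+4*k)*(Y^2*P) - (1+2*k+2*k^2)*(P + Y^2*(1+2*k)))/(Y^3*P^2)"
    proof -
      have "(b*(Y*P) - n*(1/Y*P + c*Y))/((Y*P)*(Y*P)) = (b*(Y^2*P) - n*(P + Y^2*c))/(Y^3*P^2)" for b n c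
        using Y(1) P by (simp add: field_simps power2_eq_square power3_eq_cube)
      then show ?thesis .
    qed
    moreover have "(2+4*k)*(Y^2*P) - (1+2*k+2*k^2)*(P + Y^2*(1+2*k)) = k*(1-k-4*k^2-2*k^3)"
      unfolding Y P_def by algebra
    ultimately show ?thesis by simp
  qed
  have d2: "((\<lambda>k. k*(1+2*k)/((1+k)*(1+k+k^2))) has_real_derivative
      (1+4*k+2*k^2-2*k^3-2*k^4)/((1+k)^2*P^2)) (at k)"
  proof -
    have "((\<lambda>k. k*(1+2*k)) has_real_derivative 1+4*k) (at k)" "((\<lambda>k. 1+k) has_real_derivative 1) (at k)"
      by (auto intro!: derivative_eq_intros)
    from DERIV_divide[OF this(1) DERIV_mult[OF this(2) dP]]
    have "((\<lambda>k. k*(1+2*k)/((1+k)*(1+k+k^2))) has_real_derivative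
       ((1+4*k)*((1+k)*P) - k*(1+2*k)*(1*P+(1+2*k)*(1+k)))/(((1+k)*P)*((1+k)*P))) (at k)"
      using k P unfolding P_def by simp
    moreover have "(1+4*k)*((1+k)*P) - k*(1+2*k)*(1*P+(1+2*k)*(1+k)) = 1+4*k+2*k^2-2*k^3-2*k^4"
      unfolding P_def by algebra
    ultimately show ?thesis by (simp add: power2_eq_square mult_ac)
  qed
  have d3: "((\<lambda>k. sqrt (1-k^2)) has_real_derivative - k/D) (at k)"
    using \<open>k^2 < 1\<close> unfolding D_def by (auto intro!: derivative_eq_intros simp: field_simps)
  have d4: "(arccos has_real_derivative -1/D) (at k)"
    using DERIV_arccos[of k] k unfolding D_def by (simp add: field_simps)
  let ?G = "pi/2 * ((1+2*k+2*k^2) / (Y * P)) - k*(1+2*k)/((1+k)*P)"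
  have r0: "(endpoint_slope has_real_derivative
      (pi/2 * (k*(1-k-4*k^2-2*k^3)/(Y^3*P^2)) - (1+4*k+2*k^2-2*k^3-2*k^4)/((1+k)^2*P^2)) * D
        + ?G * (- k/D) - (-1/D)) (at k)"
    unfolding endpoint_slope_def
    by (rule DERIV_cong[OF DERIV_diff[OF DERIV_mult[OF DERIV_diff[OF DERIV_cmult[OF d1] d2] d3] d4]])
       (simp only: Y_def D_def P_def mult.commute)
  have r1: "(pi/2 * (k*(1-k-4*k^2-2*k^3)/(Y^3*P^2)) - (1+4*k+2*k^2-2*k^3-2*k^4)/((1+k)^2*P^2)) * D
        + ?G * (- k/D) - (-1/D) = 
     ((pi/2 * (k*(1-k-4*k^2-2*k^3)/(Y^3*P^2)) - (1+4*k+2*k^2-2*k^3-2*k^4)/((1+k)^2*P^2)) * D^2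
        - k * ?G + 1) / D"
  proof -
    have "a * D + g * (- k/D) - (-1/D) = (a * D^2 - k * g + 1)/D" for a g
      using D(1) by (simp add: field_simps power2_eq_square)
    then show ?thesis .
  qed
  have r2: "(pi/2 * (k*(1-k-4*k^2-2*k^3)/(Y^3*P^2)) - (1+4*k+2*k^2-2*k^3-2*k^4)/((1+k)^2*P^2)) * D^2
        - k * ?G + 1 = 
     pi/2 * (k*((1-k-4*k^2-2*k^3)*D^2 - (1+2*k+2*k^2)*P*Y^2))/(Y^3*P^2)
      + ((1+k)^2*P^2 - (1+4*k+2*k^2-2*k^3-2*k^4)*D^2 + k^2*(1+2*k)*(1+k)*P)/((1+k)^2*P^2)"
  proof -
    have e1: "(1+2*k+2*k^2) / (Y * P) = (1+2*k+2*k^2)*P*Y^2/(Y^3*P^2)"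
      using Y(1) P by (simp add: field_simps power2_eq_square power3_eq_cube)
    have e2: "k*(1+2*k)/((1+k)*P) = k*(1+2*k)*(1+k)*P/((1+k)^2*P^2)"
      using k P by (simp add: power2_eq_square)
    have gen: "(pi/2 * (k*a/N) - b/M) * d - k * (pi/2 * (n/N) - c/M) + 1 = pi/2 * (k*(a*d - n))/N + (M - b*d + k*c)/M"
      if "M \<noteq> 0" for a b c d n N M :: real
      using that by (simp add: add_divide_distrib diff_divide_distrib algebra_simps)
    have M0: "(1+k)^2*P^2 \<noteq> 0" using k P by simp
    show ?thesis unfolding e1 e2 gen[OF M0] by (simp only: right_diff_distrib mult.assoc mult.left_commute power2_eq_square)
  qed
  \<comment> \<open>\<open>Y^2\<close> and \<open>D^2\<close> are polynomials in \<open>k\<close>.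
    With them both numerators collapse, and together with the \<open>k\<close> already in front they
    yield the common factor \<open>k^2/(P^2*D)\<close>.\<close>
  have r3: "(1-k-4*k^2-2*k^3)*D^2 - (1+2*k+2*k^2)*P*Y^2 = - (k * (6 + 16*k + 15*k^2 + 6*k^3 + 2*k^4))"
    unfolding Y D P_def by algebra
  have r4: "(1+k)^2*P^2 - (1+4*k+2*k^2-2*k^3-2*k^4)*D^2 + k^2*(1+2*k)*(1+k)*P = k^2*(1+k)*(2+k)^3"
    unfolding Y D P_def by algebra
  have r5: "(pi/2 * (k*(-(k*a)))/(Y^3*P^2) + k^2*(1+k)*(2+k)^3/((1+k)^2*P^2))/D =
     k^2/(P^2*D) * ((2+k)^3/(1+k) - pi/2*a/Y^3)" for a
  proof -
    have fr: "(h * (k*(-(k*a)))/(y*p) + k^2*K*t/(K^2*p))/D = k^2/(p*D) * (t/K - h*a/y)"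
      if "y \<noteq> 0" "p \<noteq> 0" "K \<noteq> 0" for h y p K t :: real
      using that D(1) by (simp add: field_simps power2_eq_square)
    show ?thesis by (rule fr) (use Y(1) P k in auto)
  qed
  show ?thesis
    using r0 unfolding r1 r2 r3 r4 mult_minus_right r5[unfolded mult_minus_right]
    unfolding Y_def D_def P_def .
qed


text \<open>A positive factor can be taken out of \<open>d\<close> such that \<open>X - pi/2\<close>
  remains, where \<open>ln X\<close> is \<open>endpoint_log_ratio k\<close>.\<close>

lemma endpoint_slope_deriv_sign:
  assumes k: "0 < k" "k < 1"
  defines "d \<equiv> k^2 / ((1+k+k^2)^2 * sqrt (1-k^2)) * ((2+k)^3/(1+k) - pi/2 * (6 + 16*k + 15*k^2 + 6*k^3 + 2*k^4) / sqrt (1+2*k)^3)"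
  shows "0 \<le> d \<longleftrightarrow> ln (pi/2) \<le> endpoint_log_ratio k" and "d \<le> 0 \<longleftrightarrow> endpoint_log_ratio k \<le> ln (pi/2)"
proof -
  define Y where "Y = sqrt (1+2*k)"
  define a where "a = 6 + 16*k + 15*k^2 + 6*k^3 + 2*k^4"
  define c where "c = k^2 / ((1+k+k^2)^2 * sqrt (1-k^2))"
  define X where "X = (2+k)^3 * Y^3 / ((1+k) * a)"
  have Y: "0 < Y" using k by (auto simp: Y_def)
  have a: "0 < a" using k unfolding a_def by (intro add_pos_pos) auto
  have "0 < 1+k+k^2" using k by (intro add_pos_pos) auto
  moreover have "k^2 < 1" using k by (simp add: abs_square_less_1)
  ultimately have c: "0 < c" using k by (auto simp: c_def)
  have X: "0 < X" using k Y a by (auto simp: X_def)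
  have d: "d = c * (a / Y^3) * (X - pi/2)"
  proof -
    have "c * (t/l - p*a/y) = c * (a/y) * (t*y/(l*a) - p)" if "l \<noteq> 0" "y \<noteq> 0" for t l p y
      using that a by (simp add: field_simps)
    from this[of "1+k" "Y^3" "(2+k)^3" "pi/2"] Y k
    have "c * ((2+k)^3/(1+k) - pi/2 * a / Y^3) = c * (a / Y^3) * (X - pi/2)"
      unfolding X_def by (metis add_pos_pos less_numeral_extra(1,3) power_not_zero)
    then show ?thesis by (simp only: d_def c_def a_def Y_def)
  qed
  have lnY: "ln Y = ln (1+2*k) / 2" using k by (simp add: Y_def ln_sqrt)
  have "ln X = endpoint_log_ratio k"
    unfolding X_def endpoint_log_ratio_def a_def[symmetric]
    using k Y a by (simp add: ln_div ln_mult ln_realpow lnY)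
  then have lnX: "ln (pi/2) \<le> endpoint_log_ratio k \<longleftrightarrow> pi/2 \<le> X" "endpoint_log_ratio k \<le> ln (pi/2) \<longleftrightarrow> X \<le> pi/2"
    using X pi_gt_zero by (metis ln_le_cancel_iff half_gt_zero)+
  have pos: "0 < c * (a / Y^3)" using c a Y by simp
  show "0 \<le> d \<longleftrightarrow> ln (pi/2) \<le> endpoint_log_ratio k" "d \<le> 0 \<longleftrightarrow> endpoint_log_ratio k \<le> ln (pi/2)"
    unfolding d lnX using pos zero_le_mult_iff[of "c * (a / Y^3)"] mult_le_0_iff[of "c * (a / Y^3)"] by auto
qed

lemma endpoint_slope_continuous: "continuous_on {0..1} endpoint_slope"
proof -
  have "1 + k + k^2 \<noteq> 0" if "0 \<le> k" for k :: real 
    using that by (smt (verit) zero_le_power2)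
  then show ?thesis unfolding endpoint_slope_def
    by (intro continuous_intros) auto
qed

text \<open>\<open>endpoint_slope\<close> vanishes at 0 and 1. If it were nonnegative at
  \<open>x\<close> and nonpositive at the later \<open>y\<close>, the mean value theorem would give
  points where its derivative is \<open>\<ge> 0\<close>, \<open>\<le> 0\<close>,
  \<open>\<ge> 0\<close> in this order. Then \<open>endpoint_log_ratio\<close> is above, below and
  again above \<open>ln (pi/2)\<close>, so its derivative is nonpositive at one point and
  nonnegative at a later one, contrary to \<open>single_sign_change\<close>.\<close>

lemma endpoint_slope_sign:
  assumes xy: "0 < x" "x < y" "y < 1" and nonneg: "0 \<le> endpoint_slope x"
  shows "0 < endpoint_slope y"
proof (rule ccontr)
  assume neg: "\<not> 0 < endpoint_slope y"
  define d where "d = (\<lambda>k. k^2 / ((1+k+k^2)^2 * sqrt (1-k^2)) * ((2+k)^3/(1+k) - pi/2 * (6 + 16*k + 15*k^2 + 6*k^3 + 2*k^4) / sqrt (1+2*k)^3) :: real)"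
  have der: "(endpoint_slope has_real_derivative d k) (at k)" if "0 < k" "k < 1" for k
    unfolding d_def using that by (rule endpoint_slope_deriv)
  let ?e = "\<lambda>k. (10 + 18*k - (3*k^2 + 35*k^3 + 45*k^4 + 24*k^5 + 2*k^6)) /
      ((2+k)*(1+2*k)*(1+k)*(6 + 16*k + 15*k^2 + 6*k^3 + 2*k^4))"
  have w0: "endpoint_slope 0 = 0" "endpoint_slope 1 = 0" by (auto simp: endpoint_slope_def)
  obtain u1 where u1: "0 < u1" "u1 < x" "endpoint_slope x - endpoint_slope 0 = (x - 0) * d u1"
    using xy by (rule_tac mvt_obtain[of 0 x endpoint_slope d])
      (auto intro: continuous_on_subset[OF endpoint_slope_continuous] der)
  obtain u2 where u2: "x < u2" "u2 < y" "endpoint_slope y - endpoint_slope x = (y - x) * d u2"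
    using xy by (rule_tac mvt_obtain[of x y endpoint_slope d])
      (auto intro: continuous_on_subset[OF endpoint_slope_continuous] der)
  obtain u3 where u3: "y < u3" "u3 < 1" "endpoint_slope 1 - endpoint_slope y = (1 - y) * d u3"
    using xy by (rule_tac mvt_obtain[of y 1 endpoint_slope d])
      (auto intro: continuous_on_subset[OF endpoint_slope_continuous] der)
  have s: "0 \<le> c * d \<Longrightarrow> 0 < c \<Longrightarrow> 0 \<le> d" "c * d \<le> 0 \<Longrightarrow> 0 < c \<Longrightarrow> d \<le> 0" for c d :: real
    by (simp_all add: zero_le_mult_iff mult_le_0_iff)
  have "0 \<le> d u1" by (rule s(1)[of "x - 0"]) (use u1 w0 nonneg xy in linarith)+
  then have Z1: "ln (pi/2) \<le> endpoint_log_ratio u1" using endpoint_slope_deriv_sign(1)[of u1] u1 xy by (simp add: d_def)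
  have "d u2 \<le> 0" by (rule s(2)[of "y - x"]) (use u2 neg nonneg xy in linarith)+
  then have Z2: "endpoint_log_ratio u2 \<le> ln (pi/2)" using endpoint_slope_deriv_sign(2)[of u2] u2 xy by (simp add: d_def)
  have "0 \<le> d u3" by (rule s(1)[of "1 - y"]) (use u3 w0 neg xy in linarith)+
  then have Z3: "ln (pi/2) \<le> endpoint_log_ratio u3" using endpoint_slope_deriv_sign(1)[of u3] u3 xy by (simp add: d_def)
  have cont: "continuous_on {a..b} endpoint_log_ratio" if "0 < a" for a b
    using that by (intro continuous_at_imp_continuous_on ballI DERIV_isCont[OF endpoint_log_ratio_deriv]) auto
  obtain z1 where z1: "u1 < z1" "z1 < u2" "endpoint_log_ratio u2 - endpoint_log_ratio u1 = (u2 - u1) * ?e z1"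
    using u1 u2 by (rule_tac mvt_obtain[of u1 u2 endpoint_log_ratio ?e]) (auto intro!: cont endpoint_log_ratio_deriv)
  obtain z2 where z2: "u2 < z2" "z2 < u3" "endpoint_log_ratio u3 - endpoint_log_ratio u2 = (u3 - u2) * ?e z2"
    using u1 u2 u3 xy by (rule_tac mvt_obtain[of u2 u3 endpoint_log_ratio ?e]) (auto intro!: cont endpoint_log_ratio_deriv)
  have den: "0 < (2+k)*(1+2*k)*(1+k)*(6 + 16*k + 15*k^2 + 6*k^3 + 2*k^4)" if "0 < k" for k :: real
    using that by (intro mult_pos_pos add_pos_pos) auto
  have "?e z1 \<le> 0" by (rule s(2)[of "u2 - u1"]) (use z1 Z1 Z2 in linarith)+
  then have "10 + 18*z1 \<le> 3*z1^2 + 35*z1^3 + 45*z1^4 + 24*z1^5 + 2*z1^6"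
    using den[of z1] z1 u1 by (simp add: divide_le_0_iff)
  then have "10 + 18*z2 < 3*z2^2 + 35*z2^3 + 45*z2^4 + 24*z2^5 + 2*z2^6"
    using z1 z2 u1 by (intro single_sign_change[of z1 z2]) linarith+
  then have "?e z2 < 0" using den[of z2] z1 z2 u1 by (simp add: divide_less_0_iff)
  moreover have "0 \<le> ?e z2" by (rule s(1)[of "u3 - u2"]) (use z2 Z3 Z2 in linarith)+
  ultimately show False by simp
qed

definition endpoint_gap :: "real \<Rightarrow> real" where
  "endpoint_gap k = pi/2 * ((1+k-k^2)/(1+2*k)) - arccos k * sqrt (1-k^2) / sqrt (1+2*k) - arcsin (k/(1+k))"

lemma endpoint_gap_deriv:
  assumes k: "0 < k" "k < 1"
  shows "(endpoint_gap has_real_derivative - ((1+k+k^2) / (sqrt (1+2*k)^3 * sqrt (1-k^2)) * endpoint_slope k)) (at k)"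
proof -
  define Y where "Y = sqrt (1+2*k)"
  define D where "D = sqrt (1-k^2)"
  define P where "P = 1+k+k^2"
  define A where "A = arccos k"
  have Y: "0 < Y" "Y^2 = 1+2*k" using k by (auto simp: Y_def)
  have "k^2 < 1" using k by (simp add: power_less_one_iff abs_square_less_1)
  then have D: "0 < D" "D^2 = 1-k^2" using k by (auto simp: D_def)
  have P: "0 < P" using k by (auto simp: P_def intro!: add_pos_pos)
  have dY: "((\<lambda>k. sqrt (1+2*k)) has_real_derivative 1/Y) (at k)"
    using k unfolding Y_def by (auto intro!: derivative_eq_intros simp: field_simps)
  have dD: "((\<lambda>k. sqrt (1-k^2)) has_real_derivative - k/D) (at k)"
    using \<open>k^2 < 1\<close> unfolding D_def by (auto intro!: derivative_eq_intros simp: field_simps)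
  have dA: "(arccos has_real_derivative -1/D) (at k)"
    using DERIV_arccos[of k] k unfolding D_def by (simp add: field_simps)
  have n: "((\<lambda>k. 1+k-k^2) has_real_derivative 1-2*k) (at k)" "((\<lambda>k. 1+2*k) has_real_derivative 2) (at k)"
    by (auto intro!: derivative_eq_intros)
  have d1: "((\<lambda>k. (1+k-k^2)/(1+2*k)) has_real_derivative ((1-2*k)*Y^2 - (1+k-k^2)*2)/(Y^2*Y^2)) (at k)"
    using DERIV_divide[OF n] Y k by simp
  have d2: "((\<lambda>k. arccos k * sqrt (1-k^2) / sqrt (1+2*k)) has_real_derivative
       ((-1/D*D + -k/D*A)*Y - A*D*(1/Y))/(Y*Y)) (at k)"
    using DERIV_divide[OF DERIV_mult[OF dA dD] dY] Y(1) unfolding A_def D_def Y_def by simp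
  have d3: "((\<lambda>k. arcsin (k/(1+k))) has_real_derivative 1/((1+k)*Y)) (at k)"
  proof -
    have r: "((\<lambda>k. k/(1+k)) has_real_derivative 1/(1+k)^2) (at k)"
      using k by (auto intro!: derivative_eq_intros simp: field_simps power2_eq_square)
    have "1 - (k/(1+k))^2 = (Y/(1+k))^2" using k Y(2) by (simp add: power_divide field_simps) (simp add: power2_eq_square algebra_simps)
    then have sq: "sqrt (1 - (k/(1+k))^2) = Y/(1+k)" using Y(1) k by (simp add: real_sqrt_unique)
    have "((\<lambda>k. arcsin (k/(1+k))) has_real_derivative inverse (sqrt (1 - (k/(1+k))^2)) * (1/(1+k)^2)) (at k)"
      using k by (intro DERIV_chain2[OF DERIV_arcsin r]) (auto simp: field_simps)
    moreover have "inverse (Y/(1+k)) * (1/(1+k)^2) = 1/((1+k)*Y)" 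
    proof -
      have "inverse (Y/l) * (1/l^2) = 1/(l*Y)" if "l \<noteq> 0" for l
        using that Y(1) by (simp add: field_simps power2_eq_square)
      then show ?thesis using k by simp
    qed
    ultimately show ?thesis unfolding sq by simp
  qed
  have r0: "(endpoint_gap has_real_derivative
      pi/2 * (((1-2*k)*Y^2 - (1+k-k^2)*2)/(Y^2*Y^2)) - ((-1/D*D + -k/D*A)*Y - A*D*(1/Y))/(Y*Y) - 1/((1+k)*Y)) (at k)"
    unfolding endpoint_gap_def by (intro DERIV_diff DERIV_cmult d1 d2 d3)
  have r1: "pi/2 * (((1-2*k)*Y^2 - (1+k-k^2)*2)/(Y^2*Y^2)) - ((-1/D*D + -k/D*A)*Y - A*D*(1/Y))/(Y*Y) - 1/((1+k)*Y)
     = pi/2 * (((1-2*k)*Y^2 - (1+k-k^2)*2)/(Y^2*Y^2)) + k*Y^2/((1+k)*Y^3) + A*(k*Y^2+D^2)/(D*Y^3)"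
  proof -
    have "p*e - ((-1/D*D + -k/D*A)*Y - A*D*(1/Y))/(Y*Y) - 1/(l*Y) = p*e + (l-1)*Y^2/(l*Y^3) + A*(k*Y^2+D^2)/(D*Y^3)"
      if "l \<noteq> 0" for p e l using that Y(1) D(1) by (simp add: field_simps power2_eq_square power3_eq_cube)
    from this[of "1+k"] show ?thesis using k by simp
  qed
  have r2: "k*Y^2+D^2 = P" "(1-2*k)*Y^2 - (1+k-k^2)*2 = -(1+2*k+2*k^2)" unfolding Y(2) D P_def by algebra+
  have r3: "- (P / (Y^3 * D) * endpoint_slope k) =
     pi/2 * (-(1+2*k+2*k^2)/(Y^2*Y^2)) + k*Y^2/((1+k)*Y^3) + A*P/(D*Y^3)"
  proof -
    have w: "endpoint_slope k = (pi/2 * ((1+2*k+2*k^2) / (Y * P)) - k*Y^2/((1+k)*P)) * D - A"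
      unfolding endpoint_slope_def by (simp add: Y_def[symmetric] D_def[symmetric] P_def[symmetric] A_def[symmetric] Y(2))
    have eq: "- (P / (Y^3 * D) * ((p * (n / (Y * P)) - k*Y^2/(l*P)) * D - A)) =
     p * (-n/(Y^2*Y^2)) + k*Y^2/(l*Y^3) + A*P/(D*Y^3)" if "l \<noteq> 0" for p n l
      using that Y(1) D(1) P by (simp add: field_simps power2_eq_square power3_eq_cube)
    show ?thesis unfolding w by (rule eq) (use k in simp)
  qed
  show ?thesis
    using r0 unfolding r1 unfolding r2 unfolding r3[symmetric] unfolding Y_def D_def P_def .
qed

text \<open>The gap vanishes at both ends, and by \<open>endpoint_slope_sign\<close> its derivative
  turns from positive to negative at most once.\<close>

lemma endpoint_gap_pos:
  assumes "0 < k" "k < 1"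
  shows "0 < endpoint_gap k"
proof (rule positive_between[OF _ endpoint_gap_deriv])
  show "continuous_on {0..1} endpoint_gap" unfolding endpoint_gap_def
    by (intro continuous_intros) (auto simp: field_simps)
  show "0 \<le> endpoint_gap 0" "0 \<le> endpoint_gap 1"
    by (simp_all add: endpoint_gap_def arcsin_one_half)
  fix x y :: real
  assume xy: "0 < x" "x < y" "y < 1" "- ((1+x+x^2) / (sqrt (1+2*x)^3 * sqrt (1-x^2)) * endpoint_slope x) \<le> 0"
  have pos: "0 < (1+x+x^2) / (sqrt (1+2*x)^3 * sqrt (1-x^2))" if "0 < x" "x < 1" for x :: real
  proof -
    have "x^2 < 1" using that by (simp add: abs_square_less_1)
    moreover have "0 < 1+x+x^2" using that by (intro add_pos_pos) auto
    ultimately show ?thesis using that by simp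
  qed
  have "0 \<le> c * b \<Longrightarrow> 0 < c \<Longrightarrow> 0 \<le> b" for c b :: real by (simp add: zero_le_mult_iff)
  then have "0 \<le> endpoint_slope x" using pos[of x] xy by (metis neg_le_0_iff_le order_less_trans)
  then have "0 < endpoint_slope y" using endpoint_slope_sign xy by blast
  moreover have "0 < y" using xy by simp
  ultimately show "- ((1+y+y^2) / (sqrt (1+2*y)^3 * sqrt (1-y^2)) * endpoint_slope y) < 0"
    using mult_pos_pos[OF pos[of y], of "endpoint_slope y"] xy by linarith
qed (use assms in auto)


text \<open>For \<open>u = q/(1+q)\<close>, \<open>arccos (1-u)\<close> is the angle at a unit disk
  in the triangle with radii \<open>q, 1, 1\<close>, and \<open>arcsin u\<close> is half the angle
  at the unit disk in the one with radii \<open>q, q, 1\<close>. The inequality compares the two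
  densities after the reduction carried out in \<open>sector_sum_two_large\<close>.\<close>

lemma endpoint_ineq:
  fixes u :: real
  assumes u: "0 < u" "u < 1/2"
  defines "e \<equiv> sqrt (u*(2-u))" and "c \<equiv> sqrt (1-u^2)"
  shows "arccos (1-u) * (u*(1+u) + e*c) < pi * u^2 + arcsin u * ((1-u)*(2-u) + e*c)"
proof -
  txt \<open>The two angles satisfy \<open>cos E + sin t = 1\<close>.  In terms of \<open>k = sin (E + t)\<close> they are given by
    \<open>E + t = pi/2 - arccos k\<close> and \<open>E - t = arcsin (k/(1+k))\<close>, which turns the claim into the positivity of
    \<open>endpoint_gap k\<close>, a function whose repeated derivatives become algebraic.\<close>
  define E where "E = arccos (1-u)"
  define t where "t = arcsin u"
  define g where "g = u*(1-u)"
  define k where "k = e*c + g"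
  have u2: "u^2 < 1" using u by (simp add: abs_square_less_1)
  have ep: "0 < e" "e^2 = u*(2-u)" using u by (auto simp: e_def)
  have cp: "0 < c" "c^2 = 1-u^2" using u2 by (auto simp: c_def)
  have tr: "sin t = u" "cos t = c" "cos E = 1-u" "sin E = e"
    using u by (auto simp: t_def E_def c_def e_def cos_arcsin sin_arccos power2_eq_square algebra_simps)
  have t: "0 < t" "t < pi/6"
    using u arcsin_less_arcsin[of 0 u] arcsin_less_arcsin[of u "1/2"] by (auto simp: t_def)
  have E: "0 < E" "E < pi/3"
  proof -
    show "0 < E" using u arccos_less_arccos[of "1-u" 1] by (simp add: E_def)
    have "arccos (1/2) = pi/3" using arccos_cos[of "pi/3"] by (simp add: cos_60)
    then show "E < pi/3" using u arccos_less_arccos[of "1/2" "1-u"] by (simp add: E_def)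
  qed
  have kk: "sin (E + t) = k" "sin (E - t) = e*c - g"
    by (simp_all add: sin_add sin_diff tr k_def g_def algebra_simps)
  have gp: "0 < g" using u by (simp add: g_def)
  \<comment> \<open>The relation between the two angles makes \<open>(e*c)^2\<close> a polynomial in
    \<open>g\<close> alone. Hence \<open>k\<close> and \<open>g\<close> satisfy the quadratic
    equation \<open>kq\<close>, and \<open>e*c - g\<close>, the sine of \<open>E - t\<close>,
    becomes \<open>k/(1+k)\<close>.\<close>
  have ec: "(e*c)^2 = g^2 + 2*g"
    unfolding power_mult_distrib ep cp g_def by algebra
  have kq: "k^2 = 2*g*(1+k)" using ec unfolding k_def by (simp add: power2_eq_square algebra_simps)
  have kp: "0 < k" using gp mult_pos_pos[OF ep(1) cp(1)] by (simp add: k_def)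
  have k1: "k < 1" 
    using sin_monotone_2pi[of "E+t" "pi/2"] t E kk by simp
  have ac: "arccos k = pi/2 - E - t"
  proof -
    have "arccos (sin (E+t)) = arccos (cos (pi/2 - (E+t)))" by (simp add: sin_cos_eq)
    also have "\<dots> = pi/2 - (E+t)" using t E by (intro arccos_cos) auto
    finally show ?thesis using kk by simp
  qed
  have as: "arcsin (k/(1+k)) = E - t"
  proof -
    have "(e*c - g) * (1+k) = k" using ec unfolding k_def by (simp add: power2_eq_square algebra_simps)
    then have "k/(1+k) = sin (E - t)" unfolding kk using kp by (simp add: field_simps)
    moreover have "- (pi/2) \<le> E - t" "E - t \<le> pi/2" using t E pi_gt_zero by linarith+
    ultimately show ?thesis by (simp add: arcsin_sin)
  qed
  define Y where "Y = sqrt (1+2*k)"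
  have Y: "0 < Y" "Y^2 = 1+2*k" using kp by (auto simp: Y_def)
  have sq: "Y * sqrt (1-k^2) = (1+k)*(1-2*u)"
  proof -
    have "(1+2*k)*(1-k^2) = ((1+k)*(1-2*u))^2"
    proof -
      have "(1+2*k)*(1-k) = (1+k)*(1-4*g)" using kq by (simp add: power2_eq_square algebra_simps)
      then have "(1+2*k)*(1-k)*(1+k) = (1+k)*(1-4*g)*(1+k)" by simp
      then show ?thesis by (simp add: power2_eq_square g_def algebra_simps)
    qed
    then show ?thesis unfolding Y_def real_sqrt_mult[symmetric] using u kp by simp
  qed
  have "0 < endpoint_gap k * Y^2" using endpoint_gap_pos[OF kp k1] Y(1) by simp
  also have "endpoint_gap k * Y^2 = pi/2 * (1+k-k^2) - arccos k * (Y * sqrt (1-k^2)) - arcsin (k/(1+k)) * Y^2"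
  proof -
    have J: "endpoint_gap k = pi/2 * ((1+k-k^2)/Y^2) - arccos k * sqrt (1-k^2)/Y - arcsin (k/(1+k))"
      unfolding Y(2) by (simp only: endpoint_gap_def Y_def)
    have "(p * (n/Y^2) - a*d/Y - b) * Y^2 = p*n - a*(Y*d) - b*Y^2" for p n a d b
      using Y(1) by (simp add: field_simps power2_eq_square)
    then show ?thesis unfolding J .
  qed
  also have "\<dots> = (1+k) * (pi/2*(1-2*g) - (pi/2-E-t)*(1-2*u)) - (E-t)*(1+2*k)"
    unfolding ac as sq unfolding Y kq by (simp add: algebra_simps)
  also have "(E-t)*(1+2*k) = (1+k) * ((E-t)*(1+e*c-g))"
  proof -
    have "(1+k)*(1+e*c-g) = 1+2*k" using ec unfolding k_def by (simp add: power2_eq_square algebra_simps)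
    then show ?thesis by (metis mult.left_commute)
  qed
  finally have "0 < (1+k) * ((pi/2*(1-2*g) - (pi/2-E-t)*(1-2*u)) - (E-t)*(1+e*c-g))"
    by (simp add: right_diff_distrib)
  then have "0 < (pi/2*(1-2*g) - (pi/2-E-t)*(1-2*u)) - (E-t)*(1+e*c-g)"
    using kp by (simp add: zero_less_mult_iff)
  also have "\<dots> = pi * u^2 + t * ((1-u)*(2-u) + e*c) - E * (u*(1+u) + e*c)"
    unfolding g_def by (simp add: field_simps power2_eq_square)
  finally show ?thesis unfolding E_def t_def by simp
qed


text \<open>The triangle spanned by the centers of three mutually tangent disks has sides
  \<open>x+y\<close>, \<open>y+z\<close>, \<open>z+x\<close>, and \<open>r\<close> is its inradius.
  The incircle touches the sides where the disks touch, so the half angles are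
  \<open>arctan (r/x)\<close> and so on, and the summands are areas of sectors.\<close>

definition sector_sum :: "real \<Rightarrow> real \<Rightarrow> real \<Rightarrow> real" where
  "sector_sum x y z = (let r = sqrt (x*y*z/(x+y+z)) in
     x^2 * arctan (r/x) + y^2 * arctan (r/y) + z^2 * arctan (r/z))"

text \<open>Heron's formula; the semiperimeter is \<open>x+y+z\<close>.\<close>

definition tri_area :: "real \<Rightarrow> real \<Rightarrow> real \<Rightarrow> real" where
  "tri_area x y z = sqrt (x*y*z*(x+y+z))"

section \<open>Triangles with radii \<open>q, q, 1\<close> and \<open>q, 1, 1\<close>\<close>

context
  fixes q :: real
  assumes q: "0 < q" "q \<le> 1"
begin

lemma half_ratio: "0 < q/(1+q)" "q/(1+q) \<le> 1/2" "q/(1+q) < 1" "-1 < q/(1+q)" "-1 \<le> q/(1+q)" "q/(1+q) \<le> 1"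
    "1 - (q/(1+q))^2 = (1+2*q)/(1+q)^2"
proof -
  have "1 - (q/l)^2 = (l+q)*(l-q)/l^2" if "l \<noteq> 0" for l
    using that by (simp add: field_simps power2_eq_square)
  then have "1 - (q/(1+q))^2 = (1+q+q)*(1+q-q)/(1+q)^2" using q by (metis add_pos_pos less_irrefl zero_less_one)
  also have "(1+q+q)*(1+q-q) = 1+2*q" by algebra
  finally show "1 - (q/(1+q))^2 = (1+2*q)/(1+q)^2" .
  show "0 < q/(1+q)" "q/(1+q) \<le> 1/2" "q/(1+q) < 1" using q by (auto simp: field_simps)
  then show "-1 < q/(1+q)" "-1 \<le> q/(1+q)" "q/(1+q) \<le> 1" by linarith+
qed

lemma cos_arcsin_ratio: "cos (arcsin (q/(1+q))) = sqrt (1+2*q) / (1+q)"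
  using half_ratio q by (simp add: cos_arcsin real_sqrt_divide)

lemma arcsin_ratio_range: "0 < arcsin (q/(1+q))" "arcsin (q/(1+q)) \<le> pi/6"
  using arcsin_less_arcsin[of 0 "q/(1+q)"] arcsin_le_arcsin[of "q/(1+q)" "1/2"] half_ratio by auto

lemma s_eq_sector_quotient: "s q = sector_quotient (arcsin (q/(1+q)))"
proof -
  define t where "t = arcsin (q/(1+q))"
  define w where "w = sqrt (1+2*q)"
  have w: "0 < w" using q by (simp add: w_def)
  have [simp]: "sin t = q/(1+q)" "cos t = w/(1+q)"
    using half_ratio cos_arcsin_ratio by (auto simp: t_def w_def)
  have l: "1 + q \<noteq> 0" using q by simp
  have "(pi/2 * (q/l)^2 + (1 - 2 * (q/l)) * t) / (q/l * (w/l)) = (pi * q^2 + 2 * (l * (l - 2*q)) * t) / (2*q*w)" if "l \<noteq> 0" for l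
    using w q that by (simp add: field_simps power2_eq_square)
  from this[OF l] show ?thesis
    unfolding s_def sector_quotient_def t_def[symmetric] w_def[symmetric]
    by (simp add: power2_eq_square algebra_simps)
qed

text \<open>\<open>sector_quotient_slope_pos\<close> in terms of \<open>q\<close>, cleared of
  denominators by the factor \<open>(1+q)^3\<close>.\<close>

lemma sector_quotient_slope_ratio:
  assumes "q < 1"
  shows "pi/2 * q^2 * (1+q) + (1-q) * q * sqrt (1+2*q) < arcsin (q/(1+q)) * (1+3*q+q^2+q^3)"
proof -
  define t where "t = arcsin (q/(1+q))"
  define w where "w = sqrt (1+2*q)"
  have st: "sin t = q/(1+q)" "cos t = w/(1+q)"
    using half_ratio cos_arcsin_ratio by (auto simp: t_def w_def)
  have "q/(1+q) < 1/2" using assms q by (simp add: field_simps)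
  then have "t < pi/6" using arcsin_less_arcsin[of "q/(1+q)" "1/2"] half_ratio by (simp add: t_def)
  then have "0 < t * (1 - 2*(sin t)^2 + 2*(sin t)^3) - pi/2 * (sin t)^2 - (1 - 2 * sin t) * sin t * cos t"
    using sector_quotient_slope_pos[of t] arcsin_ratio_range by (simp add: t_def)
  then have "0 < (t * (1 - 2*(q/(1+q))^2 + 2*(q/(1+q))^3) - pi/2 * (q/(1+q))^2 - (1 - 2 * (q/(1+q))) * (q/(1+q)) * (w/(1+q))) * (1+q)^3"
    unfolding st using q by (intro mult_pos_pos) auto
  also have "\<dots> = t * ((1+q)^3 - 2*q^2*(1+q) + 2*q^3) - pi/2*q^2*(1+q) - ((1+q)-2*q)*q*w"
  proof -
    have "(t * (1 - 2*(q/l)^2 + 2*(q/l)^3) - p * (q/l)^2 - (1 - 2 * (q/l)) * (q/l) * (w/l)) * l^3 =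
      t * (l^3 - 2*q^2*l + 2*q^3) - p*q^2*l - (l-2*q)*q*w" if "l \<noteq> 0" for l p
      using that by (simp add: field_simps power2_eq_square power3_eq_cube)
    then show ?thesis using q by (metis add_pos_pos less_irrefl zero_less_one)
  qed
  also have "(1+q)^3 - 2*q^2*(1+q) + 2*q^3 = 1+3*q+q^2+q^3" by algebra
  finally show ?thesis unfolding t_def[symmetric] w_def[symmetric] by (simp add: algebra_simps)
qed

lemma arctan_small_angle: "arctan (q / sqrt (1+2*q)) = arcsin (q/(1+q))"
proof -
  have "arcsin (q/(1+q)) = arctan (q/(1+q) / sqrt ((1+2*q)/(1+q)^2))"
    using arcsin_arctan[of "q/(1+q)"] half_ratio by simp
  also have "q/(1+q) / sqrt ((1+2*q)/(1+q)^2) = q / sqrt (1+2*q)"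
    using q by (simp add: real_sqrt_divide)
  finally show ?thesis by simp
qed

lemma arctan_big_angle: "2 * arctan (1 / sqrt (1+2*q)) = pi/2 - arcsin (q/(1+q))"
proof -
  define w where "w = sqrt (1+2*q)"
  have w: "1 < w" "w^2 = 1+2*q" using q by (auto simp: w_def)
  have "2 * arctan (1/w) = arctan (2*(1/w)/(1 - (1/w)^2))" using w by (intro arctan_double) auto
  also have "2*(1/w)/(1 - (1/w)^2) = 2*w/(w^2-1)" using w(1) by (simp add: field_simps power2_eq_square)
  also have "\<dots> = 1/(q/w)" unfolding w using q by simp
  also have "arctan (1/(q/w)) = pi/2 - arctan (q/w)" using arctan_inverse[of "q/w"] q w by simp
  finally show ?thesis using arctan_small_angle by (simp add: w_def)
qed

lemma sector_sum_two_small: "sector_sum q q 1 = s q * tri_area q q 1"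
proof -
  define w where "w = sqrt (1+2*q)"
  define t where "t = arcsin (q/(1+q))"
  have w: "0 < w" using q by (simp add: w_def)
  have eq: "q + q + 1 = 1 + 2*q" by simp
  have r: "sqrt (q*q*1/(q+q+1)) = q/w" unfolding eq using q by (simp add: w_def real_sqrt_divide)
  have "tri_area q q 1 = q * w" unfolding tri_area_def eq using q by (simp add: w_def real_sqrt_mult)
  moreover have "sector_sum q q 1 = q^2 * (2 * arctan (1/w)) + t"
    unfolding sector_sum_def Let_def r using q arctan_small_angle by (simp add: w_def t_def)
  moreover have "2 * arctan (1/w) = pi/2 - t" using arctan_big_angle by (simp add: w_def t_def)
  moreover have "s q * (q * w) = (pi * q^2 + 2*(1-q^2)*t)/2"
    using w q unfolding s_def w_def[symmetric] t_def[symmetric] by (simp add: field_simps)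
  ultimately show ?thesis by (simp add: algebra_simps)
qed

text \<open>The areas of the two triangles are \<open>m\<close> and \<open>q*w\<close>, and the
  claim is cross-multiplied with them. A further factor \<open>m + q*w\<close> removes the
  difference of roots, as \<open>(m - q*w) * (m + q*w) = 2*q*(1-q^2)\<close>; after division by
  \<open>q*(1-q^2)\<close> what remains is \<open>endpoint_ineq\<close>.\<close>

lemma sector_sum_two_large:
  assumes "q < 1"
  shows "sector_sum q 1 1 < s q * tri_area q 1 1"
proof -
  define w where "w = sqrt (1+2*q)"
  define m where "m = sqrt (q*(2+q))"
  define t where "t = arcsin (q/(1+q))"
  define r where "r = sqrt (q/(2+q))"
  define E where "E = 2 * arctan r"
  have w: "0 < w" "w^2 = 1+2*q" using q by (auto simp: w_def)
  have m: "0 < m" "m^2 = q*(2+q)" using q by (auto simp: m_def)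
  have r: "0 < r" "r^2 = q/(2+q)" "r < 1" using q by (auto simp: r_def)
  have u: "0 < q/(1+q)" "q/(1+q) < 1/2" using assms q by (auto simp: field_simps)
  have Ea: "E = arccos (1 - q/(1+q))"
  proof -
    have "cos E = 2 * (cos (arctan r))^2 - 1" unfolding E_def by (rule cos_double_cos)
    also have "(cos (arctan r))^2 = 1/(1+r^2)" by (simp add: cos_arctan power_divide)
    also have "1/(1+r^2) = (2+q)/(2+2*q)" unfolding r using q by (simp add: field_simps)
    also have "2 * \<dots> - 1 = 1 - q/(1+q)" using q by (simp add: field_simps)
    finally have "cos E = 1 - q/(1+q)" .
    moreover have "0 \<le> E" "E \<le> pi" using arctan_bounded[of r] r by (auto simp: E_def)
    ultimately show ?thesis using arccos_cos by metis
  qed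
  \<comment> \<open>Both unit disks have the angle \<open>E\<close>, so \<open>pi/2 - E\<close> is
    half the angle at the small disk.\<close>
  have big: "arctan (r/q) = pi/2 - E"
  proof -
    have "E = arctan (2*r/(1-r^2))" unfolding E_def using r by (intro arctan_double) auto
    also have "2*r/(1-r^2) = 1/(r/q)"
    proof -
      have "q = r^2 * (2+q)" using r q by simp
      then have "2*r*r = q*(1-r^2)" by (simp add: algebra_simps power2_eq_square)
      moreover have "1 - r^2 \<noteq> 0" using r(3) r(1) by (simp add: power2_eq_1_iff)
      moreover have "2*r/d = 1/(r/q)" if "2*r*r = q*d" "d \<noteq> 0" for d
        using that r q by (simp add: field_simps)
      ultimately show ?thesis by blast
    qed
    also have "arctan (1/(r/q)) = pi/2 - arctan (r/q)" using arctan_inverse[of "r/q"] q r by simp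
    finally show ?thesis by simp
  qed
  have N: "sector_sum q 1 1 = q^2 * (pi/2 - E) + E"
    using big unfolding sector_sum_def Let_def E_def by (simp add: r_def)
  have M: "tri_area q 1 1 = m" by (simp add: tri_area_def m_def add.commute)
  have S: "s q * (q*w) = pi/2 * q^2 + (1-q^2)*t"
    using w q unfolding s_def w_def[symmetric] t_def[symmetric] by (simp add: field_simps)
  \<comment> \<open>This is \<open>endpoint_ineq\<close> at \<open>u = q/(1+q)\<close>, multiplied
    by \<open>(1+q)^2\<close>.\<close>
  have "0 < t * (m/q*(m + q*w)) + pi * q^2 - E * (w*(q*w + m))"
  proof -
    let ?u = "q/(1+q)"
    have e: "sqrt (?u*(2-?u)) = m/(1+q)"
    proof -
      have "?u*(2-?u) = q*(2+q)/(1+q)^2" using q by (simp add: field_simps power2_eq_square)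
      then show ?thesis using q by (simp add: m_def real_sqrt_divide)
    qed
    have c: "sqrt (1-?u^2) = w/(1+q)" using half_ratio q by (simp add: w_def real_sqrt_divide)
    have "E * (?u*(1+?u) + m/(1+q)*(w/(1+q))) < pi * ?u^2 + t * ((1-?u)*(2-?u) + m/(1+q)*(w/(1+q)))"
      using endpoint_ineq[OF u] unfolding e c Ea t_def .
    then have lt: "E * (?u*(1+?u) + m/(1+q)*(w/(1+q))) * (1+q)^2 < (pi * ?u^2 + t * ((1-?u)*(2-?u) + m/(1+q)*(w/(1+q)))) * (1+q)^2"
      using q by (intro mult_strict_right_mono) auto
    have e1: "E * (q/l*(1+q/l) + m/l*(w/l)) * l^2 = E * (q*(l+q) + m*w)" if "l \<noteq> 0" for l
      using that by (simp add: field_simps power2_eq_square)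
    have e2: "(pi * (q/l)^2 + t * ((1-q/l)*(2-q/l) + m/l*(w/l))) * l^2 = pi*q^2 + t * ((l-q)*(2*l-q) + m*w)" if "l \<noteq> 0" for l
      using that by (simp add: field_simps power2_eq_square)
    have l: "1 + q \<noteq> 0" using q by simp
    have "E * (q*((1+q)+q) + m*w) < pi*q^2 + t * (((1+q)-q)*(2*(1+q)-q) + m*w)" using lt unfolding e1[OF l] e2[OF l] .
    moreover have "q*((1+q)+q) + m*w = w*(q*w + m)" using w(2) by (simp add: algebra_simps power2_eq_square)
    moreover have "((1+q)-q)*(2*(1+q)-q) + m*w = m/q*(m + q*w)" using m(2) q by (simp add: field_simps power2_eq_square)
    ultimately show ?thesis by simp
  qed
  then have "0 < (1-q^2) * q * (t * (m/q*(m + q*w)) + pi * q^2 - E * (w*(q*w + m)))"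
    using assms q by (simp add: abs_square_less_1)
  also have "\<dots> = (1-q^2) * (pi * q^3) + (1-q^2) * (t*m - E*q*w) * (m+q*w)"
    using q by (simp add: field_simps power2_eq_square power3_eq_cube)
  also have "(1-q^2) * (pi * q^3) = pi/2*q^2 * (m - q*w) * (m+q*w)"
  proof -
    have "(m - q*w) * (m+q*w) = m^2 - q^2*w^2" by algebra
    also have "\<dots> = 2*q*(1-q^2)" unfolding w m by algebra
    finally have "pi/2*q^2 * ((m - q*w) * (m+q*w)) = pi/2*q^2*(2*q*(1-q^2))" by simp
    then show ?thesis by (simp add: algebra_simps power2_eq_square power3_eq_cube)
  qed
  also have "pi/2*q^2 * (m - q*w) * (m+q*w) + (1-q^2) * (t*m - E*q*w) * (m+q*w)
     = ((pi/2*q^2 + (1-q^2)*t)*m - (pi/2*q^2 + (1-q^2)*E)*(q*w)) * (m+q*w)"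
  proof -
    have "h*(m-q*w)*S + f*(t*m-E*q*w)*S = ((h+f*t)*m-(h+f*E)*(q*w))*S" for h f S
      by (simp add: algebra_simps)
    then show ?thesis .
  qed
  finally have "0 < (pi/2*q^2 + (1-q^2)*t)*m - (pi/2*q^2 + (1-q^2)*E)*(q*w)"
    by (rule zero_less_mult_pos2) (use m w q in \<open>simp add: add_pos_pos\<close>)
  then have "(pi/2*q^2 + (1-q^2)*E)*(q*w) < s q * (q*w) * m" unfolding S by simp
  then have "(pi/2*q^2 + (1-q^2)*E)*(q*w) < (s q * m) * (q*w)" by (simp add: mult_ac)
  then have "pi/2*q^2 + (1-q^2)*E < s q * m" using q w by (simp add: mult_less_cancel_right)
  then show ?thesis unfolding N M by (simp add: algebra_simps)
qed

end

lemma s_antimono: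
  assumes "0 < a" "a < b" "b \<le> 1"
  shows "s b < s a"
proof -
  have "a/(1+a) < b/(1+b)" using assms by (simp add: field_simps)
  then have "arcsin (a/(1+a)) < arcsin (b/(1+b))"
    using half_ratio[of a] half_ratio[of b] assms by (intro arcsin_less_arcsin) auto
  then show ?thesis
    using sector_quotient_antimono arcsin_ratio_range[of a] arcsin_ratio_range[of b] s_eq_sector_quotient assms by auto
qed

section \<open>Triangles with a disk of intermediate size\<close>


text \<open>Exactly the inequality that makes \<open>arctan_defect\<close> decreasing.\<close>

lemma arctan_upper:
  fixes t :: real
  assumes "0 < t"
  shows "arctan t < t - t^3/(3*(1+t^2))"
proof -
  have pos: "1 + x^2 \<noteq> 0" "3 * (1+x^2) \<noteq> 0" for x :: real by (metis power_one sum_power2_eq_zero_iff zero_neq_one, metis mult_eq_0_iff power_one sum_power2_eq_zero_iff zero_neq_numeral zero_neq_one)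
  let ?f = "\<lambda>t. t - t^3/(3*(1+t^2)) - arctan t :: real"
  obtain z where z: "0 < z" "z < t" "?f t - ?f 0 = (t - 0) * (2*z^4/(3*(1+z^2)^2))"
  proof (rule mvt_obtain[of 0 t ?f "\<lambda>z. 2*z^4/(3*(1+z^2)^2)"])
    show "continuous_on {0..t} ?f" using pos by (intro continuous_intros) auto
    fix x :: real
    have d0: "(?f has_real_derivative 1 - (3*x^2*(3*(1+x^2)) - x^3*(6*x))/((3*(1+x^2))*(3*(1+x^2))) - 1/(1+x^2)) (at x)"
      using pos by (auto intro!: derivative_eq_intros simp: inverse_eq_divide)
    have "1 - (3*x^2*(3*c) - x^3*(6*x))/((3*c)*(3*c)) - 1/c = (9*c^2 - (9*x^2*c - 6*x^4) - 9*c)/(9*c^2)" if "c \<noteq> 0" for c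
      using that by (simp add: field_simps power2_eq_square eval_nat_numeral)
    from this[OF pos(1)] have d1: "1 - (3*x^2*(3*(1+x^2)) - x^3*(6*x))/((3*(1+x^2))*(3*(1+x^2))) - 1/(1+x^2)
       = (9*(1+x^2)^2 - (9*x^2*(1+x^2) - 6*x^4) - 9*(1+x^2))/(9*(1+x^2)^2)" .
    have "9*(1+x^2)^2 - (9*x^2*(1+x^2) - 6*x^4) - 9*(1+x^2) = 3*(2*x^4)" by algebra
    then have "(9*(1+x^2)^2 - (9*x^2*(1+x^2) - 6*x^4) - 9*(1+x^2))/(9*(1+x^2)^2) = 2*x^4/(3*(1+x^2)^2)"
      by (simp only:)
    then show "(?f has_real_derivative 2*x^4/(3*(1+x^2)^2)) (at x)" using d0 unfolding d1 by (simp only:)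
  qed (use assms in auto)
  have "0 < 1 + z^2" by (simp add: add_pos_nonneg)
  then have "0 < (t - 0) * (2*z^4/(3*(1+z^2)^2))" using z assms by simp
  then show ?thesis using z(3) by simp
qed

text \<open>Exactly the inequality that makes \<open>arctan_defect_slope\<close> nondecreasing. The
  range up to 1 fits its arguments later on, which are bounded by
  \<open>mid_arg_le_1\<close>.\<close>

lemma arctan_lower:
  fixes t :: real
  assumes "0 < t" "t \<le> 1"
  shows "t - t^3*(1+2*t^2)/(3*(1+t^2)^2) \<le> arctan t"
proof -
  have pos: "1 + x^2 \<noteq> 0" "3 * (1+x^2)^2 \<noteq> 0" for x :: real by (metis power_one sum_power2_eq_zero_iff zero_neq_one, metis mult_eq_0_iff power_one sum_power2_eq_zero_iff zero_neq_numeral zero_neq_one power_not_zero)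
  let ?f = "\<lambda>t. arctan t - (t - t^3*(1+2*t^2)/(3*(1+t^2)^2)) :: real"
  obtain z where z: "0 < z" "z < t" "?f t - ?f 0 = (t - 0) * ((3*z^4 - z^6)/(3*(1+z^2)^3))"
  proof (rule mvt_obtain[of 0 t ?f "\<lambda>z. (3*z^4 - z^6)/(3*(1+z^2)^3)"])
    show "continuous_on {0..t} ?f" using pos by (intro continuous_intros) auto
    fix x :: real
    have n: "((\<lambda>t. t^3*(1+2*t^2)) has_real_derivative 3*x^2+10*x^4) (at x)"
      by (auto intro!: derivative_eq_intros simp: algebra_simps power2_eq_square eval_nat_numeral)
    have d: "((\<lambda>t. 3*(1+t^2)^2) has_real_derivative 12*x*(1+x^2)) (at x)"
      by (auto intro!: derivative_eq_intros)
    have "(?f has_real_derivative inverse (1+x^2) - (1 - ((3*x^2+10*x^4)*(3*(1+x^2)^2) - x^3*(1+2*x^2)*(12*x*(1+x^2)))/((3*(1+x^2)^2)*(3*(1+x^2)^2)))) (at x)"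
      by (intro DERIV_diff DERIV_arctan DERIV_ident DERIV_divide n d pos)
    moreover have "inverse c - (1 - (n*(3*c^2) - m*(12*x*c))/((3*c^2)*(3*c^2))) = (3*c^2 - 3*c^3 + n*c - 4*x*m)/(3*c^3)" if "c \<noteq> 0" for c n m
      using that by (simp add: field_simps power2_eq_square eval_nat_numeral)
    from this[OF pos(1)] have "inverse (1+x^2) - (1 - ((3*x^2+10*x^4)*(3*(1+x^2)^2) - x^3*(1+2*x^2)*(12*x*(1+x^2)))/((3*(1+x^2)^2)*(3*(1+x^2)^2)))
       = (3*(1+x^2)^2 - 3*(1+x^2)^3 + (3*x^2+10*x^4)*(1+x^2) - 4*x*(x^3*(1+2*x^2)))/(3*(1+x^2)^3)" .
    moreover have "3*(1+x^2)^2 - 3*(1+x^2)^3 + (3*x^2+10*x^4)*(1+x^2) - 4*x*(x^3*(1+2*x^2)) = 3*x^4 - x^6" by algebra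
    ultimately show "(?f has_real_derivative (3*x^4 - x^6)/(3*(1+x^2)^3)) (at x)" by simp
  qed (use assms in auto)
  have "z^6 \<le> z^4" using z assms by (intro power_decreasing) auto
  moreover have "0 \<le> z^4" using z by simp
  ultimately have "0 \<le> 3*z^4 - z^6" by linarith
  moreover have "0 < 1 + z^2" by (simp add: add_pos_nonneg)
  ultimately have "0 \<le> (t - 0) * ((3*z^4 - z^6)/(3*(1+z^2)^3))" using assms by simp
  then show ?thesis using z(3) by simp
qed

text \<open>Varying the middle radius leaves a single transcendental term in the derivative of
  \<open>sector_sum\<close>; after normalization it is this function.\<close>

definition arctan_defect :: "real \<Rightarrow> real" where
  "arctan_defect t = (t - arctan t) / t^3"

text \<open>The derivative of \<open>arctan_defect\<close>, times \<open>-t^2\<close>.\<close>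

definition arctan_defect_slope :: "real \<Rightarrow> real" where
  "arctan_defect_slope t = 3*(t - arctan t)/t^2 - t/(1+t^2)"

lemma one_plus_square_nz: "1 + x^2 \<noteq> (0::real)"
  by (metis power_one sum_power2_eq_zero_iff zero_neq_one)

lemma arctan_defect_deriv:
  assumes "0 < t"
  shows "(arctan_defect has_real_derivative - arctan_defect_slope t / t^2) (at t)"
proof -
  have n: "((\<lambda>t. t - arctan t) has_real_derivative 1 - inverse (1+t^2)) (at t)"
    by (intro DERIV_diff DERIV_arctan DERIV_ident)
  have d: "((\<lambda>t. t^3) has_real_derivative 3*t^2) (at t)" by (auto intro!: derivative_eq_intros)
  have "(arctan_defect has_real_derivative ((1 - inverse (1+t^2))*t^3 - (t - arctan t)*(3*t^2))/(t^3*t^3)) (at t)"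
    unfolding arctan_defect_def using assms by (intro DERIV_divide n d) auto
  moreover have "((1 - inverse c)*t^3 - a*(3*t^2))/(t^3*t^3) = - (3*a/t^2 - (c-1)/(c*t))/t^2" if "c \<noteq> 0" for a c
    using that assms by (simp add: field_simps power2_eq_square eval_nat_numeral)
  from this[OF one_plus_square_nz[of t], of "t - arctan t"]
  have "((1 - inverse (1+t^2))*t^3 - (t - arctan t)*(3*t^2))/(t^3*t^3) = - (3*(t - arctan t)/t^2 - t^2/((1+t^2)*t))/t^2"
    by simp
  moreover have "t^2/((1+t^2)*t) = t/(1+t^2)" using assms by (simp add: power2_eq_square)
  ultimately show ?thesis unfolding arctan_defect_slope_def by simp
qed

lemma arctan_defect_slope_pos:
  assumes "0 < t"
  shows "0 < arctan_defect_slope t"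
proof -
  have "t^3/(3*(1+t^2)) < t - arctan t" using arctan_upper[OF assms] by simp
  then have lt: "3 * (t^3/(3*(1+t^2)))/t^2 < 3 * (t - arctan t)/t^2" using assms by (intro divide_strict_right_mono mult_strict_left_mono) auto
  have c: "3 * (t^3/(3*c))/t^2 = t/c" for c using assms by (simp add: power2_eq_square power3_eq_cube)
  show ?thesis using lt unfolding c arctan_defect_slope_def by (simp only: diff_gt_0_iff_gt)
qed

text \<open>The derivative is \<open>6/t^3\<close> times the slack in
  \<open>arctan_lower\<close>.\<close>

lemma arctan_defect_slope_mono:
  assumes "0 < a" "a < b" "b \<le> 1"
  shows "arctan_defect_slope a \<le> arctan_defect_slope b"
proof (rule DERIV_nonneg_imp_nondecreasing[where f=arctan_defect_slope])
  show "a \<le> b" using assms by simp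
  fix t assume t: "a \<le> t" "t \<le> b"
  then have t0: "0 < t" "t \<le> 1" using assms by auto
  let ?A = "t - arctan t" and ?c = "1 + t^2"
  have d1: "((\<lambda>t. 3*(t - arctan t)) has_real_derivative 3*(1 - inverse ?c)) (at t)"
    by (intro DERIV_cmult DERIV_diff DERIV_arctan DERIV_ident)
  have d2: "((\<lambda>t. t^2) has_real_derivative 2*t) (at t)" "((\<lambda>t. 1+t^2) has_real_derivative 2*t) (at t)"
    by (auto intro!: derivative_eq_intros)
  have "(arctan_defect_slope has_real_derivative (3*(1 - inverse ?c)*t^2 - 3*?A*(2*t))/(t^2*t^2) - (1*?c - t*(2*t))/(?c*?c)) (at t)"
    unfolding arctan_defect_slope_def using t0
    by (intro DERIV_diff DERIV_divide d1 d2 DERIV_ident one_plus_square_nz) auto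
  moreover have "(3*(1 - inverse c)*t^2 - 3*A*(2*t))/(t^2*t^2) - (1*c - t*(2*t))/(c*c)
      = 6/t^3 * ((3*(c-1)*c*t - t^3*(c - 2*t^2))/(6*c^2) - A)" if "c \<noteq> 0" for A c
    using that t0 by (simp add: field_simps power2_eq_square eval_nat_numeral)
  from this[OF one_plus_square_nz] have "(3*(1 - inverse ?c)*t^2 - 3*?A*(2*t))/(t^2*t^2) - (1*?c - t*(2*t))/(?c*?c)
      = 6/t^3 * ((3*(?c-1)*?c*t - t^3*(?c - 2*t^2))/(6*?c^2) - ?A)" .
  moreover have "(3*(?c-1)*?c*t - t^3*(?c - 2*t^2))/(6*?c^2) = t^3*(1+2*t^2)/(3*?c^2)"
  proof -
    have "3*(?c-1)*?c*t - t^3*(?c - 2*t^2) = 2*(t^3*(1+2*t^2))" by algebra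
    then show ?thesis by simp
  qed
  moreover have "0 \<le> 6/t^3 * (t^3*(1+2*t^2)/(3*?c^2) - ?A)"
    using arctan_lower[OF t0] t0 by (intro mult_nonneg_nonneg) auto
  ultimately show "\<exists>y. (arctan_defect_slope has_real_derivative y) (at t) \<and> 0 \<le> y" by metis
qed


section \<open>The derivative with respect to the middle radius\<close>

context
  fixes q :: real
  assumes q: "0 < q" "q < 1"
begin

text \<open>For the radii \<open>q, y, 1\<close> this is, up to a positive factor, the derivative of \<open>sector_sum - s q * tri_area\<close>
  with respect to \<open>y\<close>.  It is negative at \<open>y = q\<close> and convex, hence changes its sign at most once.\<close>

definition mid_slope :: "real \<Rightarrow> real" where
  "mid_slope y = (1 - s q) * ((1+q+y)*(1+q+2*y)) / (4*q) - arctan_defect (sqrt (q/(y*(1+q+y))))"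

text \<open>The density is symmetric in the first two radii, so its derivative in \<open>y\<close>
  at \<open>y = q\<close> is half the derivative of \<open>s\<close>. The claim is therefore the
  monotonicity of \<open>s\<close> in disguise, namely
  \<open>sector_quotient_slope_ratio\<close>.\<close>

lemma mid_slope_start: "mid_slope q < 0"
proof -
  define w where "w = sqrt (1+2*q)"
  define t where "t = arcsin (q/(1+q))"
  define B where "B = arctan (1/w)"
  have w: "0 < w" "w^2 = 1+2*q" using q by (auto simp: w_def)
  have B: "2 * B = pi/2 - t" using arctan_big_angle[of q] q by (simp add: B_def w_def t_def)
  have S: "s q * (q*w) = pi/2 * q^2 + (1-q^2)*t"
    using w q unfolding s_def w_def[symmetric] t_def[symmetric] by (simp add: field_simps)
  have eq: "1+q+q = 1+2*q" by simp
  have "sqrt (q/(q*(1+q+q))) = 1/w" unfolding eq using q by (simp add: w_def real_sqrt_divide)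
  then have "arctan_defect (sqrt (q/(q*(1+q+q)))) = (1/w - B)/(1/w)^3" by (simp only: arctan_defect_def B_def)
  also have "(1/w - B)/(1/w)^3 = w^2 * (1 - B*w)"
    using w(1) by (simp add: field_simps power2_eq_square power3_eq_cube)
  finally have g: "arctan_defect (sqrt (q/(q*(1+q+q)))) = w^2 * (1 - B*w)" .
  have K: "pi/2 * q^2 * (1+q) + (1-q) * q * w < t * (1+3*q+q^2+q^3)"
    using sector_quotient_slope_ratio[of q] q by (simp add: t_def w_def)
  have "(1-q)*(q*w) + 2*(2*B)*q^2*w^2 < (s q * (q*w)) * (1+3*q)"
  proof -
    have "(h * q^2 + (1-q^2)*t) * (1+3*q) - 2*(h - t)*q^2*(1+2*q) = t * (1+3*q+q^2+q^3) - h * q^2 * (1+q)" for h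
      by (simp add: algebra_simps power2_eq_square power3_eq_cube)
    from this[of "pi/2"] show ?thesis unfolding S B w using K by (simp add: mult.assoc)
  qed
  then have "(1 - q + 4*q*B*w) * (q*w) < (s q * (1+3*q)) * (q*w)"
    by (simp add: algebra_simps power2_eq_square)
  then have "1 - q + 4*q*B*w < s q * (1+3*q)" using q w by (simp add: mult_less_cancel_right)
  then have "(1 - s q) * (1+3*q) < 4*q*(1 - B*w)" by (simp add: algebra_simps)
  then have "(1 - s q) * (1+3*q) * (w^2/(4*q)) < 4*q*(1 - B*w) * (w^2/(4*q))"
    using q w by (intro mult_strict_right_mono) auto
  moreover have "4*q*(1 - B*w) * (w^2/(4*q)) = w^2 * (1 - B*w)" using q by simp
  moreover have "(1 - s q) * (1+3*q) * (w^2/(4*q)) = (1 - s q) * ((1+q+q)*(1+q+2*q)) / (4*q)"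
  proof -
    have "1+q+2*q = 1+3*q" by simp
    then show ?thesis unfolding w eq by (simp only: mult_ac times_divide_eq_left times_divide_eq_right)
  qed
  ultimately show ?thesis unfolding mid_slope_def g by linarith
qed

text \<open>The inradius divided by \<open>y\<close>, that is, the tangent of half the angle at the
  middle disk.\<close>

definition mid_arg :: "real \<Rightarrow> real" where
  "mid_arg y = sqrt (q/(y*(1+q+y)))"

lemma mid_arg: 
  assumes "0 < y"
  shows "0 < mid_arg y" "(mid_arg y)^2 = q/(y*(1+q+y))"
  using q assms by (auto simp: mid_arg_def)

lemma mid_arg_le_1: 
  assumes "q \<le> y" shows "mid_arg y \<le> 1"
proof -
  have "q * 1 \<le> y * (1+q+y)" using assms q by (intro mult_mono) auto
  then show ?thesis using q assms by (simp add: mid_arg_def)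
qed

lemma mid_arg_deriv:
  assumes y: "0 < y"
  shows "(mid_arg has_real_derivative - (mid_arg y^3 * (1+q+2*y)/(2*q))) (at y)"
proof -
  have l: "((\<lambda>y. y*(1+q+y)) has_real_derivative 1+q+2*y) (at y)"
    by (auto intro!: derivative_eq_intros)
  have pos: "0 < y*(1+q+y)" using q y by (intro mult_pos_pos) auto
  have "((\<lambda>y. q/(y*(1+q+y))) has_real_derivative (0*(y*(1+q+y)) - q*(1+q+2*y))/((y*(1+q+y))*(y*(1+q+y)))) (at y)"
    using pos by (intro DERIV_divide l DERIV_const) auto
  from DERIV_chain2[OF DERIV_real_sqrt this]
  have "(mid_arg has_real_derivative inverse (mid_arg y)/2 * ((0*(y*(1+q+y)) - q*(1+q+2*y))/((y*(1+q+y))*(y*(1+q+y))))) (at y)"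
    unfolding mid_arg_def using pos q by simp
  moreover have "inverse (mid_arg y)/2 * ((0*(y*(1+q+y)) - q*(1+q+2*y))/((y*(1+q+y))*(y*(1+q+y)))) = - (mid_arg y^3 * (1+q+2*y)/(2*q))"
  proof -
    have m: "y*(1+q+y) = q/(mid_arg y)^2" using mid_arg[OF y] q pos by (simp add: field_simps)
    have "inverse a/2 * ((0*(q/a^2) - q*c)/((q/a^2)*(q/a^2))) = - (a^3*c/(2*q))" if "0 < a" for a c
      using that q by (simp add: field_simps power2_eq_square power3_eq_cube)
    from this[OF mid_arg(1)[OF y]] show ?thesis unfolding m .
  qed
  ultimately show ?thesis by simp
qed

definition mid_curv :: "real \<Rightarrow> real" where
  "mid_curv y = (1 - s q)*(3*(1+q)+4*y)/(4*q) - arctan_defect_slope (mid_arg y) * (mid_arg y * (1+q+2*y)) / (2*q)"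

lemma mid_slope_deriv:
  assumes y: "0 < y"
  shows "(mid_slope has_real_derivative mid_curv y) (at y)"
proof -
  note m = mid_arg[OF y]
  have d1: "((\<lambda>y. (1 - s q) * ((1+q+y)*(1+q+2*y)) / (4*q)) has_real_derivative (1 - s q)*(3*(1+q)+4*y)/(4*q)) (at y)"
  proof -
    have "((\<lambda>y. (1+q+y)*(1+q+2*y)) has_real_derivative 3*(1+q)+4*y) (at y)"
      by (auto intro!: derivative_eq_intros)
    then show ?thesis by (intro DERIV_cdivide DERIV_cmult)
  qed
  have d2: "((\<lambda>y. arctan_defect (mid_arg y)) has_real_derivative
      - arctan_defect_slope (mid_arg y) / (mid_arg y)^2 * - (mid_arg y^3 * (1+q+2*y)/(2*q))) (at y)"
    by (rule DERIV_chain2[OF arctan_defect_deriv[OF m(1)] mid_arg_deriv[OF y]])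
  have "(mid_slope has_real_derivative (1 - s q)*(3*(1+q)+4*y)/(4*q)
       - - arctan_defect_slope (mid_arg y) / (mid_arg y)^2 * - (mid_arg y^3 * (1+q+2*y)/(2*q))) (at y)"
    unfolding mid_slope_def using DERIV_diff[OF d1 d2] by (simp only: mid_arg_def)
  moreover have "- k / a^2 * - (a^3 * c/(2*q)) = k * (a*c)/(2*q)" if "0 < a" for k a c
    using that q by (simp add: field_simps power2_eq_square power3_eq_cube)
  ultimately show ?thesis unfolding mid_curv_def using m(1) by metis
qed

text \<open>The subtracted term of \<open>mid_curv\<close> is positive, so a positive value at
  \<open>x\<close> forces \<open>1 - s q > 0\<close>. Then the first term increases with
  \<open>y\<close>, while the subtracted one does not: \<open>mid_arg\<close> decreases,
  \<open>arctan_defect_slope\<close> is nondecreasing, and the remaining factor is handled through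
  its square.\<close>

lemma mid_curv_mono:
  assumes "q \<le> x" "x < y" "0 < mid_curv x"
  shows "0 < mid_curv y"
proof -
  have pos: "0 < x" "0 < y" using assms q by auto
  note m = mid_arg[OF pos(1)] mid_arg[OF pos(2)]
  have lt: "mid_arg y < mid_arg x"
  proof -
    have "x*(1+q+x) < y*(1+q+y)" using assms pos q by (intro mult_strict_mono) auto
    then show ?thesis unfolding mid_arg_def using pos q by (simp add: frac_less2)
  qed
  \<comment> \<open>Completing the square displays this as a decreasing function of
    \<open>z*(1+q+z)\<close>.\<close>
  have sq: "(mid_arg z * (1+q+2*z))^2 = q*(4 + (1+q)^2/(z*(1+q+z)))" if "0 < z" for z
  proof -
    have "(1+q+2*z)^2 = 4*(z*(1+q+z)) + (1+q)^2" by algebra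
    moreover have "q/d*(4*d+e) = q*(4+e/d)" if "0 < d" for d e using that by (simp add: field_simps)
    moreover have "0 < z*(1+q+z)" using that q by (intro mult_pos_pos) auto
    ultimately show ?thesis unfolding power_mult_distrib mid_arg(2)[OF that] by simp
  qed
  have "(mid_arg y * (1+q+2*y))^2 \<le> (mid_arg x * (1+q+2*x))^2"
  proof -
    have "x*(1+q+x) \<le> y*(1+q+y)" "0 < x*(1+q+x)" using assms pos q by (intro mult_mono mult_pos_pos; simp)+
    then have "(1+q)^2/(y*(1+q+y)) \<le> (1+q)^2/(x*(1+q+x))"
      using pos q by (intro divide_left_mono mult_pos_pos) auto
    then show ?thesis unfolding sq[OF pos(1)] sq[OF pos(2)] using q by (intro mult_left_mono) auto
  qed
  then have le: "mid_arg y * (1+q+2*y) \<le> mid_arg x * (1+q+2*x)"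
    by (rule power2_le_imp_le) (use m pos q in auto)
  have "arctan_defect_slope (mid_arg y) \<le> arctan_defect_slope (mid_arg x)"
    using arctan_defect_slope_mono[OF m(3) lt] mid_arg_le_1 assms by simp
  then have "arctan_defect_slope (mid_arg y) * (mid_arg y * (1+q+2*y)) \<le> arctan_defect_slope (mid_arg x) * (mid_arg x * (1+q+2*x))"
    using le m pos q arctan_defect_slope_pos[OF m(1)] by (rule_tac mult_mono) auto
  then have r: "arctan_defect_slope (mid_arg y) * (mid_arg y * (1+q+2*y)) / (2*q) \<le> arctan_defect_slope (mid_arg x) * (mid_arg x * (1+q+2*x)) / (2*q)"
    using q by (intro divide_right_mono) auto
  have "0 < arctan_defect_slope (mid_arg x) * (mid_arg x * (1+q+2*x)) / (2*q)"
    using m pos q arctan_defect_slope_pos[OF m(1)] by (intro divide_pos_pos mult_pos_pos) auto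
  then have "0 < (1 - s q)*(3*(1+q)+4*x)/(4*q)" using assms(3) unfolding mid_curv_def by linarith
  then have "0 < 1 - s q" using q pos by (simp add: zero_less_divide_iff zero_less_mult_iff)
  then have "(1 - s q)*(3*(1+q)+4*x)/(4*q) \<le> (1 - s q)*(3*(1+q)+4*y)/(4*q)"
    using assms q by (intro divide_right_mono mult_left_mono) auto
  then show ?thesis using assms(3) r unfolding mid_curv_def by linarith
qed

text \<open>To climb from a negative value at \<open>q\<close> to a nonnegative one at
  \<open>x\<close>, \<open>mid_slope\<close> must have a positive derivative somewhere in between,
  and by \<open>mid_curv_mono\<close> that derivative stays positive.\<close>

lemma mid_slope_sign:
  assumes "q < x" "x < y" "0 \<le> mid_slope x"
  shows "0 < mid_slope y"
proof -
  have cont: "continuous_on {a..b} mid_slope" if "0 < a" for a b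
    using that by (intro continuous_at_imp_continuous_on ballI DERIV_isCont[OF mid_slope_deriv]) auto
  obtain z1 where z1: "q < z1" "z1 < x" "mid_slope x - mid_slope q = (x - q) * mid_curv z1"
    using assms q by (rule_tac mvt_obtain[of q x mid_slope mid_curv]) (auto intro: cont mid_slope_deriv)
  obtain z2 where z2: "x < z2" "z2 < y" "mid_slope y - mid_slope x = (y - x) * mid_curv z2"
    using assms q by (rule_tac mvt_obtain[of x y mid_slope mid_curv]) (auto intro: cont mid_slope_deriv)
  have "0 < (x - q) * mid_curv z1" using z1 mid_slope_start assms by linarith
  then have "0 < mid_curv z1" using assms by (simp add: zero_less_mult_iff)
  then have "0 < mid_curv z2" using mid_curv_mono[of z1 z2] z1 z2 by simp
  then have "0 < (y - x) * mid_curv z2" using assms by simp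
  then show ?thesis using z2 assms by linarith
qed

text \<open>Since \<open>x*(x+y+z) + y*z = (x+y)*(x+z)\<close>, the expression
  \<open>1 + (r/x)^2\<close> factors for each of the three radii. The derivatives of the three
  arctangents then add up to a simple algebraic term, and only \<open>B\<close>, from
  differentiating the coefficient \<open>y^2\<close>, stays transcendental.\<close>

lemma sector_sum_mid_deriv:
  assumes y: "0 < y"
  shows "((\<lambda>y. s q * tri_area q y 1 - sector_sum q y 1) has_real_derivative
     - (sqrt (q*y/(1+q+y)) / (2*y) * (4*q/(1+q+y))) * mid_slope y) (at y)"
proof -
  define p where "p = 1 + q"
  define R where "R = (\<lambda>y. sqrt (q*y/(p+y)))"
  have p: "0 < p" using q by (simp add: p_def)
  have R: "0 < R y" "(R y)^2 = q*y/(p+y)" using q y p by (auto simp: R_def)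
  have dR: "(R has_real_derivative R y * p/(2*y*(p+y))) (at y)"
  proof -
    have "((\<lambda>y. q*y/(p+y)) has_real_derivative (q*(p+y) - q*y*1)/((p+y)*(p+y))) (at y)"
      using p y by (intro DERIV_divide) (auto intro!: derivative_eq_intros)
    from DERIV_chain2[OF DERIV_real_sqrt this]
    have "(R has_real_derivative inverse (R y)/2 * ((q*(p+y) - q*y*1)/((p+y)*(p+y)))) (at y)"
      unfolding R_def using p y q by simp
    moreover have "inverse r/2 * ((q*l - q*y*1)/(l*l)) = r * (l-y)/(2*y*l)" if "0 < r" "r^2 = q*y/l" "0 < l" for r l
    proof -
      have "q = r^2*l/y" using that y by simp
      then show ?thesis using that(1,3) y by (simp add: field_simps power2_eq_square)
    qed
    from this[OF R] have "inverse (R y)/2 * ((q*(p+y) - q*y*1)/((p+y)*(p+y))) = R y * p/(2*y*(p+y))" using p y by simp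
    ultimately show ?thesis by simp
  qed
  have T: "tri_area q y 1 = R y * (p+y)" if "0 < y" for y
  proof -
    have "tri_area q y 1 = sqrt (q*y/(p+y) * (p+y)^2)"
      unfolding tri_area_def using p that by (simp add: p_def power2_eq_square add_ac)
    then show ?thesis unfolding R_def real_sqrt_mult[of "q*y/(p+y)"] using p that by simp
  qed
  have dT: "((\<lambda>y. R y * (p+y)) has_real_derivative R y * (p+2*y)/(2*y)) (at y)"
  proof -
    have "((\<lambda>y. R y * (p+y)) has_real_derivative R y * p/(2*y*(p+y)) * (p+y) + 1 * R y) (at y)"
      by (intro DERIV_mult dR) (auto intro!: derivative_eq_intros)
    moreover have "R y * p/(2*y*(p+y)) * (p+y) + 1 * R y = R y * (p+2*y)/(2*y)"
    proof -
      have "r * p/(2*y*l) * l + 1 * r = r * (p+2*y)/(2*y)" if "l \<noteq> 0" for r l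
        using that y by (simp add: field_simps)
      then show ?thesis using p y by (metis add_pos_pos less_irrefl)
    qed
    ultimately show ?thesis by simp
  qed
  have N: "sector_sum q y 1 = q^2 * arctan (R y / q) + y^2 * arctan (R y / y) + arctan (R y)" for y
    unfolding sector_sum_def Let_def R_def p_def by (simp add: add_ac)
  define B where "B = arctan (R y / y)"
  have dN: "((\<lambda>y. q^2 * arctan (R y / q) + y^2 * arctan (R y / y) + arctan (R y)) has_real_derivative
      2*y*B + R y * (p-2*y)/(2*y)) (at y)"
  proof -
    define r where "r = R y"
    define r' where "r' = r * p/(2*y*(p+y))"
    have dr: "(R has_real_derivative r') (at y)" using dR by (simp add: r_def r'_def)
    have a1: "((\<lambda>y. arctan (R y)) has_real_derivative inverse (1 + r^2) * r') (at y)"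
      unfolding r_def by (rule DERIV_chain2[OF DERIV_arctan dr])
    have a2: "((\<lambda>y. q^2 * arctan (R y/q)) has_real_derivative q^2 * (inverse (1 + (r/q)^2) * (r'/q))) (at y)"
      unfolding r_def by (intro DERIV_cmult DERIV_chain2[OF DERIV_arctan] DERIV_cdivide dr)
    have "((\<lambda>y. R y / y) has_real_derivative (r' * y - r * 1)/(y*y)) (at y)"
      unfolding r_def using y by (intro DERIV_divide dr DERIV_ident) auto
    then have "((\<lambda>y. arctan (R y / y)) has_real_derivative inverse (1 + (r/y)^2) * ((r' * y - r * 1)/(y*y))) (at y)"
      unfolding r_def by (rule DERIV_chain2[OF DERIV_arctan])
    moreover have "((\<lambda>y. y^2) has_real_derivative 2*y) (at y)" by (auto intro!: derivative_eq_intros)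
    ultimately have a3: "((\<lambda>y. y^2 * arctan (R y / y)) has_real_derivative
        2*y*B + inverse (1 + (r/y)^2) * ((r' * y - r * 1)/(y*y)) * y^2) (at y)"
      using DERIV_mult unfolding B_def by fast
    have "((\<lambda>y. q^2 * arctan (R y / q) + y^2 * arctan (R y / y) + arctan (R y)) has_real_derivative
      q^2 * (inverse (1 + (r/q)^2) * (r'/q)) + (2*y*B + inverse (1 + (r/y)^2) * ((r' * y - r * 1)/(y*y)) * y^2) + inverse (1 + r^2) * r') (at y)"
      by (intro DERIV_add a1 a2 a3)
    moreover have "q^2 * (inverse (1 + (r/q)^2) * (r'/q)) + (2*y*B + inverse (1 + (r/y)^2) * ((r' * y - r * 1)/(y*y)) * y^2) + inverse (1 + r^2) * r'
       = 2*y*B + r * (p-2*y)/(2*y)"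
    proof -
      have r2: "r^2 = q*y/(p+y)" using R by (simp add: r_def)
      have pos: "0 < p + y" "0 < 1+y" "0 < q+y" using p y q by auto
      have i1: "inverse (1 + r^2) = (p+y)/(p*(1+y))"
      proof -
        have "1 + r^2 = p*(1+y)/(p+y)" unfolding r2 using pos by (simp add: field_simps p_def)
        then show ?thesis by simp
      qed
      have i2: "inverse (1 + (r/q)^2) = q*(p+y)/(p*(q+y))"
      proof -
        have "1 + (r/q)^2 = p*(q+y)/(q*(p+y))" 
        proof -
          have "1 + q*y/l/q^2 = (q*l + y)/(q*l)" if "0 < l" for l
            using that q by (simp add: field_simps power2_eq_square)
          moreover have "q*(p+y) + y = p*(q+y)" unfolding p_def by algebra
          ultimately show ?thesis unfolding power_divide r2 using pos by metis
        qed
        then show ?thesis by simp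
      qed
      have i3: "inverse (1 + (r/y)^2) = y*(p+y)/((1+y)*(q+y))"
      proof -
        have "1 + (r/y)^2 = (1+y)*(q+y)/(y*(p+y))" 
        proof -
          have "1 + q*y/l/y^2 = (y*l + q)/(y*l)" if "0 < l" for l
            using that y by (simp add: field_simps power2_eq_square)
          moreover have "y*(p+y) + q = (1+y)*(q+y)" unfolding p_def by algebra
          ultimately show ?thesis unfolding power_divide r2 using pos by metis
        qed
        then show ?thesis by simp
      qed
      have e: "q^2 * (q*l/(p*b) * (r*p/(2*y*l)/q)) + (y*l/(a*b) * ((r*p/(2*y*l) * y - r*1)/(y*y)) * y^2) + l/(p*a) * (r*p/(2*y*l))
         = r*(q^2*a + (p*y^2 - 2*y^2*l) + b)/(2*y*a*b)"
        if "0 < l" "0 < a" "0 < b" for l a b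
        using that p q y by (simp add: field_simps power2_eq_square)
      have "q^2*(1+y) + (p*y^2 - 2*y^2*(p+y)) + (q+y) = (p-2*y)*(1+y)*(q+y)" unfolding p_def by algebra
      then have "q^2 * (q*(p+y)/(p*(q+y)) * (r'/q)) + (y*(p+y)/((1+y)*(q+y)) * ((r' * y - r*1)/(y*y)) * y^2) + (p+y)/(p*(1+y)) * r'
         = r*((p-2*y)*(1+y)*(q+y))/(2*y*(1+y)*(q+y))"
        using e[OF pos] unfolding r'_def by simp
      also have "\<dots> = r*(p-2*y)/(2*y)" using pos by simp
      finally show ?thesis unfolding i1 i2 i3 by linarith
    qed
    ultimately show ?thesis unfolding r_def by (simp only:)
  qed
  have ms: "mid_slope y = (1 - s q) * ((p+y)*(p+2*y)) / (4*q) - (R y/y - B)/(R y/y)^3"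
  proof -
    have "sqrt (q/(y*(p+y))) = R y / y"
    proof -
      have "q/(y*(p+y)) = (q*y/(p+y))/y^2" using y by (simp add: power2_eq_square)
      then have "sqrt (q/(y*(p+y))) = sqrt (q*y/(p+y)) / sqrt (y^2)" by (simp only: real_sqrt_divide)
      then show ?thesis using y by (simp add: R_def)
    qed
    then show ?thesis unfolding mid_slope_def arctan_defect_def B_def p_def by simp
  qed
  have dd: "((\<lambda>y. s q * (R y * (p+y)) - (q^2 * arctan (R y / q) + y^2 * arctan (R y / y) + arctan (R y))) has_real_derivative
     s q * (R y * (p+2*y)/(2*y)) - (2*y*B + R y * (p-2*y)/(2*y))) (at y)"
    by (intro DERIV_diff DERIV_cmult dT dN)
  have gen: "s q * (r * (p+2*y)/(2*y)) - (2*y*B + r * (p-2*y)/(2*y))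
     = - (r / (2*y) * (4*q/l)) * ((1 - s q) * (l*(p+2*y)) / (4*q) - (r/y - B)/(r/y)^3)" if "0 < r" "r^2 = q*y/l" "0 < l" for r l
  proof -
    have qe: "q = r^2*l/y" using that y by simp
    have "r/(2*y)*(4*q/l)*((r/y - B)/(r/y)^3) = 2*(r - B*y)"
      unfolding qe using that(1,3) y by (simp add: field_simps power2_eq_square power3_eq_cube)
    moreover have "r/(2*y)*(4*q/l)*((1 - s q) * (l*(p+2*y)) / (4*q)) = r/(2*y)*((1 - s q)*(p+2*y))"
      using that(3) q by simp
    moreover have "s q * (r * (p+2*y)/(2*y)) - (2*y*B + r * (p-2*y)/(2*y)) = 2*(r - B*y) - r/(2*y)*((1 - s q)*(p+2*y))"
      using y by (simp add: field_simps)
    ultimately show ?thesis by (simp only: right_diff_distrib minus_mult_left[symmetric])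
  qed
  have eq: "s q * (R y * (p+2*y)/(2*y)) - (2*y*B + R y * (p-2*y)/(2*y))
     = - (R y / (2*y) * (4*q/(p+y))) * mid_slope y" unfolding ms by (rule gen[OF R]) (use p y in simp)
  have "((\<lambda>y. s q * (R y * (p+y)) - sector_sum q y 1) has_real_derivative
      - (R y / (2*y) * (4*q/(p+y))) * mid_slope y) (at y)" using dd unfolding eq N[symmetric] .
  \<comment> \<open>\<open>T\<close> is available for positive arguments only; the ball of radius
    \<open>y\<close> about \<open>y\<close> consists of such.\<close>
  then have "((\<lambda>y. s q * tri_area q y 1 - sector_sum q y 1) has_real_derivative
      - (R y / (2*y) * (4*q/(p+y))) * mid_slope y) (at y)"
    by (rule has_field_derivative_transform_within[where d=y]) (use y T in \<open>auto simp: dist_real_def\<close>)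
  then show ?thesis by (simp add: R_def p_def)
qed

end

section \<open>The bound of Florian for a single triangle\<close>


lemma sector_sum_perm:
  "sector_sum x y z = sector_sum y x z" "sector_sum x y z = sector_sum x z y"
  unfolding sector_sum_def Let_def by (simp_all add: mult_ac add_ac)

lemma tri_area_perm:
  "tri_area x y z = tri_area y x z" "tri_area x y z = tri_area x z y"
  unfolding tri_area_def by (simp_all add: mult_ac add_ac)

lemma sector_sum_scale:
  assumes "0 < c"
  shows "sector_sum (c*x) (c*y) (c*z) = c^2 * sector_sum x y z"
proof -
  have "(c*x)*(c*y)*(c*z)/(c*x+c*y+c*z) = c^2 * (x*y*z/(x+y+z))"
  proof -
    have "(c*x)*(c*y)*(c*z)/(c*x+c*y+c*z) = (c*(c^2*(x*y*z)))/(c*(x+y+z))"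
      by (simp add: power2_eq_square algebra_simps)
    then show ?thesis using assms by simp
  qed
  moreover have "sqrt (c^2 * t) = c * sqrt t" for t using assms by (simp add: real_sqrt_mult)
  ultimately have "sqrt ((c*x)*(c*y)*(c*z)/(c*x+c*y+c*z)) = c * sqrt (x*y*z/(x+y+z))" by metis
  then show ?thesis unfolding sector_sum_def Let_def
    using assms by (simp add: power_mult_distrib distrib_left mult.assoc)
qed

lemma tri_area_scale:
  assumes "0 < c"
  shows "tri_area (c*x) (c*y) (c*z) = c^2 * tri_area x y z"
proof -
  have "(c*x)*(c*y)*(c*z)*(c*x+c*y+c*z) = (c^2)^2 * (x*y*z*(x+y+z))" by algebra
  moreover have "sqrt ((c^2)^2 * t) = c^2 * sqrt t" for t
    by (simp only: real_sqrt_mult real_sqrt_abs abs_power2)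
  ultimately show ?thesis unfolding tri_area_def by metis
qed

text \<open>The difference is 0 at \<open>y = q\<close> and nonnegative at \<open>y = 1\<close>, and
  \<open>mid_slope_sign\<close> excludes a second change of monotonicity.\<close>

lemma sector_sum_mid:
  assumes q: "0 < q" "q < 1" and y: "q < y" "y < 1"
  shows "sector_sum q y 1 < s q * tri_area q y 1"
proof -
  let ?f = "\<lambda>y. s q * tri_area q y 1 - sector_sum q y 1"
  let ?c = "\<lambda>y. sqrt (q*y/(1+q+y)) / (2*y) * (4*q/(1+q+y))"
  have c: "0 < ?c y" if "q < y" for y using that q by simp
  have "0 < ?f y"
  proof (rule positive_between[of q 1 ?f "\<lambda>y. - ?c y * mid_slope q y"])
    show "continuous_on {q..1} ?f"
      using q by (intro continuous_at_imp_continuous_on ballI DERIV_isCont[OF sector_sum_mid_deriv]) auto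
    show "(?f has_real_derivative - ?c y * mid_slope q y) (at y)" if "q < y" for y
      using sector_sum_mid_deriv[of q y] that q by simp
    show "0 \<le> ?f q" using sector_sum_two_small[of q] q by simp
    show "0 \<le> ?f 1" using sector_sum_two_large[of q] q by simp
    show "- ?c y * mid_slope q y < 0" if xy: "q < x" "x < y" "y < 1" "- ?c x * mid_slope q x \<le> 0" for x y
    proof -
      have "0 \<le> ?c x * mid_slope q x" using xy(4) by simp
      then have "0 \<le> mid_slope q x" using c[OF xy(1)] by (metis mult_pos_neg not_le)
      then have "0 < mid_slope q y" using mid_slope_sign[OF q xy(1,2)] by simp
      then have "0 < ?c y * mid_slope q y" using c[of y] xy by (intro mult_pos_pos[of "?c y"]) auto
      then show ?thesis by simp
    qed
  qed (use y in auto)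
  then show ?thesis by simp
qed

text \<open>Scaling by \<open>1/z\<close> gives radii \<open>a, b, 1\<close> with
  \<open>q \<le> a\<close>, for which the bound is \<open>s a\<close>, and
  \<open>s a \<le> s q\<close>. Equality requires \<open>b = a\<close> and \<open>a = q\<close>; as
  \<open>x = z*q\<close> is at least \<open>q\<close>, then \<open>z = 1\<close>.\<close>

lemma sector_sum_sorted:
  assumes q: "0 < q" "q < 1" and xyz: "q \<le> x" "x \<le> y" "y \<le> z" "z \<le> 1"
  shows "sector_sum x y z < s q * tri_area x y z \<or> (x = q \<and> y = q \<and> z = 1 \<and> sector_sum x y z = s q * tri_area x y z)"
proof -
  define a b where "a = x/z" and "b = y/z"
  have pos: "0 < x" "0 < y" "0 < z" using q xyz by auto
  have ab: "0 < a" "a \<le> b" "b \<le> 1" using pos xyz by (auto simp: a_def b_def divide_right_mono)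
  have "q * z \<le> x" using xyz q pos mult_left_le[of z q] by linarith
  then have "q \<le> a" using pos by (simp add: a_def field_simps)
  have xs: "x = z*a" "y = z*b" using pos by (auto simp: a_def b_def)
  have N: "sector_sum x y z = z^2 * sector_sum a b 1" "tri_area x y z = z^2 * tri_area a b 1"
    using sector_sum_scale[OF pos(3), of a b 1] tri_area_scale[OF pos(3), of a b 1] xs by auto
  have T: "0 < tri_area a b 1" using ab by (simp add: tri_area_def)
  have sa: "s a \<le> s q" "a \<noteq> q \<Longrightarrow> s a < s q"
    using s_antimono[of q a] q \<open>q \<le> a\<close> ab by (auto simp: less_le)
  have sT: "s a * tri_area a b 1 \<le> s q * tri_area a b 1" using sa T by simp
  consider "b = a" "a = q" | "b = a" "a \<noteq> q" | "a < b" "b < 1" | "a < b" "b = 1" using ab by linarith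
  then show ?thesis
  proof cases
    case 1
    have "z = 1"
    proof (rule ccontr)
      assume "z \<noteq> 1"
      then have "q * z < q" using xyz q by simp
      then show False using xs 1 xyz by (simp add: mult.commute)
    qed
    then show ?thesis using 1 xs sector_sum_two_small[of q] q by simp
  next
    case 2
    have "sector_sum a b 1 = s a * tri_area a b 1" using 2 sector_sum_two_small[of a] ab by simp
    also have "\<dots> < s q * tri_area a b 1" using sa(2)[OF 2(2)] T by simp
    finally show ?thesis unfolding N using pos by (simp add: mult.left_commute)
  next
    case 3
    then have "sector_sum a b 1 < s a * tri_area a b 1" using sector_sum_mid[of a b] ab by simp
    then have "sector_sum a b 1 < s q * tri_area a b 1" using sT by simp
    then show ?thesis unfolding N using pos by (simp add: mult.left_commute)
  next
    case 4
    then have "sector_sum a b 1 < s a * tri_area a b 1" using sector_sum_two_large[of a] ab by simp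
    then have "sector_sum a b 1 < s q * tri_area a b 1" using sT by simp
    then show ?thesis unfolding N using pos by (simp add: mult.left_commute)
  qed
qed

text \<open>The vertices of a face come in no particular order, so the equality case is recorded as
  a multiset of radii.\<close>

theorem florian_bound:
  assumes q: "0 < q" "q < 1" and "x \<in> {q..1}" "y \<in> {q..1}" "z \<in> {q..1}"
  shows "sector_sum x y z < s q * tri_area x y z \<or>
    ({#x, y, z#} = {#q, q, 1#} \<and> sector_sum x y z = s q * tri_area x y z)"
proof -
  let ?P = "\<lambda>x y z. sector_sum x y z < s q * tri_area x y z \<or>
    ({#x, y, z#} = {#q, q, 1#} \<and> sector_sum x y z = s q * tri_area x y z)"
  have p1: "?P x y z = ?P y x z" for x y z
    using sector_sum_perm(1)[of x y z] tri_area_perm(1)[of x y z] by (simp add: add_mset_commute)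
  have p2: "?P x y z = ?P x z y" for x y z
    using sector_sum_perm(2)[of x y z] tri_area_perm(2)[of x y z] by (simp add: add_mset_commute)
  have srt: "?P x y z" if "q \<le> x" "x \<le> y" "y \<le> z" "z \<le> 1" for x y z
    using sector_sum_sorted[OF q that] by auto
  consider "x \<le> y" "y \<le> z" | "x \<le> z" "z \<le> y" | "y \<le> x" "x \<le> z" | "y \<le> z" "z \<le> x" | "z \<le> x" "x \<le> y" | "z \<le> y" "y \<le> x"
    by linarith
  then show ?thesis
  proof cases
    case 1 then show ?thesis using srt[of x y z] assms by simp
  next
    case 2 then show ?thesis using srt[of x z y] assms p2[of x y z] by simp
  next
    case 3 then show ?thesis using srt[of y x z] assms p1[of x y z] by simp
  next
    case 4 then show ?thesis using srt[of y z x] assms p1[of x y z] p2[of y x z] by simp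
  next
    case 5 then show ?thesis using srt[of z x y] assms p2[of x y z] p1[of x z y] by simp
  next
    case 6 then show ?thesis using srt[of z y x] assms p1[of x y z] p2[of y x z] p1[of y z x] by simp
  qed
qed

section \<open>Circular sectors in the plane\<close>


definition circ :: "real \<Rightarrow> plane" where
  "circ a = vector [cos a, sin a]"

lemma circ_nth [simp]: "circ a $ 1 = cos a" "circ a $ 2 = sin a"
  by (simp_all add: circ_def)

lemma plane_eq_iff: "(x::plane) = y \<longleftrightarrow> x$1 = y$1 \<and> x$2 = y$2"
  by (simp add: vec_eq_iff forall_2)

lemma inner_plane: "(x::plane) \<bullet> y = x$1 * y$1 + x$2 * y$2"
  by (simp add: inner_vec_def sum_2)

lemma norm_circ [simp]: "norm (circ a) = 1"
  by (simp add: norm_eq_sqrt_inner inner_plane)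

lemma inner_circ: "circ a \<bullet> circ b = cos (a - b)"
  by (simp add: inner_plane cos_diff)

lemma circ_add_2pi: "circ (a + 2 * pi * of_int n) = circ a"
  using sin_cos_eq_iff by (auto simp: plane_eq_iff)

lemma circ_eq_iff: "circ a = circ b \<longleftrightarrow> (\<exists>n::int. a = b + 2 * pi * n)"
  unfolding plane_eq_iff circ_nth using sin_cos_eq_iff[of a b] by blast

text \<open>The free start \<open>b\<close> of the angular window allows an angle to be normalized
  relative to another direction.\<close>

lemma polar_from:
  obtains r a where "0 \<le> r" "b \<le> a" "a < b + 2*pi" "(x::plane) = r *\<^sub>R circ a"
proof -
  define c d where "c = x \<bullet> circ b" and "d = x \<bullet> circ (b + pi/2)"
  have x: "x = c *\<^sub>R circ b + d *\<^sub>R circ (b + pi/2)"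
  proof -
    have s: "sin b * sin b + cos b * cos b = 1" using sin_cos_squared_add3[of b] by linarith
    have q: "cos (b + pi/2) = - sin b" "sin (b + pi/2) = cos b" by (simp_all add: cos_add sin_add)
    have "c * cos b - d * sin b = x$1" "c * sin b + d * cos b = x$2"
      unfolding c_def d_def inner_plane circ_nth q using s by algebra+
    then show ?thesis by (simp add: plane_eq_iff q)
  qed
  define r where "r = sqrt (c^2 + d^2)"
  have "\<exists>t. 0 \<le> t \<and> t < 2*pi \<and> c = r * cos t \<and> d = r * sin t"
  proof (cases "r = 0")
    case True
    then have "c = 0" "d = 0" by (auto simp: r_def sum_power2_eq_zero_iff)
    with True show ?thesis by (intro exI[of _ 0]) auto
  next
    case False
    have "r^2 = c^2 + d^2" by (simp add: r_def)
    moreover have "(c/r)^2 + (d/r)^2 = (c^2 + d^2)/r^2" by (simp add: power_divide add_divide_distrib)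
    ultimately have "(c/r)^2 + (d/r)^2 = 1" using False by (metis divide_self power_not_zero)
    from sincos_total_2pi[OF this] obtain t where "0 \<le> t" "t < 2*pi" "c/r = cos t" "d/r = sin t" .
    then show ?thesis using False by (intro exI[of _ t]) (auto simp: field_simps)
  qed
  then obtain t where t: "0 \<le> t" "t < 2*pi" "c = r * cos t" "d = r * sin t" by blast
  have "x = r *\<^sub>R circ (b + t)" unfolding x t
    by (simp add: plane_eq_iff cos_add sin_add algebra_simps)
  moreover have "0 \<le> r" by (simp add: r_def)
  ultimately show ?thesis using that[of r "b + t"] t by auto
qed

text \<open>Leaving out the apex and one bounding ray makes adjacent sectors disjoint, so that areas
  add without boundary terms.\<close>

definition half_open_sector :: "real \<Rightarrow> real \<Rightarrow> plane set" where
  "half_open_sector a b = {r *\<^sub>R circ t | r t. 0 < r \<and> r \<le> 1 \<and> a \<le> t \<and> t < b}"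

lemma continuous_on_circ [continuous_intros]:
  fixes f :: "'a::t2_space \<Rightarrow> real"
  assumes "continuous_on A f"
  shows "continuous_on A (\<lambda>x. circ (f x))"
proof -
  have "circ t = cos t *\<^sub>R axis 1 1 + sin t *\<^sub>R axis 2 1" for t
    by (simp add: plane_eq_iff axis_def)
  then show ?thesis using assms
    by (simp only:) (intro continuous_on_add continuous_on_scaleR continuous_on_cos continuous_on_sin continuous_on_const)
qed

lemma half_open_sectorI:
  "0 < r \<Longrightarrow> r \<le> 1 \<Longrightarrow> a \<le> t \<Longrightarrow> t < b \<Longrightarrow> r *\<^sub>R circ t \<in> half_open_sector a b"
  unfolding half_open_sector_def by blast

lemma half_open_sectorE:
  assumes "x \<in> half_open_sector a b"
  obtains r t where "x = r *\<^sub>R circ t" "0 < r" "r \<le> 1" "a \<le> t" "t < b"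
  using assms unfolding half_open_sector_def by blast

lemma half_open_sector_lmeasurable: "half_open_sector a b \<in> lmeasurable"
proof -
  \<comment> \<open>Staying away from the apex and from the open ray by \<open>1/(n+1)\<close> gives
    compact images whose union is the sector.\<close>
  define C where "C n = (\<lambda>(r,t). r *\<^sub>R circ t) ` ({inverse (real (Suc n))..1} \<times> {a..b - inverse (real (Suc n))})" for n
  have "compact (C n)" for n unfolding C_def
    by (intro compact_continuous_image compact_Times compact_Icc)
       (auto simp: case_prod_unfold intro!: continuous_intros)
  moreover have "half_open_sector a b = (\<Union>n. C n)"
  proof
    show "(\<Union>n. C n) \<subseteq> half_open_sector a b"
    proof
      fix x assume "x \<in> (\<Union>n. C n)"
      then obtain n r t where "x = r *\<^sub>R circ t" "inverse (real (Suc n)) \<le> r" "r \<le> 1" "a \<le> t" "t \<le> b - inverse (real (Suc n))"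
        by (auto simp: C_def)
      moreover have "0 < inverse (real (Suc n))" by simp
      ultimately show "x \<in> half_open_sector a b" unfolding half_open_sector_def
        by (intro CollectI exI[of _ r] exI[of _ t]) linarith
    qed
    show "half_open_sector a b \<subseteq> (\<Union>n. C n)"
    proof
      fix x assume "x \<in> half_open_sector a b"
      then obtain r t where x: "x = r *\<^sub>R circ t" "0 < r" "r \<le> 1" "a \<le> t" "t < b"
        by (auto simp: half_open_sector_def)
      obtain n where "inverse (real (Suc n)) < min r (b - t)"
        using reals_Archimedean[of "min r (b - t)"] x by auto
      then have "x \<in> C n" unfolding C_def x(1) using x by (intro image_eqI[of _ _ "(r,t)"]) auto
      then show "x \<in> (\<Union>n. C n)" by blast
    qed
  qed
  ultimately have "half_open_sector a b \<in> sets lebesgue"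
    
    using sets.countable_UN[of C UNIV lebesgue] by (simp add: image_subset_iff borel_compact)
  moreover have "bounded (half_open_sector a b)"
    by (rule bounded_subset[of "cball 0 1"]) (auto simp: half_open_sector_def)
  ultimately show ?thesis using bounded_set_imp_lmeasurable by blast
qed

section \<open>Rotation invariance and the area of a sector\<close>

definition rot :: "real \<Rightarrow> plane \<Rightarrow> plane" where
  "rot c x = vector [cos c * x$1 - sin c * x$2, sin c * x$1 + cos c * x$2]"

lemma rot_nth: "rot c x $ 1 = cos c * x$1 - sin c * x$2" "rot c x $ 2 = sin c * x$1 + cos c * x$2"
  by (simp_all add: rot_def)

lemma orthogonal_transformation_rot: "orthogonal_transformation (rot c)"
proof -
  have s: "cos c * cos c = 1 - sin c * sin c" using sin_cos_squared_add3[of c] by linarith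
  have s': "cos c * (cos c * z) = (1 - sin c * sin c) * z" for z by (simp only: mult.assoc[symmetric] s)
  have "linear (rot c)"
    by (rule linearI) (simp_all add: plane_eq_iff rot_nth algebra_simps)
  moreover have "rot c v \<bullet> rot c w = v \<bullet> w" for v w
    by (simp add: inner_plane rot_nth algebra_simps s s')
  ultimately show ?thesis unfolding orthogonal_transformation_def by blast
qed

lemma rot_half_open_sector: "rot c ` half_open_sector a b = half_open_sector (a + c) (b + c)"
proof -
  have rc: "rot c (r *\<^sub>R circ t) = r *\<^sub>R circ (t + c)" for r t
    by (simp add: plane_eq_iff rot_nth cos_add sin_add algebra_simps)
  show ?thesis
  proof
    show "rot c ` half_open_sector a b \<subseteq> half_open_sector (a + c) (b + c)"
      by (auto elim!: half_open_sectorE simp: rc intro!: half_open_sectorI)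
    show "half_open_sector (a + c) (b + c) \<subseteq> rot c ` half_open_sector a b"
    proof
      fix x assume "x \<in> half_open_sector (a + c) (b + c)"
      then obtain r t where "x = r *\<^sub>R circ t" "0 < r" "r \<le> 1" "a + c \<le> t" "t < b + c"
        by (auto simp: half_open_sector_def)
      then show "x \<in> rot c ` half_open_sector a b"
        by (intro image_eqI[of _ _ "r *\<^sub>R circ (t - c)"] half_open_sectorI) (auto simp: rc)
    qed
  qed
qed

lemma measure_half_open_sector_shift:
  "measure lebesgue (half_open_sector (a + c) (b + c)) = measure lebesgue (half_open_sector a b)"
  using measure_orthogonal_image[OF orthogonal_transformation_rot half_open_sector_lmeasurable, of c a b]
  unfolding rot_half_open_sector .

lemma measure_half_open_sector_add:
  assumes "a \<le> b" "b \<le> c" "c \<le> a + 2*pi"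
  shows "measure lebesgue (half_open_sector a c) = measure lebesgue (half_open_sector a b) + measure lebesgue (half_open_sector b c)"
proof -
  have "half_open_sector a c = half_open_sector a b \<union> half_open_sector b c"
  proof
    show "half_open_sector a c \<subseteq> half_open_sector a b \<union> half_open_sector b c"
      by (force elim!: half_open_sectorE intro: half_open_sectorI)
    show "half_open_sector a b \<union> half_open_sector b c \<subseteq> half_open_sector a c"
      using assms by (force elim!: half_open_sectorE intro!: half_open_sectorI)
  qed
  moreover have "half_open_sector a b \<inter> half_open_sector b c = {}"
  proof (rule ccontr)
    assume "\<not> ?thesis"
    then obtain r t r' t' where rt: "r *\<^sub>R circ t = r' *\<^sub>R circ t'" "0 < r" "0 < r'" "a \<le> t" "t < b" "b \<le> t'" "t' < c"
      unfolding half_open_sector_def by auto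
    have "norm (r *\<^sub>R circ t) = norm (r' *\<^sub>R circ t')" using rt(1) by (rule arg_cong)
    then have "r = r'" using rt(2,3) by simp
    then have "circ t' = circ t" using rt by simp
    then obtain n :: int where n: "t' = t + 2*pi*n" unfolding circ_eq_iff by blast
    then have "0 < 2*pi*n" "2*pi*n < 2*pi*1" using rt assms by linarith+
    then have "0 < n" "real_of_int n < 1" by (simp_all add: zero_less_mult_iff)
    then show False by linarith
  qed
  ultimately show ?thesis
    using measure_Un2[OF half_open_sector_lmeasurable half_open_sector_lmeasurable, of a b b c]
    by (simp add: Diff_triv Int_commute)
qed

lemma half_open_sector_full: "half_open_sector 0 (2*pi) = cball 0 1 - {0}"
proof
  show "half_open_sector 0 (2*pi) \<subseteq> cball 0 1 - {0}"
  proof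
    fix x assume "x \<in> half_open_sector 0 (2*pi)"
    then obtain r t where "x = r *\<^sub>R circ t" "0 < r" "r \<le> 1" by (auto simp: half_open_sector_def)
    moreover have "circ t \<noteq> 0" by (metis norm_circ norm_zero zero_neq_one)
    ultimately show "x \<in> cball 0 1 - {0}" by auto
  qed
  show "cball 0 1 - {0} \<subseteq> half_open_sector 0 (2*pi)"
  proof
    fix x :: plane assume x: "x \<in> cball 0 1 - {0}"
    obtain r t where rt: "0 \<le> r" "0 \<le> t" "t < 0 + 2*pi" "x = r *\<^sub>R circ t" by (rule polar_from)
    then show "x \<in> half_open_sector 0 (2*pi)" using x
      unfolding half_open_sector_def by (intro CollectI exI[of _ r] exI[of _ t]) auto
  qed
qed

lemma measure_half_open_sector_full: "measure lebesgue (half_open_sector 0 (2*pi)) = pi"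
proof -
  have "measure lebesgue (cball (0::plane) 1 - {0}) = measure lebesgue (cball (0::plane) 1) - measure lebesgue {0::plane}"
    by (intro measurable_measure_Diff) auto
  also have "\<dots> = pi" using content_cball[of 1 "0::plane"] by (simp add: unit_ball_vol_2)
  finally show ?thesis unfolding half_open_sector_full .
qed

lemma measure_half_open_sector_multiple:
  assumes "0 \<le> x" "real k * x \<le> 2*pi"
  shows "measure lebesgue (half_open_sector 0 (real k * x)) = real k * measure lebesgue (half_open_sector 0 x)"
  using assms(2)
proof (induction k)
  case 0 
  have "half_open_sector 0 0 = {}" by (auto simp: half_open_sector_def)
  then show ?case by simp
next
  case (Suc k)
  have le: "real k * x \<le> real (Suc k) * x" using assms(1) by (simp add: mult_right_mono)
  have "measure lebesgue (half_open_sector 0 (real (Suc k) * x)) = measure lebesgue (half_open_sector 0 (real k * x)) +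
     measure lebesgue (half_open_sector (0 + real k * x) (x + real k * x))"
    using measure_half_open_sector_add[of 0 "real k * x" "real (Suc k) * x"] Suc.prems le assms(1)
    by (simp add: algebra_simps)
  also have "\<dots> = real k * measure lebesgue (half_open_sector 0 x) + measure lebesgue (half_open_sector 0 x)"
    unfolding measure_half_open_sector_shift using Suc le by simp
  finally show ?case by (simp add: algebra_simps)
qed

text \<open>The disk is the union of \<open>n\<close> congruent sectors of area \<open>pi/n\<close>.
  The given sector is covered by \<open>k + 1\<close> of them, and the surplus tends to 0 as
  \<open>n\<close> grows.\<close>

lemma measure_half_open_sector_le:
  assumes "0 \<le> x" "x < 2*pi"
  shows "measure lebesgue (half_open_sector 0 x) \<le> x/2"
proof (rule field_le_epsilon)
  fix e :: real assume e: "0 < e"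
  \<comment> \<open>The first summand ensures that \<open>k + 1 \<le> n\<close>, so the covering
    sectors do not wrap around; the second bounds the area of the one surplus sector by
    \<open>e\<close>.\<close>
  obtain n :: nat where n: "2*pi/(2*pi - x) + pi/e < real n" using reals_Archimedean2 by blast
  have "0 < 2*pi/(2*pi - x)" "0 < pi/e" using assms e by auto
  then have n1: "2*pi/(2*pi - x) < real n" "pi/e < real n" and n0: "0 < real n" using n by linarith+
  define k where "k = nat \<lfloor>x * real n/(2*pi)\<rfloor>"
  have k: "real k \<le> x * real n/(2*pi)" "x * real n/(2*pi) < real k + 1"
    unfolding k_def using assms by (simp_all add: of_nat_nat)
  have "x * n/(2*pi) + 1 \<le> real n"
    using n1(1) assms by (simp add: field_simps)
  then have kn: "real (Suc k) \<le> real n" using k by simp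
  let ?w = "2*pi/real n"
  have unit: "measure lebesgue (half_open_sector 0 ?w) = pi/real n"
    using measure_half_open_sector_multiple[of ?w n] n0 measure_half_open_sector_full by (simp add: field_simps)
  have xk: "x \<le> real (Suc k) * ?w" using k(2) n0 by (simp add: field_simps)
  have k2: "real (Suc k) * ?w \<le> 2*pi" 
    using mult_right_mono[OF kn, of ?w] n0 by simp
  have "measure lebesgue (half_open_sector 0 x) \<le> measure lebesgue (half_open_sector 0 (real (Suc k) * ?w))"
    by (intro measure_mono_fmeasurable fmeasurableD half_open_sector_lmeasurable)
       (use xk in \<open>auto simp: half_open_sector_def intro: order_less_le_trans\<close>)
  also have "\<dots> = real (Suc k) * (pi/real n)"
    using measure_half_open_sector_multiple[of ?w "Suc k"] k2 n0 unit by simp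
  also have "\<dots> = real k * (pi/real n) + pi/real n" by (simp add: distrib_right add_divide_distrib)
  also have "real k * (pi/real n) \<le> (x * real n/(2*pi)) * (pi/real n)" using k(1) n0 by (intro mult_right_mono) auto
  also have "\<dots> = x/2" using n0 by simp
  also have "pi/real n \<le> e" using n1(2) e n0 by (simp add: field_simps)
  finally show "measure lebesgue (half_open_sector 0 x) \<le> x/2 + e" by simp
qed

text \<open>With \<open>h = b - a\<close>, the components of \<open>x\<close> give
  \<open>r * sin h = t * sin \<alpha>\<close> and
  \<open>r * sin (\<alpha> - h) = k * sin \<alpha>\<close>. Both are nonnegative, which confines
  \<open>h\<close> to the interval from 0 to \<open>\<alpha>\<close>.\<close>

lemma polar_angle_between:
  fixes x :: plane
  assumes al: "0 < \<alpha>" "\<alpha> < pi" and x: "x = k *\<^sub>R circ a + t *\<^sub>R circ (a + \<alpha>)" and st: "0 \<le> k" "0 \<le> t"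
  obtains r b where "0 \<le> r" "x = r *\<^sub>R circ b" "a \<le> b" "b \<le> a + \<alpha>"
proof -
  obtain r b where rb: "0 \<le> r" "a \<le> b" "b < a + 2*pi" "x = r *\<^sub>R circ b" by (rule polar_from)
  show ?thesis
  proof (cases "r = 0")
    case True
    then show ?thesis using that[of 0 a] rb al by simp
  next
    case False
    define h where "h = b - a"
    have b: "b = a + h" by (simp add: h_def)
    have sp: "0 < sin \<alpha>" using al by (intro sin_gt_zero) auto
    have e: "r * cos h = k + t * cos \<alpha>" "r * sin h = t * sin \<alpha>"
    proof -
      have "x \<bullet> circ a = k * cos 0 + t * cos \<alpha>" "x \<bullet> circ (a + pi/2) = k * cos (- pi/2) + t * cos (\<alpha> - pi/2)"
        unfolding x by (simp_all add: inner_add_left inner_circ)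
      moreover have "x \<bullet> circ a = r * cos h" "x \<bullet> circ (a + pi/2) = r * cos (h - pi/2)"
        unfolding rb(4) b by (simp_all add: inner_circ)
      ultimately show "r * cos h = k + t * cos \<alpha>" "r * sin h = t * sin \<alpha>"
        by (simp_all add: cos_diff)
    qed
    have "0 \<le> r * sin h" unfolding e using st sp by simp
    then have sh: "0 \<le> sin h" using False rb(1) by (simp add: zero_le_mult_iff)
    have hpi: "h \<le> pi"
    proof (rule ccontr)
      assume "\<not> h \<le> pi"
      then have "0 < sin (h - pi)" using rb by (intro sin_gt_zero) (auto simp: h_def)
      then show False using sh by (simp add: sin_diff)
    qed
    have "r * sin (\<alpha> - h) = sin \<alpha> * (r * cos h) - cos \<alpha> * (r * sin h)" by (simp add: sin_diff algebra_simps)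
    also have "\<dots> = k * sin \<alpha>" unfolding e by (simp add: algebra_simps)
    finally have "0 \<le> r * sin (\<alpha> - h)" using st sp by simp
    then have sd: "0 \<le> sin (\<alpha> - h)" using False rb(1) by (simp add: zero_le_mult_iff)
    have "h \<le> \<alpha>"
    proof (rule ccontr)
      assume "\<not> h \<le> \<alpha>"
      then have "0 < sin (h - \<alpha>)" using hpi al by (intro sin_gt_zero) auto
      moreover have "sin (\<alpha> - h) = - sin (h - \<alpha>)" by (simp add: sin_diff)
      ultimately show False using sd by simp
    qed
    then show ?thesis using that[of r b] rb by (simp add: h_def)
  qed
qed

text \<open>The inner product fixes the angle only up to orientation, hence the two cases.\<close>

lemma polar_pair:
  fixes x y :: plane
  assumes al: "0 < \<alpha>" "\<alpha> < pi" and "x \<noteq> 0" "y \<noteq> 0" and inn: "x \<bullet> y = norm x * norm y * cos \<alpha>"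
  obtains a where "x = norm x *\<^sub>R circ a" "y = norm y *\<^sub>R circ (a + \<alpha>)"
  | a where "y = norm y *\<^sub>R circ a" "x = norm x *\<^sub>R circ (a + \<alpha>)"
proof -
  obtain r a where r: "0 \<le> r" "0 \<le> a" "a < 0 + 2*pi" "x = r *\<^sub>R circ a" by (rule polar_from)
  obtain r' b where r': "0 \<le> r'" "a \<le> b" "b < a + 2*pi" "y = r' *\<^sub>R circ b" by (rule polar_from)
  have n: "norm x = r" "norm y = r'" using r r' by auto
  have c: "cos (a - b) = cos (b - a)" by (metis cos_minus minus_diff_eq)
  have "x \<bullet> y = r * (r' * cos (a - b))" unfolding r(4) r'(4) inner_scaleR_left inner_scaleR_right inner_circ by (rule mult.left_commute)
  then have "r * (r' * cos (b - a)) = r * (r' * cos \<alpha>)" using inn unfolding n c by (simp only: mult.assoc)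
  moreover have "r \<noteq> 0" "r' \<noteq> 0" using assms(3,4) n by (metis norm_eq_zero)+
  ultimately have cs: "cos (b - a) = cos \<alpha>" by simp
  have xn: "x = norm x *\<^sub>R circ a" "y = norm y *\<^sub>R circ b" unfolding n by (rule r(4), rule r'(4))
  show ?thesis
  proof (cases "b - a \<le> pi")
    case True
    have "b - a = \<alpha>" by (rule cos_inj_pi) (use cs r'(2) al True in linarith)+
    then have ba: "b = a + \<alpha>" by simp
    show ?thesis by (rule that(1)[OF xn(1)]) (fact xn(2)[unfolded ba])
  next
    case False
    have cs': "cos (2*pi - (b - a)) = cos \<alpha>" unfolding cs[symmetric] by (simp only: cos_2pi_minus)
    have "2*pi - (b - a) = \<alpha>" by (rule cos_inj_pi) (use cs' r'(3) al False in linarith)+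
    then have "b + \<alpha> = a + 2 * pi * of_int 1" by simp
    then have ca: "circ (b + \<alpha>) = circ a" using circ_add_2pi[of a 1] by (simp only:)
    show ?thesis by (rule that(2)[OF xn(2)]) (unfold ca, fact xn(1))
  qed
qed

text \<open>The corner contains its apex and both bounding edges. It is therefore covered by a
  half-open sector of slightly larger angle \<open>\<alpha> + d\<close> together with the point
  \<open>c\<close>.\<close>

lemma measure_corner_aux:
  fixes c p1 p2 :: plane
  assumes al: "0 < \<alpha>" "\<alpha> < pi" and r: "0 < r"
    and p: "p1 - c = m1 *\<^sub>R circ a" "p2 - c = m2 *\<^sub>R circ (a + \<alpha>)" "0 \<le> m1" "0 \<le> m2"
  shows "measure lebesgue (convex hull {c, p1, p2} \<inter> cball c r) \<le> r^2 * \<alpha> / 2"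
proof (rule field_le_epsilon)
  fix e :: real assume e: "0 < e"
  \<comment> \<open>The first bound keeps the extra area \<open>r^2*d/2\<close> below
    \<open>e\<close>, the second keeps the widened angle at most \<open>pi\<close>.\<close>
  define d where "d = min (2*e/r^2) (pi - \<alpha>)"
  have d: "0 < d" "d \<le> 2*e/r^2" "\<alpha> + d \<le> pi" using e r al by (auto simp: d_def)
  let ?H = "half_open_sector a (a + (\<alpha> + d))"
  let ?S = "insert c ((\<lambda>x. r *\<^sub>R x + c) ` ?H)"
  have "convex hull {c, p1, p2} \<inter> cball c r \<subseteq> ?S"
  proof
    fix x assume x: "x \<in> convex hull {c, p1, p2} \<inter> cball c r"
    then obtain u v w where uvw: "0 \<le> u" "0 \<le> v" "0 \<le> w" "u + v + w = 1" "x = u *\<^sub>R c + v *\<^sub>R p1 + w *\<^sub>R p2"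
      unfolding convex_hull_3 by blast
    have "x - c = v *\<^sub>R (p1 - c) + w *\<^sub>R (p2 - c) + (u + v + w - 1) *\<^sub>R c"
      unfolding uvw(5) by (simp add: algebra_simps)
    then have "x - c = (v * m1) *\<^sub>R circ a + (w * m2) *\<^sub>R circ (a + \<alpha>)" using p uvw by simp
    then obtain l b where lb: "0 \<le> l" "x - c = l *\<^sub>R circ b" "a \<le> b" "b \<le> a + \<alpha>"
      by (rule polar_angle_between[OF al]) (use uvw p in auto)
    show "x \<in> ?S"
    proof (cases "l = 0")
      case True
      then show ?thesis using lb by simp
    next
      case False
      have "norm (x - c) \<le> r" using x by (simp add: dist_norm norm_minus_commute)
      then have "l \<le> r" using lb by simp
      then have "(l/r) *\<^sub>R circ b \<in> ?H" using lb False r d by (intro half_open_sectorI) auto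
      moreover have "x = r *\<^sub>R ((l/r) *\<^sub>R circ b) + c" using lb r by (simp add: algebra_simps)
      ultimately show ?thesis by blast
    qed
  qed
  moreover have Hm: "(\<lambda>x. r *\<^sub>R x + c) ` ?H \<in> lmeasurable"
  proof -
    have "(\<lambda>x. r *\<^sub>R x) ` ?H \<in> lmeasurable" 
      by (intro measurable_linear_image half_open_sector_lmeasurable linear_scale_self)
    then have "(+) c ` (\<lambda>x. r *\<^sub>R x) ` ?H \<in> lmeasurable" by (rule measurable_translation)
    then show ?thesis by (simp add: image_image add.commute)
  qed
  then have "?S \<in> lmeasurable" 
    using fmeasurable.Un[OF negligible_imp_measurable[OF negligible_sing[of c]]] by simp
  moreover have "convex hull {c, p1, p2} \<inter> cball c r \<in> sets lebesgue"
    by (intro fmeasurableD lmeasurable_compact compact_Int compact_cball finite_imp_compact_convex_hull) auto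
  ultimately have "measure lebesgue (convex hull {c, p1, p2} \<inter> cball c r) \<le> measure lebesgue ?S"
    by (intro measure_mono_fmeasurable)
  moreover have "measure lebesgue ?S \<le> measure lebesgue {c} + measure lebesgue ((\<lambda>x. r *\<^sub>R x + c) ` ?H)"
    using measure_Un_le[of "{c}" lebesgue "(\<lambda>x. r *\<^sub>R x + c) ` ?H"] Hm by simp
  moreover have "measure lebesgue ((\<lambda>x. r *\<^sub>R x + c) ` ?H) = r^2 * measure lebesgue ?H"
    using r by (simp add: measure_lebesgue_affine)
  moreover have "measure lebesgue ?H = measure lebesgue (half_open_sector 0 (\<alpha> + d))"
    using measure_half_open_sector_shift[of 0 a "\<alpha> + d"] by (simp add: add.commute)
  moreover have "r^2 * measure lebesgue (half_open_sector 0 (\<alpha> + d)) \<le> r^2 * ((\<alpha> + d)/2)"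
    using d al by (intro mult_left_mono measure_half_open_sector_le) auto
  moreover have "r^2 * ((\<alpha> + d)/2) = r^2 * \<alpha>/2 + r^2 * d/2" by (simp add: distrib_left add_divide_distrib)
  moreover have "r^2 * d/2 \<le> e" using d(2) r by (simp add: field_simps)
  ultimately show "measure lebesgue (convex hull {c, p1, p2} \<inter> cball c r) \<le> r^2 * \<alpha>/2 + e"
    by simp
qed

lemma measure_triangle_corner:
  fixes c p1 p2 :: plane
  assumes al: "0 < \<alpha>" "\<alpha> < pi" and r: "0 < r" and "p1 \<noteq> c" "p2 \<noteq> c"
    and inn: "(p1 - c) \<bullet> (p2 - c) = norm (p1 - c) * norm (p2 - c) * cos \<alpha>"
  shows "measure lebesgue (convex hull {c, p1, p2} \<inter> cball c r) \<le> r^2 * \<alpha> / 2"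
proof -
  have nz: "p1 - c \<noteq> 0" "p2 - c \<noteq> 0" using assms by auto
  from al nz inn show ?thesis
  proof (rule polar_pair)
    fix a assume "p1 - c = norm (p1 - c) *\<^sub>R circ a" "p2 - c = norm (p2 - c) *\<^sub>R circ (a + \<alpha>)"
    then show ?thesis by (rule measure_corner_aux[OF al r]) auto
  next
    fix a assume "p2 - c = norm (p2 - c) *\<^sub>R circ a" "p1 - c = norm (p1 - c) *\<^sub>R circ (a + \<alpha>)"
    then have "measure lebesgue (convex hull {c, p2, p1} \<inter> cball c r) \<le> r^2 * \<alpha> / 2"
      by (rule measure_corner_aux[OF al r]) auto
    then show ?thesis by (simp add: insert_commute)
  qed
qed

section \<open>Faces of a triangulated packing\<close>


lemma cos_tangent_angle:
  fixes x y z :: real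
  assumes "0 < x" "0 < y" "0 < z"
  shows "(x+y)*(x+z) * cos (2 * arctan (sqrt (x*y*z/(x+y+z)) / x)) = (x+y)*(x+z) - 2*y*z"
proof -
  define t where "t = sqrt (x*y*z/(x+y+z)) / x"
  have t2: "t^2 = y*z/(x*(x+y+z))"
  proof -
    have "x*y*z/S/x^2 = y*z/(x*S)" if "0 < S" for S
      using that assms by (simp add: field_simps power2_eq_square)
    moreover have "t^2 = x*y*z/(x+y+z)/x^2" using assms by (simp add: t_def power_divide)
    ultimately show ?thesis using assms by simp
  qed
  have "cos (2 * arctan t) = 2 * (cos (arctan t))^2 - 1" by (rule cos_double_cos)
  also have "(cos (arctan t))^2 = 1/(1+t^2)" by (simp add: cos_arctan power_divide)
  also have "1 + t^2 = (x+y)*(x+z)/(x*(x+y+z))"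
  proof -
    have "1 + y*z/(x*S) = (x*S + y*z)/(x*S)" if "0 < S" for S
      using that assms by (simp add: field_simps)
    moreover have "x*(x+y+z) + y*z = (x+y)*(x+z)" by algebra
    ultimately show ?thesis unfolding t2 using assms by (metis add_pos_pos)
  qed
  finally have "cos (2 * arctan t) = 2 * (x*(x+y+z)/((x+y)*(x+z))) - 1" by simp
  moreover have "D * (2 * (n/D) - 1) = 2*n - D" if "D \<noteq> 0" for D n :: real
    using that by (simp add: algebra_simps)
  moreover have "(x+y)*(x+z) \<noteq> 0" using assms by simp
  ultimately have "(x+y)*(x+z) * cos (2 * arctan t) = 2*(x*(x+y+z)) - (x+y)*(x+z)" by metis
  also have "\<dots> = (x+y)*(x+z) - 2*y*z" by (simp add: algebra_simps)
  finally show ?thesis unfolding t_def .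
qed

lemma measure_triangle_disk:
  fixes c p1 p2 :: plane
  assumes pos: "0 < x" "0 < y" "0 < z"
    and d: "dist c p1 = x + y" "dist c p2 = x + z" "dist p1 p2 = y + z"
  shows "measure lebesgue (convex hull {c, p1, p2} \<inter> cball c x) \<le> x^2 * arctan (sqrt (x*y*z/(x+y+z)) / x)"
proof -
  let ?a = "2 * arctan (sqrt (x*y*z/(x+y+z)) / x)"
  have n: "norm (p1 - c) = x + y" "norm (p2 - c) = x + z" "norm ((p1 - c) - (p2 - c)) = y + z"
    using d by (simp_all add: dist_norm norm_minus_commute)
  have "(p1 - c) \<bullet> (p2 - c) = ((x+y)^2 + (x+z)^2 - (y+z)^2)/2"
    unfolding dot_norm_neg n ..
  also have "\<dots> = (x+y)*(x+z) - 2*y*z" by (simp add: power2_eq_square field_simps)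
  finally have "(p1 - c) \<bullet> (p2 - c) = norm (p1 - c) * norm (p2 - c) * cos ?a"
    unfolding n cos_tangent_angle[OF pos] .
  moreover have "0 < ?a" "?a < pi" using arctan_bounded[of "sqrt (x*y*z/(x+y+z)) / x"] pos by auto
  moreover have "p1 \<noteq> c" "p2 \<noteq> c" using d pos by auto
  ultimately have "measure lebesgue (convex hull {c, p1, p2} \<inter> cball c x) \<le> x^2 * ?a / 2"
    using pos by (intro measure_triangle_corner) auto
  then show ?thesis by simp
qed

lemma measure_tangent_triangle:
  fixes A B C :: plane
  assumes pos: "0 < x" "0 < y" "0 < z"
    and d: "dist A B = x + y" "dist A C = x + z" "dist B C = y + z"
  shows "measure lebesgue (convex hull {A, B, C}) = tri_area x y z"
proof -
  have "convex hull {A, B, C} \<in> sets borel"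
    by (intro borel_compact finite_imp_compact_convex_hull) auto
  then have "measure lebesgue (convex hull {A, B, C}) = measure lborel (convex hull {A, B, C})"
    by (simp add: measure_completion)
  also have "\<dots> = sqrt ((x+y+z) * x * y * z)"
  proof -
    have e: "((y+z)+(x+z)+(x+y))/2 = x+y+z" by simp
    show ?thesis using heron[of A B C] unfolding d e by (simp add: algebra_simps)
  qed
  finally show ?thesis by (simp add: tri_area_def mult_ac)
qed

section \<open>Disks that meet a triangular face\<close>

definition mutually_tangent :: "disk \<Rightarrow> disk \<Rightarrow> disk \<Rightarrow> bool" where
  "mutually_tangent d1 d2 d3 \<longleftrightarrow> tangent d1 d2 \<and> tangent d2 d3 \<and> tangent d3 d1"

lemma tangent_sym: "tangent d e \<longleftrightarrow> tangent e d"
  by (auto simp: tangent_def dist_commute)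

locale packing =
  fixes P :: "disk set"
  assumes packing: "disk_packing P"
begin

lemma radius_pos: "d \<in> P \<Longrightarrow> 0 < snd d"
  using packing by (auto simp: disk_packing_def)

lemma disjoint_balls:
  assumes "d \<in> P" "e \<in> P" "d \<noteq> e"
  shows "ball (fst d) (snd d) \<inter> ball (fst e) (snd e) = {}"
  using packing assms unfolding disk_packing_def pairwise_def disk_set_def interior_cball disjnt_def by blast

lemma disjoint_ball_cball:
  assumes "d \<in> P" "e \<in> P" "d \<noteq> e"
  shows "ball (fst d) (snd d) \<inter> cball (fst e) (snd e) = {}"
proof -
  have "ball (fst d) (snd d) \<inter> closure (ball (fst e) (snd e)) = {}"
    using disjoint_balls[OF assms] by (simp add: open_Int_closure_eq_empty)
  then show ?thesis using radius_pos[OF assms(2)] by simp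
qed

lemma dist_ge:
  assumes "d \<in> P" "e \<in> P" "d \<noteq> e"
  shows "snd d + snd e \<le> dist (fst d) (fst e)"
proof (rule ccontr)
  define r t where "r = snd d" and "t = snd e"
  define x where "x = fst d + (r/(r+t)) *\<^sub>R (fst e - fst d)"
  have pos: "0 < r" "0 < t" using radius_pos assms by (auto simp: r_def t_def)
  assume "\<not> ?thesis"
  then have lt: "norm (fst e - fst d) < r + t" by (simp add: r_def t_def dist_norm norm_minus_commute)
  have "dist (fst d) x = (r/(r+t)) * norm (fst e - fst d)" using pos by (simp add: x_def dist_norm)
  also have "\<dots> < (r/(r+t)) * (r+t)" using pos lt by (intro mult_strict_left_mono) auto
  finally have "x \<in> ball (fst d) r" using pos by simp
  have "fst e - x = (1 - r/(r+t)) *\<^sub>R (fst e - fst d)" by (simp add: x_def algebra_simps)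
  also have "1 - r/(r+t) = t/(r+t)" using pos by (simp add: field_simps)
  finally have "dist (fst e) x = (t/(r+t)) * norm (fst e - fst d)" using pos by (simp add: dist_norm)
  also have "\<dots> < (t/(r+t)) * (r+t)" using pos lt by (intro mult_strict_left_mono) auto
  finally have "x \<in> ball (fst e) t" using pos by simp
  with \<open>x \<in> ball (fst d) r\<close> show False using disjoint_balls[OF assms] by (auto simp: r_def t_def)
qed

lemma edge_in_disks:
  assumes "tangent d e" "x \<in> closed_segment (fst d) (fst e)"
  shows "x \<in> cball (fst d) (snd d) \<union> cball (fst e) (snd e)"
proof -
  have "dist (fst d) (fst e) = dist (fst d) x + dist x (fst e)"
    using assms(2) by (metis between between_mem_segment)
  then show ?thesis using assms(1) by (auto simp: tangent_def dist_commute)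
qed

text \<open>The open disk of \<open>e\<close> is connected, meets \<open>F\<close> and has its
  center outside \<open>F\<close>, so it meets the boundary of the triangle. Each edge is covered by
  the two disks at its ends, and an open disk of the packing is disjoint from every other closed
  disk.\<close>

lemma disk_meets_face:
  assumes d: "d1 \<in> P" "d2 \<in> P" "d3 \<in> P" "mutually_tangent d1 d2 d3"
    and F: "F = interior (convex hull {fst d1, fst d2, fst d3})" "fst ` P \<inter> F = {}"
    and e: "e \<in> P" "ball (fst e) (snd e) \<inter> F \<noteq> {}"
  shows "e \<in> {d1, d2, d3}"
proof (rule ccontr)
  assume ne: "e \<notin> {d1, d2, d3}"
  let ?T = "convex hull {fst d1, fst d2, fst d3}"
  have "fst e \<in> ball (fst e) (snd e) - F" using F(2) e radius_pos[OF e(1)] by auto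
  then have "ball (fst e) (snd e) - F \<noteq> {}" by blast
  then have "ball (fst e) (snd e) \<inter> frontier F \<noteq> {}"
    by (intro connected_Int_frontier) (use e in auto)
  then obtain x where x: "x \<in> ball (fst e) (snd e)" "x \<in> frontier ?T"
    using frontier_interior_subset[of ?T] unfolding F(1) by blast
  have "frontier ?T = closed_segment (fst d1) (fst d2) \<union> closed_segment (fst d2) (fst d3) \<union> closed_segment (fst d3) (fst d1)"
    by (rule frontier_of_triangle) simp
  then have "x \<in> cball (fst d1) (snd d1) \<union> cball (fst d2) (snd d2) \<union> cball (fst d3) (snd d3)"
    using x edge_in_disks d(4) unfolding mutually_tangent_def by blast
  then show False
    using x disjoint_ball_cball[OF e(1)] d ne by blast
qed

lemma face_covered:
  assumes d: "d1 \<in> P" "d2 \<in> P" "d3 \<in> P" "mutually_tangent d1 d2 d3"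
    and F: "F = interior (convex hull {fst d1, fst d2, fst d3})" "fst ` P \<inter> F = {}"
  shows "F \<inter> (\<Union>d\<in>P. disk_set d) \<subseteq> (\<Union>d\<in>{d1,d2,d3}. convex hull {fst d1, fst d2, fst d3} \<inter> cball (fst d) (snd d))"
proof
  fix x assume "x \<in> F \<inter> (\<Union>d\<in>P. disk_set d)"
  then obtain e where e: "x \<in> F" "e \<in> P" "x \<in> cball (fst e) (snd e)" by (auto simp: disk_set_def)
  \<comment> \<open>As \<open>F\<close> is open, meeting the closed disk implies meeting the open
    one.\<close>
  have "F \<inter> closure (ball (fst e) (snd e)) \<noteq> {}" using e radius_pos[OF e(2)] by auto
  then have "F \<inter> ball (fst e) (snd e) \<noteq> {}" unfolding F(1) using open_Int_closure_eq_empty by blast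
  then have "e \<in> {d1, d2, d3}" using disk_meets_face[OF d F e(2)] by (simp add: Int_commute)
  then show "x \<in> (\<Union>d\<in>{d1,d2,d3}. convex hull {fst d1, fst d2, fst d3} \<inter> cball (fst d) (snd d))"
    using e interior_subset F(1) by blast
qed

lemma face_measure:
  assumes d: "d1 \<in> P" "d2 \<in> P" "d3 \<in> P" "mutually_tangent d1 d2 d3"
    and F: "F = interior (convex hull {fst d1, fst d2, fst d3})"
  shows "F \<in> lmeasurable" "measure lebesgue F = tri_area (snd d1) (snd d2) (snd d3)"
proof -
  let ?T = "convex hull {fst d1, fst d2, fst d3}"
  have cp: "compact ?T" by (intro finite_imp_compact_convex_hull) auto
  then have T: "?T \<in> lmeasurable" by (rule lmeasurable_compact)
  show "F \<in> lmeasurable" unfolding F using cp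
    by (intro lmeasurable_open bounded_interior compact_imp_bounded) auto
  have "negligible (frontier ?T)" by (intro negligible_convex_frontier convex_convex_hull)
  then have "measure lebesgue F = measure lebesgue ?T"
    unfolding F by (intro measure_interior compact_imp_bounded cp)
  also have "\<dots> = tri_area (snd d1) (snd d2) (snd d3)"
    using d radius_pos by (intro measure_tangent_triangle) (auto simp: mutually_tangent_def tangent_def dist_commute)
  finally show "measure lebesgue F = tri_area (snd d1) (snd d2) (snd d3)" .
qed

lemma face_covered_measure:
  assumes d: "d1 \<in> P" "d2 \<in> P" "d3 \<in> P" "mutually_tangent d1 d2 d3"
    and F: "F = interior (convex hull {fst d1, fst d2, fst d3})" "fst ` P \<inter> F = {}"
    and meas: "F \<inter> (\<Union>d\<in>P. disk_set d) \<in> sets lebesgue"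
  shows "measure lebesgue (F \<inter> (\<Union>d\<in>P. disk_set d)) \<le> sector_sum (snd d1) (snd d2) (snd d3)"
proof -
  let ?T = "convex hull {fst d1, fst d2, fst d3}"
  let ?x = "snd d1" and ?y = "snd d2" and ?z = "snd d3"
  let ?C = "\<lambda>d. ?T \<inter> cball (fst d) (snd d)"
  have cp: "compact ?T" by (intro finite_imp_compact_convex_hull) auto
  have C: "?C d \<in> lmeasurable" for d
    by (intro lmeasurable_compact compact_Int cp compact_cball)
  have pos: "0 < ?x" "0 < ?y" "0 < ?z" using d radius_pos by auto
  have dd: "dist (fst d1) (fst d2) = ?x + ?y" "dist (fst d2) (fst d3) = ?y + ?z" "dist (fst d3) (fst d1) = ?z + ?x"
    using d by (auto simp: mutually_tangent_def tangent_def)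
  have "measure lebesgue (F \<inter> (\<Union>d\<in>P. disk_set d)) \<le> measure lebesgue (?C d1 \<union> ?C d2 \<union> ?C d3)"
    using face_covered[OF d F] meas C by (intro measure_mono_fmeasurable fmeasurable.Un) auto
  also have "\<dots> \<le> measure lebesgue (?C d1 \<union> ?C d2) + measure lebesgue (?C d3)"
    using C by (intro measure_Un_le) (auto intro!: fmeasurableD fmeasurable.Un)
  also have "\<dots> \<le> measure lebesgue (?C d1) + measure lebesgue (?C d2) + measure lebesgue (?C d3)"
    using C measure_Un_le[of "?C d1" lebesgue "?C d2"] by (auto intro: fmeasurableD)
  also have "\<dots> \<le> sector_sum ?x ?y ?z"
  proof -
    have "measure lebesgue (?C d1) \<le> ?x^2 * arctan (sqrt (?x*?y*?z/(?x+?y+?z)) / ?x)"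
      by (rule measure_triangle_disk) (use pos dd in \<open>auto simp: dist_commute\<close>)
    moreover have "measure lebesgue (convex hull {fst d2, fst d1, fst d3} \<inter> cball (fst d2) (snd d2)) \<le> ?y^2 * arctan (sqrt (?y*?x*?z/(?y+?x+?z)) / ?y)"
      by (rule measure_triangle_disk) (use pos dd in \<open>auto simp: dist_commute\<close>)
    moreover have "measure lebesgue (convex hull {fst d3, fst d1, fst d2} \<inter> cball (fst d3) (snd d3)) \<le> ?z^2 * arctan (sqrt (?z*?x*?y/(?z+?x+?y)) / ?z)"
      by (rule measure_triangle_disk) (use pos dd in \<open>auto simp: dist_commute\<close>)
    moreover have "?y*?x*?z/(?y+?x+?z) = ?x*?y*?z/(?x+?y+?z)" "?z*?x*?y/(?z+?x+?y) = ?x*?y*?z/(?x+?y+?z)"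
      by (simp_all add: mult_ac add_ac)
    moreover have "{fst d2, fst d1, fst d3} = {fst d1, fst d2, fst d3}" "{fst d3, fst d1, fst d2} = {fst d1, fst d2, fst d3}"
      by auto
    ultimately show ?thesis unfolding sector_sum_def Let_def by simp
  qed
  finally show ?thesis .
qed

end

section \<open>Packings all of whose faces are extremal\<close>


context packing
begin

lemma face_disjoint_drawing:
  "F \<in> contact_graph_faces P \<Longrightarrow> F \<inter> contact_graph_drawing P = {}"
  unfolding contact_graph_faces_def using in_components_subset by blast

lemma face_disjoint_centers:
  "F \<in> contact_graph_faces P \<Longrightarrow> fst ` P \<inter> F = {}"
  using face_disjoint_drawing[of F] unfolding contact_graph_drawing_def by blast

lemma face_cover:
  assumes "x \<notin> contact_graph_drawing P"
  obtains F where "F \<in> contact_graph_faces P" "x \<in> F"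
  using assms Union_components[of "- contact_graph_drawing P"] unfolding contact_graph_faces_def by blast

text \<open>The law of cosines combined with \<open>dist_ge\<close>. If \<open>d\<close> has radius
  \<open>q\<close> and the neighbours have radii \<open>q\<close> and 1, the right side is the
  product of the distances times \<open>cos \<beta>\<close>, so such neighbours are at least
  \<open>\<beta>\<close> apart.\<close>

lemma neighbour_inner:
  assumes "d \<in> P" "e1 \<in> P" "e2 \<in> P" "e1 \<noteq> e2"
    and "fst e1 = fst d + (snd d + snd e1) *\<^sub>R circ a" "fst e2 = fst d + (snd d + snd e2) *\<^sub>R circ b"
  shows "(snd d + snd e1) * (snd d + snd e2) * cos (a - b) \<le> (snd d + snd e1) * (snd d + snd e2) - 2 * snd e1 * snd e2"
proof -
  let ?x = "snd d" and ?y = "snd e1" and ?z = "snd e2"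
  have pos: "0 < ?x" "0 < ?y" "0 < ?z" using assms radius_pos by auto
  have "(?y + ?z)^2 \<le> (dist (fst e1) (fst e2))^2"
    using dist_ge[OF assms(2-4)] pos by (intro power_mono) auto
  also have "\<dots> = (norm ((?x + ?y) *\<^sub>R circ a - (?x + ?z) *\<^sub>R circ b))^2"
    unfolding assms(5,6) dist_norm by simp
  also have "\<dots> = (?x+?y)^2 + (?x+?z)^2 - 2*((?x+?y)*(?x+?z)*cos (a - b))"
  proof -
    have "(norm (A *\<^sub>R circ a - B *\<^sub>R circ b))^2 = A^2 + B^2 - 2*(A*B*cos (a - b))" for A B
      using dot_norm_neg[of "A *\<^sub>R circ a" "B *\<^sub>R circ b"] by (simp add: inner_circ power_mult_distrib algebra_simps)
    then show ?thesis .
  qed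
  finally show ?thesis by (simp add: power2_eq_square algebra_simps)
qed

lemma neighbour_direction:
  assumes "d \<in> P" "e \<in> P" "tangent d e" 
  obtains a where "fst e = fst d + (snd d + snd e) *\<^sub>R circ a"
proof -
  obtain r a where ra: "0 \<le> r" "fst e - fst d = r *\<^sub>R circ a" using polar_from by metis
  have "norm (fst e - fst d) = snd d + snd e"
    using assms(3) by (simp add: tangent_def dist_norm norm_minus_commute)
  then have "r = snd d + snd e" using ra by simp
  then show ?thesis using that[of a] ra(2) by (simp add: algebra_simps)
qed

lemma segment_direction:
  assumes "d \<in> P" "e \<in> P" "tangent d e" "fst d + r *\<^sub>R circ b \<in> closed_segment (fst d) (fst e)" "0 < r"
  shows "fst e = fst d + (snd d + snd e) *\<^sub>R circ b"
proof -
  obtain a where a: "fst e = fst d + (snd d + snd e) *\<^sub>R circ a" using neighbour_direction assms(1-3) .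
  obtain t where t: "0 \<le> t" "fst d + r *\<^sub>R circ b = (1 - t) *\<^sub>R fst d + t *\<^sub>R fst e"
    using assms(4) by (auto simp: closed_segment_def)
  have eq: "r *\<^sub>R circ b = (t * (snd d + snd e)) *\<^sub>R circ a"
    using t(2) unfolding a by (simp add: algebra_simps)
  have "0 < snd d + snd e" using radius_pos[OF assms(1)] radius_pos[OF assms(2)] by simp
  moreover have "norm (r *\<^sub>R circ b) = norm ((t * (snd d + snd e)) *\<^sub>R circ a)" using eq by (rule arg_cong)
  ultimately have "r = t * (snd d + snd e)" using assms(5) t(1) by (simp add: abs_mult)
  then have "r *\<^sub>R circ b = r *\<^sub>R circ a" using eq by (simp only:)
  then have "circ b = circ a" using assms(5) by simp
  then show ?thesis using a by simp
qed

end

section \<open>The neighbours of a disk of radius \<open>q\<close>\<close>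

locale extremal_packing = packing +
  fixes q :: real
  assumes q: "0 < q" "q < 1"
    and radii: "d \<in> P \<Longrightarrow> snd d \<in> {q..1}"
    and extremal: "F \<in> contact_graph_faces P \<Longrightarrow> \<exists>d1\<in>P. \<exists>d2\<in>P. \<exists>d3\<in>P.
        mutually_tangent d1 d2 d3 \<and> F = interior (convex hull {fst d1, fst d2, fst d3}) \<and>
        {#snd d1, snd d2, snd d3#} = {#q, q, 1#}"
begin

text \<open>A disk of smallest radius sees its neighbours at least \<open>pi/3\<close> apart,
  because \<open>q + r \<le> 2*r\<close> for the radius \<open>r\<close> of each neighbour.\<close>

lemma neighbour_cos_le_half:
  assumes "d \<in> P" "snd d = q" "e1 \<in> P" "e2 \<in> P" "e1 \<noteq> e2"
    and "fst e1 = fst d + (snd d + snd e1) *\<^sub>R circ a" "fst e2 = fst d + (snd d + snd e2) *\<^sub>R circ b"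
  shows "cos (a - b) \<le> 1/2"
proof -
  let ?y = "snd e1" and ?z = "snd e2"
  have r: "q \<le> ?y" "q \<le> ?z" using radii[OF assms(3)] radii[OF assms(4)] by auto
  have "(q+?y)*(q+?z) * cos (a - b) \<le> (q+?y)*(q+?z) - 2*?y*?z"
    using neighbour_inner[OF assms(1,3-7)] assms(2) by simp
  also have "(q+?y)*(q+?z) \<le> (2*?y)*(2*?z)" using r q by (intro mult_mono) auto
  then have "(q+?y)*(q+?z) - 2*?y*?z \<le> (q+?y)*(q+?z) * (1/2)" by simp
  finally have "(q+?y)*(q+?z) * cos (a - b) \<le> (q+?y)*(q+?z) * (1/2)" .
  moreover have "0 < (q+?y)*(q+?z)" using r q by (intro mult_pos_pos) auto
  ultimately show ?thesis by (simp only: mult_le_cancel_left_pos)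
qed

definition \<beta> :: real where "\<beta> = arccos (q/(1+q))"

lemma beta: "cos \<beta> = q/(1+q)" "pi/3 < \<beta>" "\<beta> < pi/2"
proof -
  have u: "0 < q/(1+q)" "q/(1+q) < 1/2" using q by (auto simp: field_simps)
  have "-1 \<le> q/(1+q)" "q/(1+q) \<le> 1" using u by linarith+
  then show "cos \<beta> = q/(1+q)" unfolding \<beta>_def by (rule cos_arccos)
  have "arccos (1/2) = pi/3" using arccos_cos[of "pi/3"] by (simp add: cos_60)
  then show "pi/3 < \<beta>" using arccos_less_arccos[of "q/(1+q)" "1/2"] u by (simp add: \<beta>_def)
  show "\<beta> < pi/2" using arccos_less_arccos[of 0 "q/(1+q)"] u by (simp add: \<beta>_def)
qed

text \<open>Neighbours of \<open>d\<close> are at least \<open>pi/3\<close> apart as seen from \<open>d\<close>, so any angle strictly between 0 and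
  \<open>pi/3\<close> would do in place of \<open>pi/6\<close>.\<close>

lemma probe_point_off_drawing:
  assumes d: "d \<in> P" "snd d = q" and e: "e \<in> P" "fst e = fst d + (snd d + snd e) *\<^sub>R circ a"
  shows "fst d + (q/2) *\<^sub>R circ (a + pi/6) \<notin> contact_graph_drawing P" (is "?m \<notin> _")
proof
  assume m: "?m \<in> contact_graph_drawing P"
  \<comment> \<open>Because the probe lies inside the disk \<open>d\<close>, the only edges that can
    contain it are those ending at \<open>d\<close>.\<close>
  have mb: "?m \<in> ball (fst d) (snd d)" using q d by (simp add: dist_norm)
  have seg: False if e': "e' \<in> P" "tangent d e'" "?m \<in> closed_segment (fst d) (fst e')" for e'
  proof -
    have dir: "fst e' = fst d + (snd d + snd e') *\<^sub>R circ (a + pi/6)"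
      using segment_direction[OF d(1) e'] q by simp
    show False
    proof (cases "e' = e")
      case True
      have "0 < snd d + snd e" using radius_pos[OF d(1)] radius_pos[OF e(1)] by simp
      then have "circ a = circ (a + pi/6)" using dir e(2) True by simp
      then have "circ a \<bullet> circ a = circ a \<bullet> circ (a + pi/6)" by simp
      then have "cos (pi/6) = 1" unfolding inner_circ by simp
      moreover have "cos (pi/6) < cos 0" by (intro cos_monotone_0_pi) auto
      ultimately show False by simp
    next
      case False
      have "cos (a + pi/6 - a) \<le> 1/2" using neighbour_cos_le_half[OF d e'(1) e(1) False dir e(2)] .
      moreover have "cos (pi/3) < cos (pi/6)" by (intro cos_monotone_0_pi) auto
      ultimately show False by (simp add: cos_60)
    qed
  qed
  consider e' where "e' \<in> P" "?m = fst e'"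
    | d' e' where "d' \<in> P" "e' \<in> P" "tangent d' e'" "?m \<in> closed_segment (fst d') (fst e')"
    using m unfolding contact_graph_drawing_def by blast
  then show False
  proof cases
    case (1 e')
    then have "?m \<in> ball (fst e') (snd e')" using radius_pos by simp
    then have "e' = d" using mb disjoint_balls[OF d(1) 1(1)] by blast
    then have "(q/2) *\<^sub>R circ (a + pi/6) = 0" using 1(2) by simp
    moreover have "circ (a + pi/6) \<noteq> 0" by (metis norm_circ norm_zero zero_neq_one)
    ultimately show False using q by simp
  next
    case (2 d' e')
    have "?m \<in> cball (fst d') (snd d') \<union> cball (fst e') (snd e')" using edge_in_disks 2 by blast
    then have "d' = d \<or> e' = d" using mb disjoint_ball_cball d(1) 2 by blast
    then show False using seg[of e'] seg[of d'] 2 tangent_sym closed_segment_commute by metis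
  qed
qed

lemma face_corner:
  assumes F: "F \<in> contact_graph_faces P" and d: "d \<in> P" "snd d = q" and x: "x \<in> F" "x \<in> ball (fst d) (snd d)"
  obtains e1 e2 where "e1 \<in> P" "e2 \<in> P" "mutually_tangent d e1 e2" "F = interior (convex hull {fst d, fst e1, fst e2})"
    "(snd e1 = q \<and> snd e2 = 1) \<or> (snd e1 = 1 \<and> snd e2 = q)"
proof -
  obtain d1 d2 d3 where t: "d1 \<in> P" "d2 \<in> P" "d3 \<in> P" "mutually_tangent d1 d2 d3"
    "F = interior (convex hull {fst d1, fst d2, fst d3})" "{#snd d1, snd d2, snd d3#} = {#q, q, 1#}"
    using extremal[OF F] by blast
  have "d \<in> {d1, d2, d3}"
    using disk_meets_face[OF t(1-5) face_disjoint_centers[OF F] d(1)] x by blast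
  then consider "d = d1" | "d = d2" | "d = d3" by blast
  then show ?thesis
  proof cases
    case 1
    have "{#snd d2, snd d3#} = {#q, 1#}" using t(6) 1 d(2) by simp
    then show ?thesis using that[of d2 d3] t 1 by (auto simp: add_mset_eq_single add_eq_conv_ex)
  next
    case 2
    have "{#snd d3, snd d1#} = {#q, 1#}" using t(6) 2 d(2) by (simp add: add_mset_commute)
    moreover have "{fst d2, fst d3, fst d1} = {fst d1, fst d2, fst d3}" by blast
    ultimately show ?thesis using that[of d3 d1] t 2
      by (auto simp: add_mset_eq_single add_eq_conv_ex mutually_tangent_def)
  next
    case 3
    have "{#snd d1, snd d2#} = {#q, 1#}" using t(6) 3 d(2) by (simp add: add_mset_commute)
    moreover have "{fst d3, fst d1, fst d2} = {fst d1, fst d2, fst d3}" by blast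
    ultimately show ?thesis using that[of d1 d2] t 3
      by (auto simp: add_mset_eq_single add_eq_conv_ex mutually_tangent_def)
  qed
qed

text \<open>The probe point lies in a face with vertex \<open>d\<close>, whose other vertices
  \<open>x\<close> and \<open>y\<close> are seen from \<open>d\<close> at the angles
  \<open>c\<close> and \<open>c + \<beta>\<close> with the probe in between. If \<open>e\<close>
  were not \<open>x\<close>, it would be at least \<open>pi/3\<close> beyond \<open>x\<close> and
  thus, as \<open>\<beta> < pi/2\<close>, less than \<open>pi/3\<close> before \<open>y\<close>,
  against \<open>neighbour_cos_le_half\<close>. Hence \<open>y\<close> is the neighbour
  sought.\<close>

lemma next_neighbour:
  assumes d: "d \<in> P" "snd d = q" and e: "e \<in> P" "fst e = fst d + (snd d + snd e) *\<^sub>R circ a"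
  obtains e' where "e' \<in> P" "fst e' = fst d + (snd d + snd e') *\<^sub>R circ (a + \<beta>)"
    "(snd e = q \<and> snd e' = 1) \<or> (snd e = 1 \<and> snd e' = q)"
proof -
  let ?m = "fst d + (q/2) *\<^sub>R circ (a + pi/6)"
  obtain F where F: "F \<in> contact_graph_faces P" "?m \<in> F"
    using face_cover probe_point_off_drawing[OF d e] by blast
  have "?m \<in> ball (fst d) (snd d)" using q d by (simp add: dist_norm)
  then obtain e1 e2 where e12: "e1 \<in> P" "e2 \<in> P" "mutually_tangent d e1 e2" "F = interior (convex hull {fst d, fst e1, fst e2})"
    "(snd e1 = q \<and> snd e2 = 1) \<or> (snd e1 = 1 \<and> snd e2 = q)"
    using face_corner[OF F(1) d F(2)] by metis
  have nrm: "norm (fst e1 - fst d) = q + snd e1" "norm (fst e2 - fst d) = q + snd e2"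
    "norm ((fst e1 - fst d) - (fst e2 - fst d)) = 1 + q"
    using e12(3,5) d by (auto simp: mutually_tangent_def tangent_def dist_norm norm_minus_commute)
  have rp: "(q + snd e1) * (q + snd e2) = 2*q*(q+1)" "(q + snd e1)^2 + (q + snd e2)^2 = (2*q)^2 + (q+1)^2"
    using e12(5) by auto
  have "(fst e1 - fst d) \<bullet> (fst e2 - fst d) = ((2*q)^2 + (q+1)^2 - (1+q)^2)/2"
    unfolding dot_norm_neg nrm rp ..
  also have "\<dots> = 2*q*(q+1) * (q/(1+q))" using q by (simp add: field_simps power2_eq_square)
  finally have inn: "(fst e1 - fst d) \<bullet> (fst e2 - fst d) = norm (fst e1 - fst d) * norm (fst e2 - fst d) * cos \<beta>"
    unfolding nrm beta(1) rp by simp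
  have b0: "0 < \<beta>" "\<beta> < pi" using beta q pi_gt_zero by linarith+
  have nz: "fst e1 - fst d \<noteq> 0" "fst e2 - fst d \<noteq> 0"
    using nrm radius_pos[OF e12(1)] radius_pos[OF e12(2)] q by auto
  obtain x y c where xy: "x \<in> P" "y \<in> P" "fst x = fst d + (snd d + snd x) *\<^sub>R circ c" "fst y = fst d + (snd d + snd y) *\<^sub>R circ (c + \<beta>)"
    "(snd x = q \<and> snd y = 1) \<or> (snd x = 1 \<and> snd y = q)" "F = interior (convex hull {fst d, fst x, fst y})"
  proof (rule polar_pair[OF b0 nz inn])
    fix c assume "fst e1 - fst d = norm (fst e1 - fst d) *\<^sub>R circ c" "fst e2 - fst d = norm (fst e2 - fst d) *\<^sub>R circ (c + \<beta>)"
    then show thesis using that[of e1 e2 c] e12 d unfolding nrm by (simp add: algebra_simps)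
  next
    fix c assume "fst e2 - fst d = norm (fst e2 - fst d) *\<^sub>R circ c" "fst e1 - fst d = norm (fst e1 - fst d) *\<^sub>R circ (c + \<beta>)"
    then show thesis using that[of e2 e1 c] e12 d unfolding nrm by (auto simp: algebra_simps insert_commute)
  qed
  have "?m \<in> convex hull {fst d, fst x, fst y}" using F(2) xy(6) interior_subset by blast
  then obtain k1 k2 k3 where k: "0 \<le> k1" "0 \<le> k2" "0 \<le> k3" "k1 + k2 + k3 = 1" "?m = k1 *\<^sub>R fst d + k2 *\<^sub>R fst x + k3 *\<^sub>R fst y"
    unfolding convex_hull_3 by blast
  have "?m - fst d = k2 *\<^sub>R (fst x - fst d) + k3 *\<^sub>R (fst y - fst d) + (k1 + k2 + k3 - 1) *\<^sub>R fst d"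
    unfolding k(5) by (simp add: algebra_simps)
  then have "?m - fst d = (k2 * (snd d + snd x)) *\<^sub>R circ c + (k3 * (snd d + snd y)) *\<^sub>R circ (c + \<beta>)"
    using k(4) xy(3,4) by simp
  moreover have "0 \<le> k2 * (snd d + snd x)" "0 \<le> k3 * (snd d + snd y)"
    using k radius_pos[OF d(1)] radius_pos[OF xy(1)] radius_pos[OF xy(2)] by auto
  ultimately obtain l b where lb: "0 \<le> l" "?m - fst d = l *\<^sub>R circ b" "c \<le> b" "b \<le> c + \<beta>"
    using polar_angle_between[OF b0] by metis
  have "norm (?m - fst d) = l" using lb by simp
  then have l: "l = q/2" using q by simp
  have "(q/2) *\<^sub>R circ (a + pi/6) = (q/2) *\<^sub>R circ b" using lb(2) unfolding l by simp
  then have cb: "circ b = circ (a + pi/6)" using q by simp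
  \<comment> \<open>This is the angle \<open>a\<close> shifted by a multiple of \<open>2*pi\<close>
    so that it can be compared with \<open>c\<close>.\<close>
  define a' where "a' = b - pi/6"
  have ca: "circ a = circ a'"
  proof -
    obtain n :: int where "b = a + pi/6 + 2*pi*n" using cb unfolding circ_eq_iff by blast
    then have "a' = a + 2*pi*n" by (simp add: a'_def)
    then show ?thesis using circ_add_2pi[of a n] by simp
  qed
  have ca2: "circ (a' + \<beta>) = circ (a + \<beta>)"
  proof -
    obtain n :: int where "a = a' + 2*pi*n" using ca unfolding circ_eq_iff by blast
    then have "a + \<beta> = a' + \<beta> + 2 * pi * of_int n" by simp
    then show ?thesis using circ_add_2pi[of "a' + \<beta>" n] by (simp only:)
  qed
  have ea: "fst e = fst d + (snd d + snd e) *\<^sub>R circ a'" using e(2) ca by simp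
  have cos_gt: "1/2 < cos z" if "0 \<le> z" "z < pi/3" for z
    using cos_monotone_0_pi[of z "pi/3"] that by (simp add: cos_60)
  have ex: "e = x"
  proof (rule ccontr)
    assume ne: "e \<noteq> x"
    have c1: "cos (a' - c) \<le> 1/2" using neighbour_cos_le_half[OF d e(1) xy(1) ne ea xy(3)] .
    have gt: "c + pi/3 \<le> a'"
    proof (rule ccontr)
      assume "\<not> ?thesis"
      then have "\<bar>a' - c\<bar> < pi/3" using lb(3) pi_gt_zero unfolding a'_def abs_less_iff by linarith
      then have "1/2 < cos \<bar>a' - c\<bar>" by (intro cos_gt) auto
      then show False using c1 by simp
    qed
    have r: "a' < c + \<beta>" using lb(4) pi_gt_zero unfolding a'_def by linarith
    have "e \<noteq> y"
    proof
      assume "e = y"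
      then have "(snd d + snd y) *\<^sub>R circ (c + \<beta>) = (snd d + snd y) *\<^sub>R circ a'"
        using ea xy(4) by (metis add_left_imp_eq)
      moreover have "snd d + snd y \<noteq> 0" using radius_pos[OF d(1)] radius_pos[OF xy(2)] by simp
      ultimately have "circ a' \<bullet> circ (c + \<beta>) = circ a' \<bullet> circ a'" by simp
      then have "cos (c + \<beta> - a') = 1" unfolding inner_circ by (metis cos_minus cos_zero diff_self minus_diff_eq)
      moreover have "cos (c + \<beta> - a') < cos 0" using r gt b0 by (intro cos_monotone_0_pi) linarith+
      ultimately show False by simp
    qed
    then have "cos (a' - (c + \<beta>)) \<le> 1/2" using neighbour_cos_le_half[OF d e(1) xy(2) _ ea xy(4)] by simp
    then have "cos (c + \<beta> - a') \<le> 1/2" by (metis cos_minus minus_diff_eq)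
    moreover have "1/2 < cos (c + \<beta> - a')" using gt r beta(3) pi_gt_zero by (intro cos_gt) linarith+
    ultimately show False by simp
  qed
  have "circ a' = circ c"
  proof -
    have "(snd d + snd x) *\<^sub>R circ a' = (snd d + snd x) *\<^sub>R circ c"
      using ea xy(3) unfolding ex by (metis add_left_imp_eq)
    moreover have "snd d + snd x \<noteq> 0" using radius_pos[OF d(1)] radius_pos[OF xy(1)] by simp
    ultimately show ?thesis by simp
  qed
  then obtain n :: int where "a' = c + 2*pi*n" unfolding circ_eq_iff by blast
  then have "circ (a' + \<beta>) = circ (c + \<beta>)" using circ_add_2pi[of "c + \<beta>" n] by (simp add: add_ac)
  then have "fst y = fst d + (snd d + snd y) *\<^sub>R circ (a + \<beta>)" using xy(4) ca2 by simp
  then show ?thesis using that[of y] xy ex by auto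
qed

text \<open>Five steps, an odd number, lead from a neighbour of radius \<open>q\<close> to one of
  radius 1. The last neighbour is thus a different disk, and \<open>neighbour_inner\<close> applies
  to it and the first one.\<close>

lemma no_small_pair:
  assumes d: "d \<in> P" "snd d = q" and e: "e \<in> P" "snd e = q" "tangent d e"
  shows False
proof -
  obtain a where a: "fst e = fst d + (snd d + snd e) *\<^sub>R circ a" using neighbour_direction d(1) e(1,3) .
  obtain e1 where e1: "e1 \<in> P" "fst e1 = fst d + (snd d + snd e1) *\<^sub>R circ (a + \<beta>)" "snd e1 = 1"
    using next_neighbour[OF d e(1) a] e(2) q by auto
  obtain e2 where e2: "e2 \<in> P" "fst e2 = fst d + (snd d + snd e2) *\<^sub>R circ (a + \<beta> + \<beta>)" "snd e2 = q"
    using next_neighbour[OF d e1(1,2)] e1(3) q by auto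
  obtain e3 where e3: "e3 \<in> P" "fst e3 = fst d + (snd d + snd e3) *\<^sub>R circ (a + \<beta> + \<beta> + \<beta>)" "snd e3 = 1"
    using next_neighbour[OF d e2(1,2)] e2(3) q by auto
  obtain e4 where e4: "e4 \<in> P" "fst e4 = fst d + (snd d + snd e4) *\<^sub>R circ (a + \<beta> + \<beta> + \<beta> + \<beta>)" "snd e4 = q"
    using next_neighbour[OF d e3(1,2)] e3(3) q by auto
  obtain e5 where e5: "e5 \<in> P" "fst e5 = fst d + (snd d + snd e5) *\<^sub>R circ (a + \<beta> + \<beta> + \<beta> + \<beta> + \<beta>)" "snd e5 = 1"
    using next_neighbour[OF d e4(1,2)] e4(3) q by auto
  \<comment> \<open>Both bounds on \<open>\<beta>\<close> enter: \<open>?z < \<beta>\<close> amounts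
    to \<open>\<beta> < pi/2\<close>, and \<open>-?z < \<beta>\<close> to
    \<open>pi/3 < \<beta>\<close>.\<close>
  let ?z = "5*\<beta> - 2*pi"
  have ne: "e5 \<noteq> e" using e5(3) e(2) q by auto
  have "(q+1) * (q+q) * cos ((a + \<beta> + \<beta> + \<beta> + \<beta> + \<beta>) - a) \<le> (q+1)*(q+q) - 2*1*q"
    using neighbour_inner[OF d(1) e5(1) e(1) ne e5(2) a] unfolding d(2) e(2) e5(3) .
  also have "(a + \<beta> + \<beta> + \<beta> + \<beta> + \<beta>) - a = ?z + 2*pi" by simp
  also have "cos (?z + 2*pi) = cos \<bar>?z\<bar>" by (simp only: cos_periodic cos_abs_real)
  also have "(q+1)*(q+q) - 2*1*q = (q+1)*(q+q) * cos \<beta>" unfolding beta(1) using q by (simp add: field_simps)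
  finally have "cos \<bar>?z\<bar> \<le> cos \<beta>" using q by (simp add: mult_le_cancel_left)
  moreover have "\<bar>?z\<bar> < \<beta>" using beta(2,3) unfolding abs_less_iff by linarith
  then have "cos \<beta> < cos \<bar>?z\<bar>" using beta(3) pi_gt_zero by (intro cos_monotone_0_pi) linarith+
  ultimately show False by simp
qed

end

section \<open>Fundamental regions of a lattice\<close>


lemma lattice_countable: "countable (lattice_of u v)"
proof -
  have "lattice_of u v = (\<lambda>(m,n). of_int m *\<^sub>R u + of_int n *\<^sub>R v) ` (UNIV :: (int \<times> int) set)"
    by (auto simp: lattice_of_def)
  then show ?thesis by simp
qed

lemma lattice_uminus: "a \<in> lattice_of u v \<Longrightarrow> - a \<in> lattice_of u v"
  unfolding lattice_of_def
  by clarsimp (metis (no_types, opaque_lifting) add_uminus_conv_diff minus_add_distrib of_int_minus scaleR_minus_left)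

locale plane_lattice =
  fixes u v :: plane
  assumes indep: "u \<noteq> v" "independent {u, v}"
begin

abbreviation "L \<equiv> lattice_of u v"
abbreviation "D \<equiv> fundamental_region u v"

lemma coords_unique:
  assumes "a *\<^sub>R u + b *\<^sub>R v = a' *\<^sub>R u + b' *\<^sub>R v"
  shows "a = a'" "b = b'"
proof -
  have eq: "(a - a') *\<^sub>R u + (b - b') *\<^sub>R v = 0" using assms by (simp add: algebra_simps)
  let ?c = "\<lambda>x. if x = u then a - a' else b - b'"
  have "(\<Sum>x\<in>{u,v}. ?c x *\<^sub>R x) = 0" using eq indep(1) by auto
  moreover have "\<forall>c. (\<Sum>x\<in>{u,v}. c x *\<^sub>R x) = 0 \<longrightarrow> (\<forall>x\<in>{u,v}. c x = 0)"
    using indep(2) unfolding independent_explicit by (rule conjunct2)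
  ultimately have "\<forall>x\<in>{u,v}. ?c x = 0" by (rule_tac mp[OF spec[of _ ?c]])
  then show "a = a'" "b = b'" using indep(1) by (auto split: if_splits)
qed

lemma coords_exist:
  obtains a b where "(x::plane) = a *\<^sub>R u + b *\<^sub>R v"
proof -
  have "card {u, v} = 2" using indep(1) by simp
  then have "UNIV \<subseteq> span {u, v}"
    using card_eq_dim[of "{u,v}" UNIV] indep(2) by (simp add: dim_UNIV) 
  then have "x \<in> span {u, v}" by blast
  then show ?thesis using that unfolding span_insert span_singleton
    by (auto simp: algebra_simps)
qed

lemma fundamental_unique: "\<exists>!l. l \<in> L \<and> x - l \<in> D"
proof -
  obtain a b where x: "x = a *\<^sub>R u + b *\<^sub>R v" using coords_exist .
  let ?l = "of_int \<lfloor>a\<rfloor> *\<^sub>R u + of_int \<lfloor>b\<rfloor> *\<^sub>R v"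
  show ?thesis
  proof (rule ex1I)
    have "x - ?l = (a - of_int \<lfloor>a\<rfloor>) *\<^sub>R u + (b - of_int \<lfloor>b\<rfloor>) *\<^sub>R v" unfolding x by (simp add: algebra_simps)
    moreover have "0 \<le> a - of_int \<lfloor>a\<rfloor>" "a - of_int \<lfloor>a\<rfloor> < 1" "0 \<le> b - of_int \<lfloor>b\<rfloor>" "b - of_int \<lfloor>b\<rfloor> < 1"
      by linarith+
    ultimately have "x - ?l \<in> D" unfolding fundamental_region_def by blast
    then show "?l \<in> L \<and> x - ?l \<in> D" unfolding lattice_of_def by blast
  next
    fix l assume "l \<in> L \<and> x - l \<in> D"
    then obtain m n :: int and c d where l: "l = of_int m *\<^sub>R u + of_int n *\<^sub>R v"
      and cd: "x - l = c *\<^sub>R u + d *\<^sub>R v" "0 \<le> c" "c < 1" "0 \<le> d" "d < 1"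
      unfolding lattice_of_def fundamental_region_def by blast
    have "a *\<^sub>R u + b *\<^sub>R v = (of_int m + c) *\<^sub>R u + (of_int n + d) *\<^sub>R v"
      using cd(1) unfolding x l by (simp add: algebra_simps)
    then have "a = of_int m + c" "b = of_int n + d" using coords_unique by blast+
    then have "\<lfloor>a\<rfloor> = m" "\<lfloor>b\<rfloor> = n" using cd by (auto intro: floor_unique)
    then show "l = ?l" using l by simp
  qed
qed

lemma fundamental_lmeasurable: "D \<in> lmeasurable"
proof -
  let ?f = "\<lambda>x::plane. (x$1) *\<^sub>R u + (x$2) *\<^sub>R v"
  let ?B = "{x::plane. 0 \<le> x$1 \<and> x$1 < 1 \<and> 0 \<le> x$2 \<and> x$2 < 1}"
  have D: "D = ?f ` ?B"
  proof
    show "?f ` ?B \<subseteq> D" unfolding fundamental_region_def by blast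
    show "D \<subseteq> ?f ` ?B"
    proof
      fix x assume "x \<in> D"
      then obtain a b where "x = a *\<^sub>R u + b *\<^sub>R v" "0 \<le> a" "a < 1" "0 \<le> b" "b < 1"
        unfolding fundamental_region_def by blast
      then show "x \<in> ?f ` ?B" by (intro image_eqI[of _ _ "vector [a, b]"]) auto
    qed
  qed
  have B: "?B \<in> lmeasurable"
  proof (rule bounded_set_imp_lmeasurable)
    have "?B \<subseteq> cbox 0 1" by (auto simp: mem_box_cart forall_2)
    then show "bounded ?B" using bounded_cbox bounded_subset by blast
    have "?B \<in> sets borel" by measurable
    then show "?B \<in> sets lebesgue" by simp
  qed
  have lin: "linear ?f" by (intro linearI) (simp_all add: algebra_simps)
  show ?thesis unfolding D by (rule measurable_linear_image[OF lin B])
qed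

lemma emeasure_translate:
  fixes S :: "plane set"
  assumes "S \<in> sets lebesgue"
  shows "emeasure lebesgue ((\<lambda>x. x + l) ` S) = emeasure lebesgue S"
  using emeasure_lebesgue_affine[of 1 l S] by simp

lemma sets_translate:
  fixes S :: "plane set"
  assumes "S \<in> sets lebesgue"
  shows "(\<lambda>x. x + l) ` S \<in> sets lebesgue"
  using lebesgue_sets_translation[OF assms, of l] by (simp add: add.commute)

text \<open>\<open>A \<inter> D\<close> is cut into pieces by the translates of \<open>G\<close>.
  Moving each piece back by its lattice vector cuts \<open>A \<inter> G\<close> into pieces by the
  translates of \<open>D\<close>, and both decompositions are countable and disjoint.\<close>

lemma emeasure_fundamental:
  fixes G N A :: "plane set"
  assumes G: "G \<in> sets lebesgue" and N: "negligible N" and A: "A \<in> sets lebesgue"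
    and inv: "\<And>x l. l \<in> L \<Longrightarrow> x \<in> A \<Longrightarrow> x + l \<in> A"
    and ex: "\<And>x. x \<notin> N \<Longrightarrow> \<exists>l\<in>L. x - l \<in> G"
    and un: "\<And>x l l'. l \<in> L \<Longrightarrow> l' \<in> L \<Longrightarrow> x - l \<in> G \<Longrightarrow> x - l' \<in> G \<Longrightarrow> l = l'"
  shows "emeasure lebesgue (A \<inter> D) = emeasure lebesgue (A \<inter> G)"
proof -
  have Ds: "D \<in> sets lebesgue" using fundamental_lmeasurable by blast
  have tG: "(\<lambda>x. x + l) ` G \<in> sets lebesgue" and tD: "(\<lambda>x. x + l) ` D \<in> sets lebesgue" for l
    using G Ds sets_translate by blast+
  have mem: "x \<in> (\<lambda>x. x + l) ` S \<longleftrightarrow> x - l \<in> S" for x l and S :: "plane set"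
    by (metis (no_types, lifting) add_diff_cancel_right' diff_add_cancel image_iff)
  have invm: "x - l \<in> A" if "l \<in> L" "x \<in> A" for x l
    using inv[OF lattice_uminus[OF that(1)] that(2)] by simp
  have "emeasure lebesgue (A \<inter> D) = emeasure lebesgue (\<Union>l\<in>L. A \<inter> D \<inter> (\<lambda>x. x + l) ` G)"
  proof (rule emeasure_eq_AE)
    have "AE x in lebesgue. x \<notin> N"
      using N by (intro AE_not_in) (simp add: negligible_iff_null_sets)
    moreover have "x \<in> A \<inter> D \<longleftrightarrow> x \<in> (\<Union>l\<in>L. A \<inter> D \<inter> (\<lambda>x. x + l) ` G)" if "x \<notin> N" for x
      unfolding UN_iff Int_iff mem using ex[OF that] by blast
    ultimately show "AE x in lebesgue. x \<in> A \<inter> D \<longleftrightarrow> x \<in> (\<Union>l\<in>L. A \<inter> D \<inter> (\<lambda>x. x + l) ` G)"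
      by (rule eventually_mono)
    show "A \<inter> D \<in> sets lebesgue" using A Ds by simp
    show "(\<Union>l\<in>L. A \<inter> D \<inter> (\<lambda>x. x + l) ` G) \<in> sets lebesgue"
      using A Ds tG by (intro sets.countable_UN' lattice_countable) auto
  qed
  also have "\<dots> = (\<integral>\<^sup>+l. emeasure lebesgue (A \<inter> D \<inter> (\<lambda>x. x + l) ` G) \<partial>count_space L)"
  proof (rule emeasure_UN_countable)
    show "disjoint_family_on (\<lambda>l. A \<inter> D \<inter> (\<lambda>x. x + l) ` G) L"
      unfolding disjoint_family_on_def disjoint_iff Int_iff mem using un by blast
    show "A \<inter> D \<inter> (\<lambda>x. x + l) ` G \<in> sets lebesgue" for l using A Ds tG by blast
  qed (rule lattice_countable)
  also have "\<dots> = (\<integral>\<^sup>+l. emeasure lebesgue (A \<inter> G \<inter> (\<lambda>x. x + (- l)) ` D) \<partial>count_space L)"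
  proof (rule nn_integral_cong)
    fix l assume "l \<in> space (count_space L)"
    then have l: "l \<in> L" by simp
    have "A \<inter> D \<inter> (\<lambda>x. x + l) ` G = (\<lambda>x. x + l) ` (A \<inter> G \<inter> (\<lambda>x. x + (- l)) ` D)"
    proof (rule set_eqI)
      fix x
      have "x \<in> A \<longleftrightarrow> x - l \<in> A" using invm[OF l, of x] inv[OF l, of "x - l"] by auto
      then show "x \<in> A \<inter> D \<inter> (\<lambda>x. x + l) ` G \<longleftrightarrow> x \<in> (\<lambda>x. x + l) ` (A \<inter> G \<inter> (\<lambda>x. x + (- l)) ` D)"
        unfolding Int_iff mem by auto
    qed
    moreover have "A \<inter> G \<inter> (\<lambda>x. x + (- l)) ` D \<in> sets lebesgue" using A G tD by blast
    ultimately show "emeasure lebesgue (A \<inter> D \<inter> (\<lambda>x. x + l) ` G) = emeasure lebesgue (A \<inter> G \<inter> (\<lambda>x. x + (- l)) ` D)"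
      using emeasure_translate by metis
  qed
  also have "\<dots> = emeasure lebesgue (\<Union>l\<in>L. A \<inter> G \<inter> (\<lambda>x. x + (- l)) ` D)"
  proof (rule emeasure_UN_countable[symmetric])
    show "disjoint_family_on (\<lambda>l. A \<inter> G \<inter> (\<lambda>x. x + (- l)) ` D) L"
    proof (unfold disjoint_family_on_def, intro ballI impI)
      fix l l' assume l: "l \<in> L" "l' \<in> L" "l \<noteq> l'"
      have False if "x + l \<in> D" "x + l' \<in> D" for x
      proof -
        have "x - (- l) \<in> D" "x - (- l') \<in> D" using that by simp_all
        moreover have "- l \<in> L" "- l' \<in> L" using l lattice_uminus by blast+
        ultimately have "- l = - l'" using fundamental_unique[of x] by blast
        then show False using l by simp
      qed
      then show "(A \<inter> G \<inter> (\<lambda>x. x + (- l)) ` D) \<inter> (A \<inter> G \<inter> (\<lambda>x. x + (- l')) ` D) = {}"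
        unfolding disjoint_iff Int_iff mem by auto
    qed
    show "A \<inter> G \<inter> (\<lambda>x. x + (- l)) ` D \<in> sets lebesgue" for l using A G tD by blast
  qed (rule lattice_countable)
  also have "(\<Union>l\<in>L. A \<inter> G \<inter> (\<lambda>x. x + (- l)) ` D) = A \<inter> G"
  proof
    show "A \<inter> G \<subseteq> (\<Union>l\<in>L. A \<inter> G \<inter> (\<lambda>x. x + (- l)) ` D)"
    proof
      fix x assume x: "x \<in> A \<inter> G"
      obtain l where "l \<in> L" "x - l \<in> D" using fundamental_unique[of x] by blast
      then have "- l \<in> L" "x \<in> (\<lambda>x. x + (- (- l))) ` D" using lattice_uminus by (auto simp: mem)
      then show "x \<in> (\<Union>l\<in>L. A \<inter> G \<inter> (\<lambda>x. x + (- l)) ` D)" using x by blast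
    qed
  qed blast
  finally show ?thesis .
qed

end

section \<open>Density of a periodic packing\<close>


text \<open>The face-wise bounds are summed in \<open>ennreal\<close>, which covers a countable
  family without any question of convergence.\<close>

lemma emeasure_Union_density:
  fixes A :: "plane set"
  assumes "countable \<H>" "disjoint \<H>" and meas: "\<And>F. F \<in> \<H> \<Longrightarrow> F \<in> lmeasurable"
    and A: "A \<in> sets lebesgue" and k: "0 \<le> k"
    and le: "\<And>F. F \<in> \<H> \<Longrightarrow> measure lebesgue (A \<inter> F) \<le> k * measure lebesgue F"
  shows "emeasure lebesgue (A \<inter> \<Union>\<H>) \<le> ennreal k * emeasure lebesgue (\<Union>\<H>)"
proof -
  have dj: "disjoint_family_on (\<lambda>F. A \<inter> F) \<H>" "disjoint_family_on (\<lambda>F. F) \<H>"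
    using assms(2) unfolding disjoint_family_on_def disjoint_def by blast+
  have AF: "A \<inter> F \<in> lmeasurable" if "F \<in> \<H>" for F
    using fmeasurable_Int_fmeasurable[OF meas[OF that] A] by (simp add: Int_commute)
  have eq: "A \<inter> \<Union>\<H> = (\<Union>F\<in>\<H>. A \<inter> F)" by blast
  have "emeasure lebesgue (A \<inter> \<Union>\<H>) = emeasure lebesgue (\<Union>F\<in>\<H>. A \<inter> F)"
    unfolding eq ..
  also have "\<dots> = (\<integral>\<^sup>+F. emeasure lebesgue (A \<inter> F) \<partial>count_space \<H>)"
    using AF by (intro emeasure_UN_countable dj assms(1)) auto
  also have "\<dots> \<le> (\<integral>\<^sup>+F. ennreal k * emeasure lebesgue F \<partial>count_space \<H>)"
  proof (rule nn_integral_mono)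
    fix F assume "F \<in> space (count_space \<H>)"
    then have F: "F \<in> \<H>" by simp
    have "ennreal (measure lebesgue (A \<inter> F)) \<le> ennreal (k * measure lebesgue F)"
      using le[OF F] by (rule ennreal_leI)
    then show "emeasure lebesgue (A \<inter> F) \<le> ennreal k * emeasure lebesgue F"
      using emeasure_eq_measure2[OF AF[OF F]] emeasure_eq_measure2[OF meas[OF F]] k by (simp add: ennreal_mult)
  qed
  also have "\<dots> = ennreal k * (\<integral>\<^sup>+F. emeasure lebesgue F \<partial>count_space \<H>)"
    by (rule nn_integral_cmult) simp
  also have "(\<integral>\<^sup>+F. emeasure lebesgue F \<partial>count_space \<H>) = emeasure lebesgue (\<Union>F\<in>\<H>. F)"
    using meas by (intro emeasure_UN_countable[symmetric] dj assms(1)) auto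
  finally show ?thesis by simp
qed

text \<open>Any map from faces to points that commutes with translations would do here.\<close>

definition corner :: "plane set \<Rightarrow> plane" where
  "corner F = (\<chi> i. Inf ((\<lambda>x. x $ i) ` F))"

lemma corner_translate:
  assumes "F \<noteq> {}" "bounded F"
  shows "corner ((\<lambda>x. x + l) ` F) = corner F + l"
proof -
  have "Inf ((\<lambda>x. x $ i) ` (\<lambda>x. x + l) ` F) = Inf ((\<lambda>x. x $ i) ` F) + l $ i" for i
  proof (rule cInf_eq_non_empty)
    obtain b where b: "\<And>x. x \<in> F \<Longrightarrow> norm x \<le> b" using assms(2) unfolding bounded_iff by blast
    have "- b \<le> x $ i" if "x \<in> F" for x
      using component_le_norm_cart[of x i] b[OF that] by linarith
    then have bdd: "bdd_below ((\<lambda>x. x $ i) ` F)" by (intro bdd_belowI2)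
    show "Inf ((\<lambda>x. x $ i) ` F) + l $ i \<le> y" if "y \<in> (\<lambda>x. x $ i) ` (\<lambda>x. x + l) ` F" for y
      using that cInf_lower[OF _ bdd] by force
    show "y \<le> Inf ((\<lambda>x. x $ i) ` F) + l $ i" if y: "\<And>x. x \<in> (\<lambda>x. x $ i) ` (\<lambda>x. x + l) ` F \<Longrightarrow> y \<le> x" for y
    proof -
      have "y - l $ i \<le> z" if z: "z \<in> (\<lambda>x. x $ i) ` F" for z
      proof -
        obtain x where x: "x \<in> F" "z = x $ i" using z by blast
        have "y \<le> (x + l) $ i" by (rule y) (use x in blast)
        then show ?thesis using x by simp
      qed
      then have "y - l $ i \<le> Inf ((\<lambda>x. x $ i) ` F)" using assms(1) by (intro cInf_greatest) auto
      then show ?thesis by simp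
    qed
  qed (use assms in simp)
  then show ?thesis by (simp add: corner_def vec_eq_iff)
qed

section \<open>The drawing and its faces under lattice translations\<close>

locale periodic_packing = packing P + plane_lattice u v for P u v +
  assumes periodic: "l \<in> L \<Longrightarrow> (\<lambda>(c, r). (c + l, r)) ` P = P"
    and fin: "finite {d \<in> P. fst d \<in> D}"
    and tri: "triangulated P"
begin

lemma translate_disk: "l \<in> L \<Longrightarrow> d \<in> P \<Longrightarrow> (fst d + l, snd d) \<in> P"
  using periodic[of l] by (force simp: case_prod_unfold)

text \<open>Every disk is a lattice translate of one of the finitely many disks centered in
  \<open>D\<close>.\<close>

lemma countable_disks: "countable P"
proof (rule countable_subset)
  show "P \<subseteq> (\<lambda>(l, d). (fst d + l, snd d)) ` (L \<times> {d \<in> P. fst d \<in> D})"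
  proof
    fix d assume d: "d \<in> P"
    obtain l where l: "l \<in> L" "fst d - l \<in> D" using fundamental_unique[of "fst d"] by blast
    have "(fst d + - l, snd d) \<in> P" using translate_disk[OF lattice_uminus[OF l(1)] d] .
    then show "d \<in> (\<lambda>(l, d). (fst d + l, snd d)) ` (L \<times> {d \<in> P. fst d \<in> D})"
      using l by (intro image_eqI[of _ _ "(l, (fst d - l, snd d))"]) auto
  qed
  show "countable ((\<lambda>(l, d). (fst d + l, snd d)) ` (L \<times> {d \<in> P. fst d \<in> D}))"
    using lattice_countable countable_finite[OF fin] by (intro countable_image countable_SIGMA) auto
qed

abbreviation "\<G> \<equiv> contact_graph_drawing P"
abbreviation "faces \<equiv> contact_graph_faces P"
abbreviation "covered \<equiv> (\<Union>d\<in>P. disk_set d)"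

lemma negligible_drawing: "negligible \<G>"
proof -
  have "negligible (closed_segment a b)" for a b :: plane
    using negligible_convex_interior[OF convex_closed_segment, of a b] interior_closed_segment_ge2[of a b] by simp
  moreover have "countable {closed_segment (fst d) (fst e) |d e. d \<in> P \<and> e \<in> P \<and> tangent d e}"
  proof (rule countable_subset)
    show "{closed_segment (fst d) (fst e) |d e. d \<in> P \<and> e \<in> P \<and> tangent d e} \<subseteq> (\<lambda>(d,e). closed_segment (fst d) (fst e)) ` (P \<times> P)"
    proof
      fix x assume "x \<in> {closed_segment (fst d) (fst e) |d e. d \<in> P \<and> e \<in> P \<and> tangent d e}"
      then obtain d e where "x = closed_segment (fst d) (fst e)" "d \<in> P" "e \<in> P" by blast
      then show "x \<in> (\<lambda>(d,e). closed_segment (fst d) (fst e)) ` (P \<times> P)"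
        by (intro image_eqI[of _ _ "(d, e)"]) simp_all
    qed
  qed (use countable_disks in auto)
  ultimately have "negligible (\<Union>{closed_segment (fst d) (fst e) |d e. d \<in> P \<and> e \<in> P \<and> tangent d e})"
    by (intro negligible_countable_Union) auto
  moreover have "negligible (fst ` P)"
  proof -
    have "negligible (\<Union>((\<lambda>d. {fst d}) ` P))"
      using countable_disks by (intro negligible_countable_Union) auto
    then show ?thesis by (simp add: UNION_singleton_eq_range)
  qed
  ultimately show ?thesis unfolding contact_graph_drawing_def by (rule negligible_Un[rotated])
qed

lemma translate_drawing:
  assumes l: "l \<in> L" and x: "x \<in> \<G>"
  shows "x + l \<in> \<G>"
proof -
  consider d where "d \<in> P" "x = fst d"
    | d e where "d \<in> P" "e \<in> P" "tangent d e" "x \<in> closed_segment (fst d) (fst e)"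
    using x unfolding contact_graph_drawing_def by blast
  then show ?thesis
  proof cases
    case (1 d)
    then have "x + l = fst (fst d + l, snd d)" by simp
    then show ?thesis unfolding contact_graph_drawing_def using translate_disk[OF l 1(1)] by blast
  next
    case (2 d e)
    let ?d = "(fst d + l, snd d)" and ?e = "(fst e + l, snd e)"
    have "l + x \<in> closed_segment (l + fst d) (l + fst e)"
      using 2(4) by (simp add: closed_segment_translation)
    then have "x + l \<in> closed_segment (fst ?d) (fst ?e)" by (simp add: add.commute)
    moreover have "tangent ?d ?e" using 2(3) by (simp add: tangent_def)
    ultimately show ?thesis unfolding contact_graph_drawing_def
      using translate_disk[OF l 2(1)] translate_disk[OF l 2(2)] by blast
  qed
qed

text \<open>Faces are the maximal connected subsets of the complement of the drawing. Maximality of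
  the translate is seen by moving a larger connected set back by \<open>-l\<close>.\<close>

lemma translate_face:
  assumes l: "l \<in> L" and F: "F \<in> faces"
  shows "(\<lambda>x. x + l) ` F \<in> faces"
proof -
  have tr: "(\<lambda>x. x + l) ` S \<subseteq> - \<G>" if "l \<in> L" "S \<subseteq> - \<G>" for S l
  proof
    fix y assume "y \<in> (\<lambda>x. x + l) ` S"
    then obtain x where "x \<in> S" "y = x + l" by blast
    then show "y \<in> - \<G>" using translate_drawing[OF lattice_uminus[OF that(1)], of y] that(2) by auto
  qed
  have conn: "connected ((\<lambda>x. x + l) ` S)" if "connected S" for l and S :: "plane set"
    using that by (intro connected_continuous_image continuous_intros)
  have Fc: "F \<noteq> {}" "F \<subseteq> - \<G>" "connected F" "\<And>S. S \<noteq> {} \<Longrightarrow> F \<subseteq> S \<Longrightarrow> S \<subseteq> - \<G> \<Longrightarrow> connected S \<Longrightarrow> S = F"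
    using F unfolding contact_graph_faces_def in_components_maximal by blast+
  have ml: "- l \<in> L" using lattice_uminus[OF l] .
  have cancel: "(\<lambda>x. x + l) ` (\<lambda>x. x + (- l)) ` S = S" "(\<lambda>x. x + (- l)) ` (\<lambda>x. x + l) ` S = S" for S :: "plane set"
    by (simp_all add: image_image)
  have "S = (\<lambda>x. x + l) ` F" if S: "S \<noteq> {}" "(\<lambda>x. x + l) ` F \<subseteq> S" "S \<subseteq> - \<G>" "connected S" for S
  proof -
    have "(\<lambda>x. x + (- l)) ` (\<lambda>x. x + l) ` F \<subseteq> (\<lambda>x. x + (- l)) ` S" using S(2) by (rule image_mono)
    then have "(\<lambda>x. x + (- l)) ` S = F"
      unfolding cancel by (intro Fc(4) tr[OF ml S(3)] conn[OF S(4)]) (use S(1) in auto)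
    then show ?thesis using cancel(1)[of S] by simp
  qed
  then show ?thesis unfolding contact_graph_faces_def in_components_maximal
    using Fc(1) tr[OF l Fc(2)] conn[OF Fc(3)] by blast
qed

lemma face_triangle:
  assumes "F \<in> faces"
  obtains d1 d2 d3 where "d1 \<in> P" "d2 \<in> P" "d3 \<in> P" "mutually_tangent d1 d2 d3" "F = interior (convex hull {fst d1, fst d2, fst d3})"
  using tri assms unfolding triangulated_def mutually_tangent_def by blast

lemma face_basic:
  assumes F: "F \<in> faces"
  shows "open F" "F \<noteq> {}" "bounded F" "F \<in> lmeasurable"
proof -
  obtain d1 d2 d3 where t: "d1 \<in> P" "d2 \<in> P" "d3 \<in> P" "mutually_tangent d1 d2 d3" "F = interior (convex hull {fst d1, fst d2, fst d3})"
    using face_triangle[OF F] .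
  show "open F" using t(5) by simp
  show "F \<noteq> {}" using F unfolding contact_graph_faces_def by (rule in_components_nonempty)
  have "bounded (convex hull {fst d1, fst d2, fst d3})" by (intro bounded_convex_hull) simp
  then show "bounded F" unfolding t(5) by (rule bounded_interior)
  show "F \<in> lmeasurable" using face_measure(1)[OF t] .
qed

lemma disjoint_faces: "disjoint faces"
  unfolding contact_graph_faces_def using pairwise_disjoint_components 
  by (auto simp: disjoint_def pairwise_def disjnt_def)

lemma faces_eqI:
  assumes "F \<in> faces" "F' \<in> faces" "x \<in> F" "x \<in> F'"
  shows "F = F'"
proof (rule ccontr)
  assume "F \<noteq> F'"
  then have "F \<inter> F' = {}" using disjoint_faces assms(1,2) unfolding disjoint_def by simp
  then show False using assms(3,4) by blast
qed

lemma countable_faces: "countable faces"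
  using disjoint_faces face_basic(1)
  by (intro countable_disjoint_open_subsets) (auto simp: disjoint_def pairwise_def disjnt_def)

lemma covered_sets: "covered \<in> sets lebesgue"
  by (intro sets.countable_UN' countable_disks) (auto simp: disk_set_def)

lemma translate_covered:
  assumes "l \<in> L" "x \<in> covered"
  shows "x + l \<in> covered"
proof -
  obtain d where d: "d \<in> P" "x \<in> disk_set d" using assms by blast
  then have "x + l \<in> disk_set (fst d + l, snd d)" by (simp add: disk_set_def dist_norm algebra_simps)
  then show ?thesis using translate_disk[OF assms(1) d(1)] by blast
qed

definition rep :: "plane set" where
  "rep = \<Union>{F \<in> faces. corner F \<in> D}"

lemma rep_sets: "rep \<in> sets lebesgue"
proof -
  have "open rep" unfolding rep_def using face_basic(1) by blast
  then show ?thesis by simp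
qed

text \<open>A point off the drawing lies in one face, and exactly one lattice vector brings the
  corner of that face into \<open>D\<close>. Uniqueness holds because translated faces that share a
  point coincide and so have the same corner.\<close>

lemma emeasure_rep:
  assumes A: "A \<in> sets lebesgue" and inv: "\<And>x l. l \<in> L \<Longrightarrow> x \<in> A \<Longrightarrow> x + l \<in> A"
  shows "emeasure lebesgue (A \<inter> D) = emeasure lebesgue (A \<inter> rep)"
proof (rule emeasure_fundamental[OF rep_sets negligible_drawing A inv])
  have shift: "(\<lambda>x. x + (- l)) ` F \<in> faces" "corner ((\<lambda>x. x + (- l)) ` F) = corner F - l" if "l \<in> L" "F \<in> faces" for l F
    using translate_face[OF lattice_uminus[OF that(1)] that(2)] corner_translate[of F "- l"] face_basic[OF that(2)] by auto
  show "\<exists>l\<in>L. x - l \<in> rep" if nx: "x \<notin> \<G>" for x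
  proof -
    obtain F where F: "F \<in> faces" "x \<in> F" using face_cover[OF nx] .
    obtain l where l: "l \<in> L" "corner F - l \<in> D" using fundamental_unique[of "corner F"] by blast
    have "x + (- l) \<in> (\<lambda>x. x + (- l)) ` F" using F(2) by blast
    then have "x - l \<in> rep" unfolding rep_def using shift[OF l(1) F(1)] l(2) by auto
    then show ?thesis using l(1) by blast
  qed
  show "l = l'" if l: "l \<in> L" "l' \<in> L" and x: "x - l \<in> rep" "x - l' \<in> rep" for x l l'
  proof -
    obtain F F' where F: "F \<in> faces" "corner F \<in> D" "x - l \<in> F" "F' \<in> faces" "corner F' \<in> D" "x - l' \<in> F'"
      using x unfolding rep_def by blast
    let ?H = "(\<lambda>x. x + l) ` F" and ?H' = "(\<lambda>x. x + l') ` F'"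
    have "x \<in> ?H" by (rule image_eqI[of _ _ "x - l"]) (use F in simp_all)
    moreover have "x \<in> ?H'" by (rule image_eqI[of _ _ "x - l'"]) (use F in simp_all)
    ultimately have "?H = ?H'"
      by (rule faces_eqI[OF translate_face[OF l(1) F(1)] translate_face[OF l(2) F(4)]])
    then have c: "corner F + l = corner F' + l'"
      using corner_translate[of F l] corner_translate[of F' l'] face_basic[OF F(1)] face_basic[OF F(4)] by simp
    have "corner F + l - l \<in> D" "corner F + l - l' \<in> D" using F(2,5) by (simp, simp add: c)
    then show "l = l'" using fundamental_unique[of "corner F + l"] l by blast
  qed
qed

end

section \<open>Adding up the faces of one period\<close>

locale bounded_radii_packing = periodic_packing P u v for P u v +
  fixes q :: real
  assumes q: "0 < q" "q < 1" and radii: "d \<in> P \<Longrightarrow> snd d \<in> {q..1}"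
begin

lemma face_density:
  assumes F: "F \<in> faces"
  shows "measure lebesgue (covered \<inter> F) < s q * measure lebesgue F \<or>
    (measure lebesgue (covered \<inter> F) \<le> s q * measure lebesgue F \<and>
     (\<exists>d1\<in>P. \<exists>d2\<in>P. \<exists>d3\<in>P. mutually_tangent d1 d2 d3 \<and> F = interior (convex hull {fst d1, fst d2, fst d3}) \<and>
        {#snd d1, snd d2, snd d3#} = {#q, q, 1#}))"
proof -
  obtain d1 d2 d3 where t: "d1 \<in> P" "d2 \<in> P" "d3 \<in> P" "mutually_tangent d1 d2 d3" "F = interior (convex hull {fst d1, fst d2, fst d3})"
    using face_triangle[OF F] .
  have "F \<inter> covered \<in> sets lebesgue" using covered_sets face_basic(4)[OF F] by blast
  then have "measure lebesgue (covered \<inter> F) \<le> sector_sum (snd d1) (snd d2) (snd d3)"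
    using face_covered_measure[OF t face_disjoint_centers[OF F]] by (simp add: Int_commute)
  moreover have "measure lebesgue F = tri_area (snd d1) (snd d2) (snd d3)" using face_measure(2)[OF t] .
  ultimately have le: "sector_sum (snd d1) (snd d2) (snd d3) < s q * tri_area (snd d1) (snd d2) (snd d3) \<Longrightarrow>
      measure lebesgue (covered \<inter> F) < s q * measure lebesgue F"
    and eq: "sector_sum (snd d1) (snd d2) (snd d3) = s q * tri_area (snd d1) (snd d2) (snd d3) \<Longrightarrow>
      measure lebesgue (covered \<inter> F) \<le> s q * measure lebesgue F"
    by simp_all
  from florian_bound[OF q radii[OF t(1)] radii[OF t(2)] radii[OF t(3)]] show ?thesis
  proof
    assume "{#snd d1, snd d2, snd d3#} = {#q, q, 1#} \<and>
      sector_sum (snd d1) (snd d2) (snd d3) = s q * tri_area (snd d1) (snd d2) (snd d3)"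
    then show ?thesis using eq t by blast
  qed (use le in blast)
qed

lemma strict_face_exists:
  "\<exists>F\<in>faces. measure lebesgue (covered \<inter> F) < s q * measure lebesgue F"
proof (rule ccontr)
  assume no: "\<not> ?thesis"
  have ex: "\<exists>d1\<in>P. \<exists>d2\<in>P. \<exists>d3\<in>P. mutually_tangent d1 d2 d3 \<and> F = interior (convex hull {fst d1, fst d2, fst d3}) \<and>
        {#snd d1, snd d2, snd d3#} = {#q, q, 1#}" if "F \<in> faces" for F
    using face_density[OF that] no that by blast
  interpret extremal_packing P q
    by unfold_locales (rule q, rule q, erule radii, erule ex)
  \<comment> \<open>A face exists at all because the drawing is a null set and so misses some point;
    that face supplies two tangent disks of radius \<open>q\<close>.\<close>
  have "\<not> negligible (UNIV :: plane set)" by (rule open_not_negligible) auto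
  then obtain x where "x \<notin> \<G>" using negligible_drawing by (metis UNIV_eq_I)
  then obtain F where "F \<in> faces" using face_cover by blast
  then obtain d1 d2 d3 where t: "d1 \<in> P" "d2 \<in> P" "d3 \<in> P" "mutually_tangent d1 d2 d3" "{#snd d1, snd d2, snd d3#} = {#q, q, 1#}"
    using ex by blast
  have "(snd d1 = q \<and> snd d2 = q) \<or> (snd d2 = q \<and> snd d3 = q) \<or> (snd d3 = q \<and> snd d1 = q)"
    using t(5) by (auto simp: add_eq_conv_ex)
  then show False using no_small_pair t unfolding mutually_tangent_def by blast
qed

text \<open>A strict face is translated so that its corner lies in \<open>D\<close>, which makes it
  one of the faces of \<open>rep\<close>. The other faces satisfy the non-strict bound, and since
  \<open>rep\<close> has finite measure, adding them preserves strictness.\<close>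

lemma covered_rep_less: "measure lebesgue (covered \<inter> rep) < s q * measure lebesgue rep"
  and rep_pos: "0 < measure lebesgue rep"
proof -
  have "emeasure lebesgue D = emeasure lebesgue rep" using emeasure_rep[of UNIV] by simp
  then have rm: "rep \<in> lmeasurable"
    using fundamental_lmeasurable rep_sets by (auto simp: fmeasurable_def)
  obtain F0 where F0: "F0 \<in> faces" "measure lebesgue (covered \<inter> F0) < s q * measure lebesgue F0"
    using strict_face_exists by blast
  obtain l where l: "l \<in> L" "corner F0 - l \<in> D" using fundamental_unique[of "corner F0"] by blast
  define F where "F = (\<lambda>x. x + (- l)) ` F0"
  have ml: "- l \<in> L" using lattice_uminus[OF l(1)] .
  have F: "F \<in> faces" unfolding F_def using translate_face[OF ml F0(1)] .
  have Fc: "corner F \<in> D" unfolding F_def using corner_translate[of F0 "- l"] face_basic[OF F0(1)] l(2) by simp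
  have mt: "measure lebesgue ((\<lambda>x. x + (- l)) ` S) = measure lebesgue S" for S
    using measure_translation[of "- l" S] by (simp add: add.commute)
  have cF: "covered \<inter> F = (\<lambda>x. x + (- l)) ` (covered \<inter> F0)"
  proof
    show "(\<lambda>x. x + (- l)) ` (covered \<inter> F0) \<subseteq> covered \<inter> F"
      unfolding F_def using translate_covered[OF ml] by blast
    show "covered \<inter> F \<subseteq> (\<lambda>x. x + (- l)) ` (covered \<inter> F0)"
    proof
      fix y assume y: "y \<in> covered \<inter> F"
      then obtain x where x: "x \<in> F0" "y = x + (- l)" unfolding F_def by blast
      have "y + l \<in> covered" using translate_covered[OF l(1)] y by blast
      then show "y \<in> (\<lambda>x. x + (- l)) ` (covered \<inter> F0)" using x by auto
    qed
  qed
  have less: "measure lebesgue (covered \<inter> F) < s q * measure lebesgue F"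
    using F0(2) unfolding cF unfolding F_def mt .
  define \<H> where "\<H> = {F \<in> faces. corner F \<in> D} - {F}"
  have rep: "rep = F \<union> \<Union>\<H>" unfolding rep_def \<H>_def using F Fc by blast
  have dj: "F \<inter> \<Union>\<H> = {}" unfolding \<H>_def using faces_eqI[OF F] by blast
  have opn: "open (\<Union>\<H>)" unfolding \<H>_def using face_basic(1) by blast
  have Hm: "\<Union>\<H> \<in> lmeasurable"
    using rm opn by (rule_tac fmeasurableI2[OF rm]) (auto simp: rep)
  have Fm: "F \<in> lmeasurable" using face_basic(4)[OF F] .
  have sq: "0 \<le> s q"
  proof -
    have "0 \<le> q/(1+q)" "q/(1+q) \<le> 1" using q by (auto simp: field_simps)
    then have "0 \<le> arcsin (q/(1+q))" using arcsin_le_arcsin[of 0 "q/(1+q)"] by simp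
    moreover have "0 \<le> 1 - q^2" using q by (simp add: power_le_one)
    ultimately show ?thesis unfolding s_def using q by (intro divide_nonneg_nonneg add_nonneg_nonneg mult_nonneg_nonneg) auto
  qed
  have cH: "covered \<inter> \<Union>\<H> \<in> lmeasurable" "covered \<inter> F \<in> lmeasurable"
    using fmeasurable_Int_fmeasurable[OF Hm covered_sets] fmeasurable_Int_fmeasurable[OF Fm covered_sets]
    by (simp_all add: Int_commute)
  have "emeasure lebesgue (covered \<inter> \<Union>\<H>) \<le> ennreal (s q) * emeasure lebesgue (\<Union>\<H>)"
  proof (rule emeasure_Union_density[OF _ _ _ covered_sets sq])
    show "countable \<H>" unfolding \<H>_def using countable_faces by (rule countable_subset[rotated]) blast
    show "disjoint \<H>" unfolding \<H>_def using disjoint_faces by (auto simp: disjoint_def)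
    show "F \<in> lmeasurable" if "F \<in> \<H>" for F using face_basic(4) that unfolding \<H>_def by blast
    show "measure lebesgue (covered \<inter> F) \<le> s q * measure lebesgue F" if "F \<in> \<H>" for F
      using face_density[of F] that unfolding \<H>_def by auto
  qed
  then have "ennreal (measure lebesgue (covered \<inter> \<Union>\<H>)) \<le> ennreal (s q * measure lebesgue (\<Union>\<H>))"
    using emeasure_eq_measure2[OF cH(1)] emeasure_eq_measure2[OF Hm] sq by (simp add: ennreal_mult)
  then have le: "measure lebesgue (covered \<inter> \<Union>\<H>) \<le> s q * measure lebesgue (\<Union>\<H>)"
    using sq by (simp add: ennreal_le_iff)
  have "measure lebesgue rep = measure lebesgue F + measure lebesgue (\<Union>\<H>)"
    unfolding rep using measure_Un2[OF Fm Hm] dj by (simp add: Diff_triv Int_commute)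
  moreover have "measure lebesgue (covered \<inter> rep) = measure lebesgue (covered \<inter> F) + measure lebesgue (covered \<inter> \<Union>\<H>)"
  proof -
    have "covered \<inter> rep = (covered \<inter> F) \<union> (covered \<inter> \<Union>\<H>)" unfolding rep by blast
    moreover have "(covered \<inter> \<Union>\<H>) - (covered \<inter> F) = covered \<inter> \<Union>\<H>" using dj by blast
    ultimately show ?thesis using measure_Un2[OF cH(2,1)] by simp
  qed
  ultimately show lt: "measure lebesgue (covered \<inter> rep) < s q * measure lebesgue rep"
    using less le by (simp add: distrib_left)
  \<comment> \<open>The strict inequality itself shows that \<open>rep\<close> has positive area,
    since the covered area is nonnegative.\<close>
  have "0 < s q * measure lebesgue rep" using lt measure_nonneg by (rule le_less_trans[rotated])
  then show "0 < measure lebesgue rep" using sq by (simp add: zero_less_mult_iff)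
qed

lemma density_less: "packing_density u v P < s q"
proof -
  have c: "emeasure lebesgue (covered \<inter> D) = emeasure lebesgue (covered \<inter> rep)"
  proof (rule emeasure_rep)
    show "x + l \<in> covered" if "l \<in> L" "x \<in> covered" for x l
      using that by (rule translate_covered)
  qed (rule covered_sets)
  have "emeasure lebesgue D = emeasure lebesgue rep" using emeasure_rep[of UNIV] by simp
  then have d: "measure lebesgue D = measure lebesgue rep" by (simp add: measure_def)
  have "measure lebesgue (D \<inter> covered) = measure lebesgue (covered \<inter> rep)"
    unfolding measure_def Int_commute[of D] c ..
  then have "packing_density u v P = measure lebesgue (covered \<inter> rep) / measure lebesgue rep"
    unfolding packing_density_def d by (simp only:)
  also have "\<dots> < s q"
    using covered_rep_less rep_pos by (simp only: pos_divide_less_eq)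
  finally show ?thesis .
qed

end

theorem theorem2p5:
  fixes q \<delta> :: real and P :: "disk set" and u v :: plane
  assumes "0 < q" and "q < 1"
    and "disk_packing P"
    and "doubly_periodic u v P"
    and "triangulated P"
    and "\<forall>d\<in>P. snd d \<in> {q..1}"
    and "\<delta> = packing_density u v P"
  shows "\<delta> < s q"
proof -
  interpret bounded_radii_packing P u v q
  proof
    show "disk_packing P" "u \<noteq> v" "independent {u, v}" "finite {d \<in> P. fst d \<in> fundamental_region u v}"
      "triangulated P" "0 < q" "q < 1"
      using assms unfolding doubly_periodic_def by blast+
    show "(\<lambda>(c, r). (c + l, r)) ` P = P" if "l \<in> lattice_of u v" for l
      using assms(4) that unfolding doubly_periodic_def by blast
    show "snd d \<in> {q..1}" if "d \<in> P" for d using assms(6) that by blast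
  qed
  show ?thesis using density_less assms(7) by simp
qed

end
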